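(* For each positive integer $m$, as $n \to \infty$, \[ \frac{A_n}{G_n} = e\left( \frac{1}{2} + \sum_{i = 1}^m \frac{1}{\log^ip_n} \left( -r_{i+1} + r_i + \sum_{s=1}^{i-1} r_s k_{i-s} \right) \right) \cdot \exp \left( \sum_{j = 1}^m\frac{k_j}{\log^jp_n} \right) + O \left( \frac{1}{\log^{m+1}p_n} \right). \]
   Context: $p_n$ denotes the $n$-th prime number and $\log$ is the natural logarithm. $A_n = \frac{1}{n}\sum_{k\le n} p_k$ is the arithmetic mean and $G_n = (p_1\cdots p_n)^{1/n}$ the geometric mean of the first $n$ primes. For positive integers $i$, $r_i = (i-1)!\,(1 - 2^{-i})$. The positive integers $k_1, k_2, \ldots$ are defined by the recurrence $k_s + 1!\,k_{s-1} + 2!\,k_{s-2} + \cdots + (s-1)!\,k_1 = s\cdot s!$ for every positive integer $s$ (so $k_1=1$, $k_2=3$, $k_3=13$, $k_4=71$). *)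

theory Defs
  imports Complex_Main
    "HOL-Library.Infinite_Set"
    "HOL-Library.Landau_Symbols"
    "HOL-Computational_Algebra.Primes"
begin

text \<open>Primes are indexed from 1, whereas \<^const>\<open>enumerate\<close> counts from 0; only
  \<open>n \<ge> 1\<close> is meaningful.\<close>

definition nth_prime :: "nat \<Rightarrow> nat" where
  "nth_prime n = enumerate {p. prime p} (n - 1)"

definition arith_mean_primes :: "nat \<Rightarrow> real" where
  "arith_mean_primes n = (\<Sum>k=1..n. real (nth_prime k)) / real n"

definition geom_mean_primes :: "nat \<Rightarrow> real" where
  "geom_mean_primes n = root n (\<Prod>k=1..n. real (nth_prime k))"

definition r_coeff :: "nat \<Rightarrow> real" where
  "r_coeff i = fact (i - 1) * (1 - 1 / 2 ^ i)"

text \<open>The recurrence is solved for its leading term. Values are integers so that the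
  subtraction is not truncated; the value at index 0 is never used.\<close>

fun k_coeff :: "nat \<Rightarrow> int" where
  "k_coeff s = int s * fact s - (\<Sum>j=1..s-1. fact j * k_coeff (s - j))"

declare k_coeff.simps [simp del]

lemma k_coeff_recurrence:
  assumes "s \<ge> 1"
  shows "(\<Sum>j=0..s-1. fact j * k_coeff (s - j)) = int s * fact s"
proof -
  have "(\<Sum>j=0..s-1. fact j * k_coeff (s - j)) = k_coeff s + (\<Sum>j=1..s-1. fact j * k_coeff (s - j))"
    by (subst sum.atLeast_Suc_atMost) auto
  then show ?thesis
    using k_coeff.simps[of s] by simp
qed

lemma k_coeff_values:
  "k_coeff 1 = 1" "k_coeff 2 = 3" "k_coeff 3 = 13" "k_coeff 4 = 71"
proof -
  show 1: "k_coeff 1 = 1" by (subst k_coeff.simps) simp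
  show 2: "k_coeff 2 = 3" using 1 by (subst k_coeff.simps) (simp add: numeral_eq_Suc)
  show 3: "k_coeff 3 = 13" using 1 2 by (subst k_coeff.simps) (simp add: numeral_eq_Suc)
  show "k_coeff 4 = 71" using 1 2 3 by (subst k_coeff.simps) (simp add: numeral_eq_Suc)
qed

end

theory Submission
  imports
    Defs
    "HOL-Complex_Analysis.Complex_Analysis"
    "HOL-Number_Theory.Prime_Powers"
    "HOL-Probability.Probability"
    "HOL-Real_Asymp.Real_Asymp"
begin

text \<open>
  Everything rests on the prime number theorem with error \<open>O(x / log\<^sup>j x)\<close> for every \<open>j\<close>.
  The function \<open>(s - 1) \<zeta>(s)\<close> extends to \<open>Re s > 0\<close>, and the 3-4-1 inequality bounds it below by
  a power \<open>|t|\<^bsup>1-\<epsilon>\<^esup>\<close> slightly to the left of \<open>Re s = 1\<close>. So all derivatives of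
  \<open>(- \<zeta>'/\<zeta>(s) - 1/(s - 1)) / (s (s + 1))\<close> are uniformly integrable on vertical lines \<open>Re s > 1\<close>.
  Perron's formula expresses the first Riesz mean of \<open>\<Lambda>\<close> through the integral of this function against
  \<open>x\<^sup>s\<close>; integrating by parts \<open>k\<close> times gains \<open>log\<^sup>-\<^sup>k x\<close>, so no contour has to be moved,
  and monotonicity removes the averaging.

  Partial summation then expands \<open>\<pi>(x)\<close> and \<open>\<Sum>\<^bsub>p \<le> x\<^esub> p\<close> in powers of \<open>y = 1 / log x\<close>. At \<open>x = p\<^sub>n\<close>,
  where \<open>\<pi>(x) = n\<close> and \<open>log G\<^sub>n = \<theta>(x) / n\<close>, the recurrence for \<open>k\<^sub>j\<close> says that
  \<open>1 - y - \<Sum> k\<^sub>j y\<^bsup>j+1\<^esup>\<close> is the formal reciprocal of \<open>\<Sum> i! y\<^sup>i\<close>; this gives the expansions of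
  \<open>log G\<^sub>n\<close> and of \<open>A\<^sub>n / p\<^sub>n\<close>.
\<close>

subsection \<open>Fourier inversion\<close>

text \<open>As \<open>m\<close> is arbitrary, the error for primes has to beat every fixed power of
  log x. Polynomial losses in the height are affordable provided that their exponent can be made
  small: with T = |t| + 2, k derivatives are paid for by Cauchy estimates on discs of radius about
  T^(- 10 e), at a cost of T^(10 e k), and e is chosen after k so that the decay T^(-2) of 1/(s (s +
  1)) still leaves the integrable T^(-3/2). These bounds must be uniform as Re s tends to 1 from the
  right, since the line of integration is taken at 1 + 1/(2 + log x), where x^s has size O(x). The
  Riesz mean replaces psi because its kernel is absolutely integrable with a continuous Fourier
  transform, so that inversion holds at every point; undoing the average halves the number of
  logarithms saved. Finally, log G_n is of the order of log p_n itself, and multiplying an expansion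
  by log p_n loses one order.\<close>

lemma integral_iexp_std_normal_density:
  "(LBINT z. iexp (w * z) * complex_of_real (std_normal_density z)) = complex_of_real (exp (- w\<^sup>2 / 2))"
proof -
  have "char std_normal_distribution w = (LBINT z. std_normal_density z *\<^sub>R iexp (w * z))"
    unfolding char_def
    by (subst integral_density) (auto simp: normal_density_nonneg)
  also have "\<dots> = (LBINT z. iexp (w * z) * complex_of_real (std_normal_density z))"
    by (intro Bochner_Integration.integral_cong) (auto simp: scaleR_conv_of_real mult.commute)
  finally show ?thesis
    by (simp add: char_std_normal_distribution)
qed

lemma integrable_std_normal_density: "integrable lborel std_normal_density"
  using integrable_normal_density[of 1 0] by simp

text \<open>Gaussian summation: inserting \<open>?phi (e * t)\<close> into the integral of
  \<open>K\<close> and exchanging integrals turns it into an average of \<open>k\<close> around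
  \<open>y\<close> at scale \<open>e\<close>. Continuity and boundedness of \<open>k\<close> let
  \<open>e\<close> tend to 0 at every single point, not just almost everywhere.\<close>

lemma fourier_inversion:
  fixes k K :: "real \<Rightarrow> complex"
  assumes cont: "continuous_on UNIV k" and bd: "\<And>u. norm (k u) \<le> B"
    and int: "integrable lborel k"
    and K: "\<And>t. K t = (LBINT u. k u * iexp (- (t * u)))"
    and intK: "integrable lborel K"
  shows "(LBINT t. K t * iexp (t * y)) = 2 * pi * k y"
proof -
  let ?phi = std_normal_density
  note [measurable] = borel_measurable_continuous_onI[OF cont]
  have [measurable]: "K \<in> borel_measurable borel" using intK by auto
  have phi_le: "?phi z \<le> ?phi 0" for z
    by (simp add: std_normal_density_def divide_simps)
  have phi_cont: "isCont ?phi z" for z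
    unfolding std_normal_density_def by (intro continuous_intros) auto
  have key: "(LBINT t. K t * iexp (t * y) * ?phi (e * t)) = sqrt (2*pi) * (LBINT z. k (y - e * z) * ?phi z)"
    if "e > 0" for e :: real
  proof -
    have inner: "(LBINT t. iexp (t * (y - u)) * complex_of_real (?phi (e * t)))
        = complex_of_real (sqrt (2*pi) / e * ?phi ((y - u) / e))" for u
    proof -
      have "(LBINT t. iexp (t * (y - u)) * complex_of_real (?phi (e * t)))
          = \<bar>1/e\<bar> *\<^sub>R (LBINT z. iexp ((y - u) / e * z) * complex_of_real (?phi z))"
        using that
        by (subst lborel_integral_real_affine[of "1/e" _ 0]) (auto simp: field_simps)
      also have "\<dots> = complex_of_real (1/e * exp (- ((y - u) / e)\<^sup>2 / 2))"
        using that by (subst integral_iexp_std_normal_density) (simp add: scaleR_conv_of_real)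
      finally show ?thesis
        using that by (simp add: std_normal_density_def)
    qed
    let ?f = "\<lambda>t u. k u * iexp (t * (y - u)) * complex_of_real (?phi (e * t))"
    have intphi: "integrable lborel (\<lambda>t. ?phi (e * t))"
      using lborel_integrable_real_affine[OF integrable_std_normal_density, of e 0] that by simp
    have int2: "integrable (lborel \<Otimes>\<^sub>M lborel) (case_prod ?f)"
    proof (rule lborel_pair.Fubini_integrable)
      show "case_prod ?f \<in> borel_measurable (lborel \<Otimes>\<^sub>M lborel)"
        unfolding std_normal_density_def by measurable
      have eq: "(\<lambda>x. LBINT ya. norm (case (x, ya) of (t, u) \<Rightarrow> ?f t u)) = (\<lambda>t. ?phi (e * t) * (LBINT u. norm (k u)))"
        by (auto simp: norm_mult mult.commute)
      show "integrable lborel (\<lambda>x. LBINT ya. norm (case (x, ya) of (t, u) \<Rightarrow> ?f t u))"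
        unfolding eq using intphi by (rule integrable_mult_left)
      show "AE x in lborel. integrable lborel (\<lambda>ya. case (x, ya) of (t, u) \<Rightarrow> ?f t u)"
      proof (rule AE_I2)
        fix t :: real
        have "integrable lborel (\<lambda>u. complex_of_real (?phi (e * t)) * (k u * iexp (t * (y - u))))"
          by (intro integrable_mult_right Bochner_Integration.integrable_bound[OF int]) (auto simp: norm_mult)
        thus "integrable lborel (\<lambda>ya. case (t, ya) of (t, u) \<Rightarrow> ?f t u)"
          by (simp add: mult_ac)
      qed
    qed
    have "(LBINT t. K t * iexp (t * y) * ?phi (e * t)) = (LBINT t. LBINT u. ?f t u)"
    proof (rule Bochner_Integration.integral_cong[OF refl])
      fix t :: real
      have "K t * iexp (t * y) * ?phi (e * t) = (LBINT u. (k u * iexp (- (t * u))) * (iexp (t * y) * ?phi (e * t)))"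
        unfolding K by (simp only: mult.assoc integral_mult_left_zero[symmetric])
      also have "\<dots> = (LBINT u. ?f t u)"
        by (intro Bochner_Integration.integral_cong refl)
           (auto simp: algebra_simps exp_add[symmetric] exp_diff exp_minus field_simps)
      finally show "K t * iexp (t * y) * ?phi (e * t) = (LBINT u. ?f t u)" .
    qed
    also have "\<dots> = (LBINT u. LBINT t. ?f t u)"
      using lborel_pair.Fubini_integral[OF int2] by simp
    also have "\<dots> = (LBINT u. k u * (sqrt (2*pi) / e * ?phi ((y - u) / e)))"
      by (intro Bochner_Integration.integral_cong refl) (simp only: mult.assoc integral_mult_right_zero inner)
    also have "\<dots> = \<bar>-e\<bar> *\<^sub>R (LBINT z. k (y + (-e) * z) * (sqrt (2*pi) / e * ?phi ((y - (y + (-e) * z)) / e)))"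
      using that by (subst lborel_integral_real_affine[of "-e" _ y]) auto
    also have "\<dots> = \<bar>-e\<bar> *\<^sub>R (LBINT z. complex_of_real (sqrt (2*pi) / e) * (k (y - e * z) * ?phi z))"
      using that by (intro arg_cong[where f="\<lambda>x. \<bar>-e\<bar> *\<^sub>R x"] Bochner_Integration.integral_cong refl) (auto simp: mult_ac)
    also have "\<dots> = sqrt (2*pi) * (LBINT z. k (y - e * z) * ?phi z)"
      using that by (simp add: scaleR_conv_of_real)
    finally show ?thesis .
  qed
  define e where "e = (\<lambda>n::nat. 1 / real (Suc n))"
  have e0: "e \<longlonglongrightarrow> 0" unfolding e_def by (rule LIMSEQ_Suc[OF lim_1_over_n])
  have epos: "e n > 0" for n by (simp add: e_def)
  have L: "(\<lambda>n. LBINT t. K t * iexp (t * y) * ?phi (e n * t)) \<longlonglongrightarrow> (LBINT t. K t * iexp (t * y) * ?phi 0)"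
  proof (rule integral_dominated_convergence)
    show "integrable lborel (\<lambda>t. norm (K t) * ?phi 0)"
      using intK by (intro integrable_mult_left integrable_norm)
    show "AE t in lborel. (\<lambda>n. K t * iexp (t * y) * ?phi (e n * t)) \<longlonglongrightarrow> K t * iexp (t * y) * ?phi 0"
    proof (rule AE_I2)
      fix t
      have "(\<lambda>n. e n * t) \<longlonglongrightarrow> 0 * t" by (intro tendsto_intros e0)
      hence "(\<lambda>n. ?phi (e n * t)) \<longlonglongrightarrow> ?phi 0"
        using isCont_tendsto_compose[OF phi_cont] by force
      thus "(\<lambda>n. K t * iexp (t * y) * ?phi (e n * t)) \<longlonglongrightarrow> K t * iexp (t * y) * ?phi 0"
        by (intro tendsto_intros)
    qed
    show "AE t in lborel. norm (K t * iexp (t * y) * ?phi (e n * t)) \<le> norm (K t) * ?phi 0" for n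
      using phi_le by (auto simp: norm_mult intro!: mult_left_mono)
  qed auto
  have R: "(\<lambda>n. LBINT z. k (y - e n * z) * ?phi z) \<longlonglongrightarrow> (LBINT z. k y * ?phi z)"
  proof (rule integral_dominated_convergence)
    show "integrable lborel (\<lambda>z. B * ?phi z)"
      by (intro integrable_mult_right integrable_std_normal_density)
    show "AE z in lborel. (\<lambda>n. k (y - e n * z) * ?phi z) \<longlonglongrightarrow> k y * ?phi z"
    proof (rule AE_I2)
      fix z
      have "(\<lambda>n. y - e n * z) \<longlonglongrightarrow> y - 0 * z" by (intro tendsto_intros e0)
      hence "(\<lambda>n. k (y - e n * z)) \<longlonglongrightarrow> k y"
        using isCont_tendsto_compose[of y k "\<lambda>n. y - e n * z" sequentially] cont
        by (simp add: continuous_on_eq_continuous_at)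
      thus "(\<lambda>n. k (y - e n * z) * ?phi z) \<longlonglongrightarrow> k y * ?phi z"
        by (intro tendsto_intros)
    qed
    show "AE z in lborel. norm (k (y - e n * z) * ?phi z) \<le> B * ?phi z" for n
      using bd by (auto simp: norm_mult intro!: mult_right_mono)
  qed auto
  have one: "(LBINT z. complex_of_real (?phi z)) = 1"
    using integral_iexp_std_normal_density[of 0] by simp
  have "(LBINT t. K t * iexp (t * y) * ?phi 0) = sqrt (2*pi) * (LBINT z. k y * ?phi z)"
    using LIMSEQ_unique[OF L] tendsto_mult_left[OF R, of "complex_of_real (sqrt (2*pi))"] key[OF epos]
    by simp
  also have "\<dots> = sqrt (2*pi) * k y"
    by (simp add: one)
  \<comment> \<open>\<open>?phi 0\<close> is 1 / sqrt (2 pi); moved to the other side it supplies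
    the second factor sqrt (2 pi).\<close>
  also have "(LBINT t. K t * iexp (t * y) * ?phi 0) = (LBINT t. K t * iexp (t * y)) * (1 / sqrt (2 * pi))"
    by (subst integral_mult_left_zero[symmetric]) (simp add: std_normal_density_def)
  finally have "(LBINT t. K t * iexp (t * y)) = sqrt (2*pi) * (sqrt (2*pi) * k y)"
    by (simp add: field_simps)
  also have "\<dots> = complex_of_real (sqrt (2*pi) * sqrt (2*pi)) * k y"
    by (simp only: of_real_mult mult.assoc)
  finally show ?thesis by simp
qed

lemma LBINT_exp_ray:
  fixes c :: complex
  assumes "Re c > 0"
  shows "integrable lborel (\<lambda>u. indicator {0<..} u *\<^sub>R exp (- c * complex_of_real u))"
    and "(LBINT u. indicator {0<..} u *\<^sub>R exp (- c * complex_of_real u)) = 1 / c"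
proof -
  have ein: "einterval 0 \<infinity> = {0<..}" by (auto simp: einterval_def)
  have lim: "((\<lambda>u. exp (- Re c * u)) \<longlongrightarrow> 0) at_top"
    using assms by real_asymp
  have "set_integrable lborel (einterval 0 \<infinity>) (\<lambda>u. Re c * exp (- Re c * u))"
  proof (rule interval_integral_FTC_nonneg[where F="\<lambda>u. - exp (- Re c * u)" and A = "-1" and B = 0])
    show "(((\<lambda>u. - exp (- Re c * u)) \<circ> real_of_ereal) \<longlongrightarrow> - 1) (at_right 0)"
      unfolding zero_ereal_def ereal_tendsto_simps
      by (rule tendsto_eq_intros refl | simp)+
    show "(((\<lambda>u. - exp (- Re c * u)) \<circ> real_of_ereal) \<longlongrightarrow> 0) (at_left \<infinity>)"
      unfolding ereal_tendsto_simps using tendsto_minus[OF lim] by simp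
  qed (use assms in \<open>auto intro!: derivative_eq_intros\<close>)
  hence "set_integrable lborel {0<..} (\<lambda>u. exp (- Re c * u))"
    using assms by (simp add: ein)
  hence "integrable lborel (\<lambda>u. indicator {0<..} u *\<^sub>R exp (- Re c * u))"
    by (simp add: set_integrable_def)
  thus int: "integrable lborel (\<lambda>u. indicator {0<..} u *\<^sub>R exp (- c * complex_of_real u))"
    by (rule Bochner_Integration.integrable_bound) (auto simp: indicator_def)
  have "(LBINT u=0..\<infinity>. exp (- c * complex_of_real u)) = 0 - (- 1 / c)"
  proof (rule interval_integral_FTC_integrable[where F="\<lambda>u. - exp (- c * complex_of_real u) / c"])
    have c: "c \<noteq> 0" using assms by auto
    show "((\<lambda>u. - exp (- c * complex_of_real u) / c) has_vector_derivative exp (- c * complex_of_real x)) (at x)" for x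
      by (rule has_vector_derivative_real_field) (use c in \<open>auto intro!: derivative_eq_intros\<close>)
    show "set_integrable lborel (einterval 0 \<infinity>) (\<lambda>u. exp (- c * complex_of_real u))"
      using int by (simp add: ein set_integrable_def)
    show "(((\<lambda>u. - exp (- c * complex_of_real u) / c) \<circ> real_of_ereal) \<longlongrightarrow> - 1 / c) (at_right 0)"
      unfolding zero_ereal_def ereal_tendsto_simps using c
      by (auto intro!: tendsto_eq_intros)
    have "((\<lambda>u. exp (- c * complex_of_real u)) \<longlongrightarrow> 0) at_top"
      by (rule tendsto_norm_zero_cancel) (use lim in simp)
    from tendsto_divide[OF tendsto_minus[OF this] tendsto_const c]
    show "(((\<lambda>u. - exp (- c * complex_of_real u) / c) \<circ> real_of_ereal) \<longlongrightarrow> 0) (at_left \<infinity>)"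
      unfolding ereal_tendsto_simps by simp
  qed (auto intro!: continuous_intros)
  thus "(LBINT u. indicator {0<..} u *\<^sub>R exp (- c * complex_of_real u)) = 1 / c"
    by (simp add: interval_lebesgue_integral_def ein set_lebesgue_integral_def)
qed

text \<open>The Perron-type kernels needed are exponential sums on the positive half line that vanish
  at the origin, so that the inversion formula applies pointwise.\<close>

lemma exp_sum_inversion:
  fixes c :: "nat \<Rightarrow> real" and l :: "nat \<Rightarrow> real" and N :: nat
  assumes l: "\<And>j. j < N \<Longrightarrow> l j > 0" and c: "(\<Sum>j<N. c j) = 0"
    and intK: "integrable lborel (\<lambda>t. \<Sum>j<N. complex_of_real (c j) / Complex (l j) t)"
  shows "(LBINT t. (\<Sum>j<N. complex_of_real (c j) / Complex (l j) t) * iexp (t * y))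
       = 2 * pi * complex_of_real (if y \<le> 0 then 0 else \<Sum>j<N. c j * exp (- l j * y))"
proof (rule fourier_inversion[where B="\<Sum>j<N. \<bar>c j\<bar>", OF _ _ _ _ intK])
  let ?k = "\<lambda>y. complex_of_real (if y \<le> 0 then 0 else \<Sum>j<N. c j * exp (- l j * y))"
  have "continuous_on UNIV (\<lambda>y::real. if y \<le> 0 then 0 else \<Sum>j<N. c j * exp (- l j * y))"
  proof -
    \<comment> \<open>Since the \<open>c j\<close> add up to 0, the sum vanishes at the origin, and
      clamping the argument reproduces the cut-off; this is where continuity comes from.\<close>
    have eq: "(\<lambda>y::real. if y \<le> 0 then 0 else \<Sum>j<N. c j * exp (- l j * y)) = (\<lambda>y. \<Sum>j<N. c j * exp (- l j * max y 0))"
      by (auto simp: c max_def)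
    show ?thesis unfolding eq by (intro continuous_intros)
  qed
  thus "continuous_on UNIV ?k" by (intro continuous_intros)
  show "norm (?k u) \<le> (\<Sum>j<N. \<bar>c j\<bar>)" for u
  proof (cases "u \<le> 0")
    case False
    have "\<bar>\<Sum>j<N. c j * exp (- l j * u)\<bar> \<le> (\<Sum>j<N. \<bar>c j * exp (- l j * u)\<bar>)" by (rule sum_abs)
    also have "\<dots> \<le> (\<Sum>j<N. \<bar>c j\<bar>)"
      using False l by (intro sum_mono) (auto simp: abs_mult intro!: mult_left_le simp: less_imp_le)
    finally show ?thesis using False by (simp only: norm_of_real if_False)
  qed (auto intro: sum_nonneg)
  have ray: "integrable lborel (\<lambda>u. indicator {0<..} u *\<^sub>R exp (- Complex (l j) t * complex_of_real u))"
            "(LBINT u. indicator {0<..} u *\<^sub>R exp (- Complex (l j) t * complex_of_real u)) = 1 / Complex (l j) t"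
    if "j < N" for j t
    using LBINT_exp_ray[of "Complex (l j) t"] l[OF that] by auto
  have keq: "?k u * iexp (- (t * u)) = (\<Sum>j<N. c j * (indicator {0<..} u *\<^sub>R exp (- Complex (l j) t * complex_of_real u)))" for u t
  proof (cases "u \<le> 0")
    case False
    thus ?thesis
      by (auto simp: sum_distrib_right exp_of_real[symmetric] mult.assoc exp_add[symmetric] complex_eq_iff
               intro!: sum.cong arg_cong[where f=exp]) (auto simp: Complex_eq algebra_simps)
  qed auto
  show "(\<Sum>j<N. complex_of_real (c j) / Complex (l j) t) = (LBINT u. ?k u * iexp (- (t * u)))" for t
  proof -
    have "(LBINT u. ?k u * iexp (- (t * u)))
        = (\<Sum>j<N. LBINT u. c j * (indicator {0<..} u *\<^sub>R exp (- Complex (l j) t * complex_of_real u)))"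
      unfolding keq by (intro Bochner_Integration.integral_sum integrable_mult_right ray) simp
    also have "\<dots> = (\<Sum>j<N. complex_of_real (c j) / Complex (l j) t)"
      by (intro sum.cong refl) (simp only: integral_mult_right_zero ray lessThan_iff, simp)
    finally show ?thesis ..
  qed
  show "integrable lborel ?k"
  proof -
    have "integrable lborel (\<lambda>u. ?k u * iexp (- (0 * u)))"
      unfolding keq using ray by (intro Bochner_Integration.integrable_sum integrable_mult_right) auto
    thus ?thesis by simp
  qed
qed

text \<open>One derivative in t is traded for a factor \<open>- \<i> * y\<close>; with y = ln x each
  application saves a logarithm. The decay of \<open>f\<close> at both ends kills the boundary
  terms.\<close>

lemma fourier_by_parts:
  fixes f f' :: "real \<Rightarrow> complex"
  assumes der: "\<And>t. (f has_vector_derivative f' t) (at t)" and cont: "continuous_on UNIV f'"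
    and int: "integrable lborel f" and int': "integrable lborel f'"
    and top: "(f \<longlongrightarrow> 0) at_top" and bot: "(f \<longlongrightarrow> 0) at_bot"
  shows "(LBINT t. f' t * iexp (t * y)) = - \<i> * y * (LBINT t. f t * iexp (t * y))"
proof -
  have contf: "isCont f t" for t
    using der has_vector_derivative_continuous by blast
  have [measurable]: "f \<in> borel_measurable borel" "f' \<in> borel_measurable borel"
    using int int' by auto
  let ?g = "\<lambda>t. f' t * iexp (t * y) + \<i> * y * (f t * iexp (t * y))"
  have i: "integrable lborel (\<lambda>t. f t * iexp (t * y))" "integrable lborel (\<lambda>t. f' t * iexp (t * y))"
    by (rule Bochner_Integration.integrable_bound[OF int] Bochner_Integration.integrable_bound[OF int'];
        auto simp: norm_mult)+
  have intg: "integrable lborel ?g"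
    by (intro Bochner_Integration.integrable_add integrable_mult_right i)
  have "(LBINT t=-\<infinity>..\<infinity>. ?g t) = 0 - 0"
  proof (rule interval_integral_FTC_integrable[where F="\<lambda>t. f t * iexp (t * y)"])
    show "((\<lambda>t. f t * iexp (t * y)) has_vector_derivative ?g t) (at t)" for t
      by (rule has_vector_derivative_eq_rhs)
         (rule derivative_intros der has_vector_derivative_real_field | simp)+
    show "set_integrable lborel (einterval (- \<infinity>) \<infinity>) ?g"
      using intg by (simp add: set_integrable_def einterval_def)
    show "isCont ?g t" for t
      using cont contf by (auto intro!: continuous_intros simp: continuous_on_eq_continuous_at)
    show "(((\<lambda>t. f t * iexp (t * y)) \<circ> real_of_ereal) \<longlongrightarrow> 0) (at_right (- \<infinity>))"
      unfolding ereal_tendsto_simps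
      by (rule tendsto_norm_zero_cancel) (use tendsto_norm_zero[OF bot] in \<open>simp add: norm_mult\<close>)
    show "(((\<lambda>t. f t * iexp (t * y)) \<circ> real_of_ereal) \<longlongrightarrow> 0) (at_left \<infinity>)"
      unfolding ereal_tendsto_simps
      by (rule tendsto_norm_zero_cancel) (use tendsto_norm_zero[OF top] in \<open>simp add: norm_mult\<close>)
  qed auto
  hence "integral\<^sup>L lborel ?g = 0"
    by (simp add: interval_lebesgue_integral_def set_lebesgue_integral_def einterval_def)
  also have "integral\<^sup>L lborel ?g = (LBINT t. f' t * iexp (t * y)) + \<i> * y * (LBINT t. f t * iexp (t * y))"
    by (subst Bochner_Integration.integral_add[OF i(2) integrable_mult_right[OF i(1)]]) simp
  finally show ?thesis by (simp add: add_eq_0_iff)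
qed

lemma integrable_abs_plus_2_powr:
  fixes a :: real
  assumes "a < -1"
  shows "integrable lborel (\<lambda>t. (\<bar>t\<bar> + 2) powr a)"
proof -
  have "(\<lambda>x. x powr a) integrable_on {2..}"
    using has_integral_powr_to_inf[of a 2] assms by (auto simp: integrable_on_def)
  hence "(\<lambda>x. x powr a) absolutely_integrable_on {2..}"
    by (intro nonnegative_absolutely_integrable_1) auto
  hence "set_integrable lborel {2..} (\<lambda>x::real. x powr a)"
    by (subst (asm) set_integrable_def, subst (asm) integrable_completion)
       (auto simp: set_integrable_def)
  hence 1: "integrable lborel (\<lambda>x::real. indicator {2..} x * x powr a)"
    by (simp add: set_integrable_def)
  have 2: "integrable lborel (\<lambda>t::real. indicator {2..} (2 + t) * (2 + t) powr a)"
          "integrable lborel (\<lambda>t::real. indicator {2..} (2 - t) * (2 - t) powr a)"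
    using lborel_integrable_real_affine[OF 1, of 1 2] lborel_integrable_real_affine[OF 1, of "-1" 2] by auto
  show ?thesis
    by (rule Bochner_Integration.integrable_bound[OF Bochner_Integration.integrable_add[OF 2]])
       (auto simp: indicator_def add.commute abs_if)
qed

subsection \<open>Dirichlet series and the logarithm of the zeta function\<close>

text \<open>The term at 0 vanishes since \<open>0 powr z = 0\<close>, so this is the usual sum over
  n \<ge> 1.\<close>

definition dseries :: "(nat \<Rightarrow> real) \<Rightarrow> complex \<Rightarrow> complex" where
  "dseries a s = (\<Sum>n. of_real (a n) * of_nat n powr (- s))"

definition dconv :: "(nat \<Rightarrow> real) \<Rightarrow> bool" where
  "dconv a \<longleftrightarrow> (\<forall>\<sigma>>1. summable (\<lambda>n. \<bar>a n\<bar> * real n powr (- \<sigma>)))"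

lemma norm_nat_powr: "norm (of_nat n powr (- s) :: complex) = real n powr (- Re s)"
  using norm_powr_real_powr[of "of_nat n" "-s"] by (cases "n = 0") auto

lemma dseries_sums:
  assumes "dconv a" "Re s > 1"
  shows "(\<lambda>n. of_real (a n) * of_nat n powr (- s)) sums dseries a s"
    and "summable (\<lambda>n. norm (of_real (a n) * of_nat n powr (- s) :: complex))"
proof -
  show *: "summable (\<lambda>n. norm (of_real (a n) * of_nat n powr (- s) :: complex))"
    using assms by (simp add: norm_mult norm_nat_powr dconv_def)
  show "(\<lambda>n. of_real (a n) * of_nat n powr (- s)) sums dseries a s"
    unfolding dseries_def by (intro summable_sums summable_norm_cancel[OF *])
qed

lemma ln_le_powr:
  assumes "n \<ge> (1::nat)" "e > 0" shows "ln (real n) \<le> real n powr e / e"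
  using ln_powr_bound[of "real n" e] assms by simp

lemma dconv_ln:
  assumes "dconv a" shows "dconv (\<lambda>n. a n * ln (real n))"
  unfolding dconv_def
proof (intro allI impI)
  fix \<sigma> :: real assume s: "\<sigma> > 1"
  \<comment> \<open>Half of the room \<open>\<sigma> - 1\<close> absorbs the logarithm; the series
    at \<open>\<sigma> - e\<close> still converges.\<close>
  define e where "e = (\<sigma> - 1) / 2"
  have e: "e > 0" "\<sigma> - e > 1" using s by (auto simp: e_def field_simps)
  have "summable (\<lambda>n. \<bar>a n\<bar> * real n powr (- (\<sigma> - e)) / e)"
    using assms e by (intro summable_divide) (auto simp: dconv_def)
  thus "summable (\<lambda>n. \<bar>a n * ln (real n)\<bar> * real n powr (- \<sigma>))"
  proof (rule summable_comparison_test'[where N=0])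
    fix n :: nat
    show "norm (\<bar>a n * ln (real n)\<bar> * real n powr (- \<sigma>)) \<le> \<bar>a n\<bar> * real n powr (- (\<sigma> - e)) / e"
    proof (cases "n = 0")
      case False
      have "\<bar>a n\<bar> * ln (real n) * real n powr (- \<sigma>) \<le> \<bar>a n\<bar> * (real n powr e / e) * real n powr (- \<sigma>)"
        using False e ln_le_powr[of n e] by (intro mult_right_mono mult_left_mono) auto
      also have "\<dots> = \<bar>a n\<bar> * real n powr (- (\<sigma> - e)) / e"
        using False by (simp add: powr_add[symmetric])
      finally show ?thesis using False by (simp add: abs_mult)
    qed auto
  qed
qed

lemma dconv_le:
  assumes "dconv b" "\<And>n. \<bar>a n\<bar> \<le> \<bar>b n\<bar>" shows "dconv a"
  unfolding dconv_def
proof (intro allI impI)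
  fix \<sigma> :: real assume s: "\<sigma> > 1"
  have "summable (\<lambda>n. \<bar>b n\<bar> * real n powr (- \<sigma>))" using assms s by (auto simp: dconv_def)
  thus "summable (\<lambda>n. \<bar>a n\<bar> * real n powr (- \<sigma>))"
    by (rule summable_comparison_test') (use assms in \<open>auto intro!: mult_right_mono\<close>)
qed

lemma dconv_1: "dconv (\<lambda>_. 1)"
  by (auto simp: dconv_def summable_real_powr_iff)

text \<open>Weierstrass's test on the half-plane Re z > (1 + Re s)/2, where one convergent series
  dominates the terms. The derivative stays in the class because \<open>dconv\<close> is stable
  under the factor \<open>ln\<close>.\<close>

lemma has_field_derivative_dseries:
  assumes "dconv a" "Re s > 1"
  shows "(dseries a has_field_derivative - dseries (\<lambda>n. a n * ln (real n)) s) (at s)"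
proof -
  define S where "S = {z. Re z > (1 + Re s) / 2}"
  have S: "open S" "s \<in> S" unfolding S_def by (rule open_halfspace_Re_gt) (use assms in simp)
  have S1: "z \<in> S \<Longrightarrow> Re z > 1" for z using assms by (auto simp: S_def)
  let ?f = "\<lambda>n z. of_real (a n) * of_nat n powr (- z) :: complex"
  let ?f' = "\<lambda>n z. - (of_real (a n * ln (real n)) * of_nat n powr (- z)) :: complex"
  have d: "(?f n has_field_derivative ?f' n z) (at z)" for n z
  proof (cases "n = 0")
    case False
    have "((\<lambda>z. of_nat n powr (- z)) has_field_derivative (Ln (of_nat n) * of_nat n powr (- z)) * (- 1)) (at z)"
      by (rule DERIV_chain2[OF has_field_derivative_powr_right]) (use False in \<open>auto intro!: derivative_eq_intros\<close>)
    from DERIV_cmult[OF this, of "of_real (a n)"] show ?thesis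
      using False by (simp add: Ln_of_nat mult_ac)
  qed auto
  obtain g g' where g: "\<And>z. z \<in> S \<Longrightarrow> (\<lambda>n. ?f n z) sums g z \<and> (\<lambda>n. ?f' n z) sums g' z \<and> (g has_field_derivative g' z) (at z)"
  proof (rule series_and_derivative_comparison[OF S(1) _ d])
    show "summable (\<lambda>n. \<bar>a n\<bar> * real n powr (- ((1 + Re s) / 2)))"
      using assms by (auto simp: dconv_def)
    show "\<forall>\<^sub>F n in sequentially. \<forall>z\<in>S. norm (?f n z) \<le> \<bar>a n\<bar> * real n powr (- ((1 + Re s) / 2))"
    proof (intro always_eventually allI ballI)
      fix n z assume "z \<in> S"
      thus "norm (?f n z) \<le> \<bar>a n\<bar> * real n powr (- ((1 + Re s) / 2))"
        by (cases "n = 0") (auto simp: norm_mult norm_nat_powr S_def intro!: mult_left_mono powr_mono)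
    qed
  qed blast
  have "g' s = - dseries (\<lambda>n. a n * ln (real n)) s"
    using g[OF S(2)] sums_minus[OF dseries_sums(1)[OF dconv_ln[OF assms(1)] assms(2)]] sums_unique2 by blast
  moreover have "g z = dseries a z" if "z \<in> S" for z
    using g[OF that] dseries_sums(1)[OF assms(1) S1[OF that]] sums_unique2 by blast
  ultimately show ?thesis
    using has_field_derivative_transform_within_open[OF _ S, of g "g' s" "dseries a"] g[OF S(2)] by simp
qed

section \<open>The zeta function, the von Mangoldt function and the 3-4-1 inequality\<close>

abbreviation zeta :: "complex \<Rightarrow> complex" where "zeta \<equiv> dseries (\<lambda>_. 1)"

lemma mangoldt_le_ln: "n \<ge> 1 \<Longrightarrow> (mangoldt n :: real) \<le> ln (real n)"
proof -
  assume n: "n \<ge> 1"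
  have "(mangoldt n :: real) \<le> (\<Sum>d | d dvd n. mangoldt d)"
    using n by (intro member_le_sum) (auto simp: mangoldt_nonneg)
  thus ?thesis using mangoldt_sum[of n, where ?'a = real] n by simp
qed

lemma dconv_mangoldt: "dconv mangoldt"
proof (rule dconv_le)
  show "dconv (\<lambda>n. 1 * ln (real n))" by (rule dconv_ln[OF dconv_1])
  show "\<bar>mangoldt n\<bar> \<le> \<bar>1 * ln (real n)\<bar>" for n
    using mangoldt_le_ln[of n] mangoldt_nonneg[of n] by (cases "n = 0") auto
qed

text \<open>Unordered sums over n \<ge> 1 are the form in which a double sum can be regrouped by
  divisors; index 0 has to go because every number divides it.\<close>

lemma dseries_has_sum:
  assumes "dconv a" "Re s > 1"
  shows "((\<lambda>n. of_real (a n) * of_nat n powr (- s)) has_sum dseries a s) {1..}"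
    and "((\<lambda>n. norm (of_real (a n) * of_nat n powr (- s) :: complex)) summable_on {1..})"
proof -
  let ?f = "\<lambda>n. of_real (a n) * of_nat n powr (- s) :: complex"
  have "(?f has_sum dseries a s) UNIV"
    by (intro norm_summable_imp_has_sum dseries_sums assms)
  thus "(?f has_sum dseries a s) {1..}"
    by (subst has_sum_cong_neutral[where T=UNIV and g = ?f]) (auto simp: not_le)
  show "(\<lambda>n. norm (?f n)) summable_on {1..}"
    by (rule summable_on_subset_banach[where A=UNIV])
       (auto intro!: norm_summable_imp_summable_on dseries_sums(2)[OF assms])
qed

text \<open>The Dirichlet convolution of \<open>mangoldt\<close> with 1 is the logarithm. The double
  series converges absolutely, so it may be summed along the hyperbolas d m = n.\<close>

lemma zeta_mult_dseries_mangoldt: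
  assumes "Re s > 1"
  shows "dseries mangoldt s * zeta s = dseries (\<lambda>n. ln (real n)) s"
proof -
  let ?f = "\<lambda>n. of_real (mangoldt n) * of_nat n powr (- s) :: complex"
  let ?g = "\<lambda>n. of_real 1 * of_nat n powr (- s) :: complex"
  note f = dseries_has_sum[OF dconv_mangoldt assms]
  note g = dseries_has_sum[OF dconv_1 assms]
  let ?h = "\<lambda>(d,m). ?f d * ?g m"
  have "(\<lambda>x. norm (?h x)) summable_on ({1..} \<times> {1..})"
  proof (rule summable_on_SigmaI[where g="\<lambda>d. norm (?f d) * (\<Sum>\<^sub>\<infinity>m\<in>{1..}. norm (?g m))"])
    show "(\<lambda>d. norm (?f d) * (\<Sum>\<^sub>\<infinity>m\<in>{1..}. norm (?g m))) summable_on {1..}"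
      by (intro summable_on_cmult_left f)
    show "((\<lambda>m. norm (?h (d, m))) has_sum norm (?f d) * (\<Sum>\<^sub>\<infinity>m\<in>{1..}. norm (?g m))) {1..}" for d
      unfolding case_prod_conv norm_mult[of "?f d"]
      by (intro has_sum_cmult_right has_sum_infsum g)
  qed auto
  hence summ: "?h summable_on ({1..} \<times> {1..})"
    by (rule abs_summable_summable)
  have 1: "(?h has_sum (dseries mangoldt s * zeta s)) ({1..} \<times> {1..})"
  proof (rule has_sum_SigmaI[where g="\<lambda>d. ?f d * zeta s"])
    show "((\<lambda>d. ?f d * zeta s) has_sum dseries mangoldt s * zeta s) {1..}"
      by (intro has_sum_cmult_left f)
    show "((\<lambda>m. ?h (d, m)) has_sum ?f d * zeta s) {1..}" for d
      unfolding case_prod_conv by (intro has_sum_cmult_right g)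
  qed (use summ in auto)
  have "((\<lambda>(n,d). ?f d * ?g (n div d)) has_sum (dseries mangoldt s * zeta s)) (Sigma {1..} (\<lambda>n. {d. d dvd n}))"
    using 1
    by (subst has_sum_reindex_bij_witness[where i="\<lambda>(d,m). (d*m, d)" and j="\<lambda>(n,d). (d, n div d)" and T="{1..} \<times> {1..}" and h = ?h])
       (auto elim!: dvdE simp: Suc_le_eq)
  hence "((\<lambda>n. \<Sum>d | d dvd n. ?f d * ?g (n div d)) has_sum (dseries mangoldt s * zeta s)) {1..}"
    by (rule has_sum_SigmaD) (auto intro!: has_sum_finite)
  also have "?this \<longleftrightarrow> ((\<lambda>n. of_real (ln (real n)) * of_nat n powr (- s)) has_sum (dseries mangoldt s * zeta s)) {1..}"
  proof (rule has_sum_cong)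
    fix n :: nat assume n: "n \<in> {1..}"
    have "(\<Sum>d | d dvd n. ?f d * ?g (n div d)) = (\<Sum>d | d dvd n. of_real (mangoldt d) * of_nat n powr (- s))"
    proof (intro sum.cong refl)
      fix d assume "d \<in> {d. d dvd n}"
      then obtain m where m: "n = d * m" by auto
      have "(of_nat (d * m) :: complex) powr (- s) = of_nat d powr (- s) * of_nat m powr (- s)"
        unfolding of_nat_mult by (rule powr_times_real) auto
      thus "?f d * ?g (n div d) = of_real (mangoldt d) * of_nat n powr (- s)"
        using m n by auto
    qed
    also have "\<dots> = of_real (ln (real n)) * of_nat n powr (- s)"
      using mangoldt_sum[of n, where ?'a=complex] n
      by (simp add: sum_distrib_right[symmetric])
    finally show "(\<Sum>d | d dvd n. ?f d * ?g (n div d)) = of_real (ln (real n)) * of_nat n powr (- s)" .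
  qed
  finally show ?thesis
    using dseries_has_sum(1)[OF dconv_ln[OF dconv_1] assms] has_sum_unique by fastforce
qed

text \<open>The logarithmic derivative in product form: that \<open>zeta\<close> has no zeros here
  is itself deduced from this equation, by way of \<open>logzeta\<close>.\<close>

lemma has_field_derivative_zeta:
  assumes "Re s > 1"
  shows "(zeta has_field_derivative - (dseries mangoldt s * zeta s)) (at s)"
  using has_field_derivative_dseries[OF dconv_1 assms] zeta_mult_dseries_mangoldt[OF assms] by simp

lemma Re_nat_powr: "Re (of_nat n powr (- Complex \<sigma> t)) = real n powr (- \<sigma>) * cos (t * ln (real n))"
  by (cases "n = 0") (auto simp: powr_def Re_exp Ln_of_nat mult.commute)

text \<open>The primitive of the logarithmic derivative is again a Dirichlet series with nonnegative
  coefficients; this replaces the Euler product.\<close>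

definition logzeta :: "complex \<Rightarrow> complex" where
  "logzeta = dseries (\<lambda>n. mangoldt n / ln (real n))"

lemma dconv_logzeta: "dconv (\<lambda>n. mangoldt n / ln (real n))"
proof (rule dconv_le[OF dconv_1])
  show "\<bar>mangoldt n / ln (real n)\<bar> \<le> \<bar>1\<bar>" for n :: nat
    using mangoldt_le_ln[of n] mangoldt_nonneg[of n]
    by (cases "n \<le> 1") (auto simp: le_Suc_eq divide_le_eq)
qed

text \<open>The product \<open>zeta s * exp (- logzeta s)\<close> has derivative 0 on a convex set.
  The constant is left unevaluated: what matters below is that it is nonzero, as it enters the 3-4-1
  inequality through \<open>norm c ^ 8\<close>.\<close>

lemma zeta_eq_exp_logzeta:
  obtains c where "c \<noteq> 0" "\<And>s. Re s > 1 \<Longrightarrow> zeta s = c * exp (logzeta s)"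
proof -
  let ?S = "{s. Re s > 1}"
  have "mangoldt n / ln (real n) * ln (real n) = mangoldt n" for n :: nat
    by (cases "n \<le> 1") (auto simp: le_Suc_eq)
  hence eq: "(\<lambda>n. mangoldt n / ln (real n) * ln (real n)) = mangoldt" by blast
  have d: "(logzeta has_field_derivative - dseries mangoldt s) (at s)" if "Re s > 1" for s
    using has_field_derivative_dseries[OF dconv_logzeta that] by (simp only: logzeta_def eq)
  have "\<exists>c. \<forall>s\<in>?S. zeta s * exp (- logzeta s) = c"
  proof (rule has_field_derivative_zero_constant)
    show "convex ?S" by (rule convex_halfspace_Re_gt)
    show "((\<lambda>s. zeta s * exp (- logzeta s)) has_field_derivative 0) (at s within ?S)" if "s \<in> ?S" for s
      using that
      by (auto intro!: derivative_eq_intros has_field_derivative_at_within[OF has_field_derivative_zeta]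
            has_field_derivative_at_within[OF d] simp: algebra_simps)
  qed
  then obtain c where c: "\<And>s. Re s > 1 \<Longrightarrow> zeta s * exp (- logzeta s) = c" by blast
  have z: "zeta s = c * exp (logzeta s)" if "Re s > 1" for s
    using c[OF that] by (auto simp: exp_minus field_simps)
  \<comment> \<open>At s = 2 the real part is at least the first term 1, so the constant cannot be
    0.\<close>
  have "(\<lambda>n. Re (of_real 1 * of_nat n powr (- 2))) sums Re (zeta 2)"
    by (intro sums_Re dseries_sums dconv_1) auto
  hence *: "(\<lambda>n. real n powr (- 2)) sums Re (zeta 2)"
    using Re_nat_powr[of _ 2 0] by (simp add: Complex_eq)
  have "(\<Sum>n\<in>{1::nat}. real n powr (- 2)) \<le> (\<Sum>n. real n powr (- 2))"
    using * by (intro sum_le_suminf) (auto simp: sums_iff)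
  hence "Re (zeta 2) \<ge> 1" using * by (simp add: sums_iff)
  hence "c \<noteq> 0" using z[of 2] by auto
  thus thesis using that z by blast
qed

lemma zeta_nonzero: "Re s > 1 \<Longrightarrow> zeta s \<noteq> 0"
  using zeta_eq_exp_logzeta by (metis exp_not_eq_zero mult_eq_0_iff)

text \<open>Absolute values turn \<open>logzeta\<close> into its real part, a cosine series with
  nonnegative coefficients, and 3 + 4 cos x + cos 2x = 2 (1 + cos x)^2. The bound is
  \<open>norm c ^ 8\<close> because 3 + 4 + 1 = 8.\<close>

lemma zeta_3_4_1:
  obtains d :: real where "d > 0"
    "\<And>\<sigma> t. \<sigma> > 1 \<Longrightarrow> d \<le> norm (zeta (of_real \<sigma>)) ^ 3 * norm (zeta (Complex \<sigma> t)) ^ 4 * norm (zeta (Complex \<sigma> (2 * t)))"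
proof -
  obtain c where c: "c \<noteq> 0" "\<And>s. Re s > 1 \<Longrightarrow> zeta s = c * exp (logzeta s)"
    using zeta_eq_exp_logzeta by blast
  show thesis
  proof (rule that[of "norm c ^ 8"])
    fix \<sigma> t :: real assume \<sigma>: "\<sigma> > 1"
    let ?a = "\<lambda>n. mangoldt n / ln (real n) :: real"
    have L: "(\<lambda>n. ?a n * (real n powr (- \<sigma>) * cos (u * ln (real n)))) sums Re (logzeta (Complex \<sigma> u))" for u
      using sums_Re[OF dseries_sums(1)[OF dconv_logzeta, of "Complex \<sigma> u"]] \<sigma>
      by (simp add: Re_nat_powr logzeta_def)
    have 1: "(\<lambda>n. 3 * (?a n * (real n powr (- \<sigma>) * cos (0 * ln (real n))))
                + 4 * (?a n * (real n powr (- \<sigma>) * cos (t * ln (real n))))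
                + ?a n * (real n powr (- \<sigma>) * cos ((2 * t) * ln (real n))))
          sums (3 * Re (logzeta (Complex \<sigma> 0)) + 4 * Re (logzeta (Complex \<sigma> t)) + Re (logzeta (Complex \<sigma> (2 * t))))"
      by (intro sums_add sums_mult L)
    have nn: "0 \<le> 3 * Re (logzeta (Complex \<sigma> 0)) + 4 * Re (logzeta (Complex \<sigma> t)) + Re (logzeta (Complex \<sigma> (2 * t)))"
    proof (rule sums_le[OF _ sums_zero 1])
      fix n :: nat
      let ?x = "t * ln (real n)"
      have "?a n \<ge> 0" using mangoldt_nonneg by (cases "n = 0") auto
      hence "0 \<le> ?a n * real n powr (- \<sigma>) * (2 * (1 + cos ?x)\<^sup>2)"
        by (intro mult_nonneg_nonneg) auto
      also have "2 * (1 + cos ?x)\<^sup>2 = 3 + 4 * cos ?x + cos (2 * ?x)"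
        unfolding cos_double_cos by (simp add: power2_eq_square algebra_simps)
      finally show "0 \<le> 3 * (?a n * (real n powr (- \<sigma>) * cos (0 * ln (real n))))
                + 4 * (?a n * (real n powr (- \<sigma>) * cos (t * ln (real n))))
                + ?a n * (real n powr (- \<sigma>) * cos ((2 * t) * ln (real n)))"
        by (simp add: algebra_simps del: cos_double_cos)
    qed
    have z: "norm (zeta (Complex \<sigma> u)) = norm c * exp (Re (logzeta (Complex \<sigma> u)))" for u
      using c(2)[of "Complex \<sigma> u"] \<sigma> by (simp add: norm_mult)
    have "norm c ^ 8 * 1 \<le> norm c ^ 8 * exp (3 * Re (logzeta (Complex \<sigma> 0)) + 4 * Re (logzeta (Complex \<sigma> t)) + Re (logzeta (Complex \<sigma> (2 * t))))"
      using nn by (intro mult_left_mono) auto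
    also have "\<dots> = norm (zeta (Complex \<sigma> 0)) ^ 3 * norm (zeta (Complex \<sigma> t)) ^ 4 * norm (zeta (Complex \<sigma> (2 * t)))"
    proof -
      have e: "exp (3 * x + 4 * y + w) = exp x ^ 3 * exp y ^ 4 * exp w" for x y w :: real
        using exp_of_nat_mult[of 3 x] exp_of_nat_mult[of 4 y] by (simp add: exp_add)
      have "norm c ^ 8 = norm c ^ 3 * norm c ^ 4 * norm c" by (simp add: eval_nat_numeral)
      thus ?thesis unfolding z e by (simp add: power_mult_distrib mult_ac)
    qed
    also have "Complex \<sigma> 0 = of_real \<sigma>" by (simp add: complex_of_real_def)
    finally show "norm c ^ 8 \<le> norm (zeta (of_real \<sigma>)) ^ 3 * norm (zeta (Complex \<sigma> t)) ^ 4 * norm (zeta (Complex \<sigma> (2 * t)))"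
      by simp
  qed (use c in auto)
qed

section \<open>Continuation of (s - 1) zeta(s) to the right half-plane\<close>

definition Zterm :: "nat \<Rightarrow> complex \<Rightarrow> complex" where
  "Zterm n s = (s - 1) * of_nat n powr (- s) - of_nat n powr (1 - s) + of_nat (Suc n) powr (1 - s)"

text \<open>\<open>(s - 1) \<zeta>(s)\<close>, continued to the right half-plane: the term of index \<open>n\<close> is
  \<open>(s - 1)\<close> times the integral of \<open>n\<^sup>-\<^sup>s - x\<^sup>-\<^sup>s\<close> over \<open>[n, n + 1]\<close>.\<close>

definition Zeta1 :: "complex \<Rightarrow> complex" where
  "Zeta1 s = 1 + (\<Sum>n. Zterm (Suc n) s)"

text \<open>Two mean value estimates on the segment from n to n + 1: the power with exponent - s
  varies by at most \<open>norm s * real n powr (- Re s - 1)\<close>, and \<open>Zterm\<close> is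
  the increment of \<open>?F\<close>, whose derivative is s - 1 times that variation. The power of n
  gained gives convergence for Re s > 0.\<close>

lemma norm_Zterm_le:
  assumes n: "n \<ge> 1" and s: "Re s > 0"
  shows "norm (Zterm n s) \<le> norm (s - 1) * norm s * real n powr (- Re s - 1)"
proof -
  define S where "S = complex_of_real ` {real n..real n + 1}"
  have conv: "convex S" unfolding S_def
    by (intro convex_linear_image convex_real_interval) (auto simp: bounded_linear.linear bounded_linear_of_real)
  have mem: "of_nat n \<in> S" "of_nat (Suc n) \<in> S"
    unfolding S_def by (intro image_eqI[where x="real n"]; simp) (intro image_eqI[where x="real n + 1"]; simp)
  have diam: "norm (x - y) \<le> 1" if "x \<in> S" "y \<in> S" for x y
    using that by (auto simp: S_def abs_le_iff simp flip: of_real_diff)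
  have nz: "z \<notin> \<real>\<^sub>\<le>\<^sub>0" if "z \<in> S" for z
    using that n by (auto simp: S_def)
  have pw: "norm (of_nat n powr (- s) - z powr (- s)) \<le> norm s * real n powr (- Re s - 1)" if z: "z \<in> S" for z
  proof -
    have "norm (of_nat n powr (- s) - z powr (- s)) \<le> (norm s * real n powr (- Re s - 1)) * norm (of_nat n - z)"
    proof (rule field_differentiable_bound[OF conv])
      fix w assume w: "w \<in> S"
      show "((\<lambda>z. z powr (- s)) has_field_derivative - s * w powr (- s - 1)) (at w within S)"
        using nz[OF w] by (auto intro!: derivative_eq_intros)
      obtain x where x: "w = of_real x" "x \<ge> real n" using w by (auto simp: S_def)
      have "norm (w powr (- s - 1)) = x powr (- Re s - 1)"
        using x n norm_powr_real_powr[of w "- s - 1"] by auto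
      also have "\<dots> \<le> real n powr (- Re s - 1)"
        using x n s by (intro powr_mono2') auto
      finally show "norm (- s * w powr (- s - 1)) \<le> norm s * real n powr (- Re s - 1)"
        by (auto simp: norm_mult intro: mult_left_mono)
    qed (use mem z in auto)
    also have "\<dots> \<le> (norm s * real n powr (- Re s - 1)) * 1"
      by (intro mult_left_mono diam mem z) auto
    finally show ?thesis by simp
  qed
  let ?F = "\<lambda>z. (s - 1) * of_nat n powr (- s) * z + z powr (1 - s)"
  have "norm (?F (of_nat (Suc n)) - ?F (of_nat n)) \<le> (norm (s - 1) * norm s * real n powr (- Re s - 1)) * norm (of_nat (Suc n) - of_nat n :: complex)"
  proof (rule field_differentiable_bound[OF conv])
    fix w assume w: "w \<in> S"
    show "(?F has_field_derivative (s - 1) * (of_nat n powr (- s) - w powr (- s))) (at w within S)"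
      using nz[OF w] by (auto intro!: derivative_eq_intros simp: algebra_simps)
    show "norm ((s - 1) * (of_nat n powr (- s) - w powr (- s))) \<le> norm (s - 1) * norm s * real n powr (- Re s - 1)"
      using pw[OF w] by (auto simp: norm_mult mult.assoc intro!: mult_left_mono)
  qed (use mem in auto)
  also have "?F (of_nat (Suc n)) - ?F (of_nat n) = Zterm n s"
    by (simp add: Zterm_def algebra_simps)
  finally show ?thesis by simp
qed

lemma summable_Suc_powr: "e > 0 \<Longrightarrow> summable (\<lambda>n. real (Suc n) powr (- e - 1))"
  by (subst summable_Suc_iff) (simp add: summable_real_powr_iff)

lemma summable_Zterm:
  assumes "Re s > 0"
  shows "summable (\<lambda>n. Zterm (Suc n) s)"
proof (rule summable_comparison_test'[where N=0])
  show "summable (\<lambda>n. norm (s - 1) * norm s * real (Suc n) powr (- Re s - 1))"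
    using summable_Suc_powr[OF assms] by (intro summable_mult)
  show "norm (Zterm (Suc n) s) \<le> norm (s - 1) * norm s * real (Suc n) powr (- Re s - 1)" for n
    using norm_Zterm_le[of "Suc n" s] assms by simp
qed

lemma Zeta1_holomorphic: "Zeta1 holomorphic_on {s. Re s > 0}"
proof (rule holomorphic_onI)
  fix s assume "s \<in> {s. Re s > 0}"
  hence s: "Re s > 0" by simp
  define S where "S = {z. Re z > Re s / 2} \<inter> ball s 1"
  have S: "open S" "s \<in> S"
    unfolding S_def by (intro open_Int open_halfspace_Re_gt open_ball) (use s in auto)
  have d: "(Zterm (Suc n) has_field_derivative deriv (Zterm (Suc n)) z) (at z)" for n z
  proof -
    have "Zterm (Suc n) holomorphic_on UNIV"
      unfolding Zterm_def by (intro holomorphic_intros)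
    thus ?thesis by (rule holomorphic_derivI) auto
  qed
  obtain g g' where g: "\<And>z. z \<in> S \<Longrightarrow> (\<lambda>n. Zterm (Suc n) z) sums g z \<and> (g has_field_derivative g' z) (at z)"
  proof (rule series_and_derivative_comparison[OF S(1) _ d])
    show "summable (\<lambda>n. (norm s + 2) * (norm s + 1) * real (Suc n) powr (- (Re s / 2) - 1))"
      using s by (intro summable_mult summable_Suc_powr) auto
    show "\<forall>\<^sub>F n in sequentially. \<forall>z\<in>S. norm (Zterm (Suc n) z) \<le> (norm s + 2) * (norm s + 1) * real (Suc n) powr (- (Re s / 2) - 1)"
    proof (intro always_eventually allI ballI)
      fix n z assume z: "z \<in> S"
      hence zs: "norm (z - s) < 1" "Re z > Re s / 2" by (auto simp: S_def dist_norm norm_minus_commute)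
      have z1: "norm z \<le> norm s + 1" using zs(1) norm_triangle_ineq2[of z s] by linarith
      hence z2: "norm (z - 1) \<le> norm s + 2" using norm_triangle_ineq4[of z 1] by simp
      have "norm (Zterm (Suc n) z) \<le> norm (z - 1) * norm z * real (Suc n) powr (- Re z - 1)"
        using s zs by (intro norm_Zterm_le) auto
      also have "\<dots> \<le> (norm s + 2) * (norm s + 1) * real (Suc n) powr (- (Re s / 2) - 1)"
        using z1 z2 zs by (intro mult_mono powr_mono) auto
      finally show "norm (Zterm (Suc n) z) \<le> (norm s + 2) * (norm s + 1) * real (Suc n) powr (- (Re s / 2) - 1)" .
    qed
  qed blast
  have "(Zeta1 has_field_derivative g' s) (at s)"
  proof (rule has_field_derivative_transform_within_open[OF _ S])
    show "((\<lambda>z. 1 + g z) has_field_derivative g' s) (at s)"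
      using g[OF S(2)] by (auto intro!: derivative_eq_intros)
    show "1 + g z = Zeta1 z" if "z \<in> S" for z
      using g[OF that] by (simp add: Zeta1_def sums_iff)
  qed
  thus "Zeta1 field_differentiable at s within {s. Re s > 0}"
    using field_differentiable_at_within field_differentiable_def by blast
qed

lemma Zeta1_1: "Zeta1 1 = 1"
  by (simp add: Zeta1_def Zterm_def del: of_nat_Suc)

text \<open>The subtracted powers telescope. This holds for all s: letting M grow identifies the
  continuation with zeta, and stopping at M near the height of s bounds it to the left of 1.\<close>

lemma Zeta1_partial:
  "1 + (\<Sum>n<M. Zterm (Suc n) s) = (s - 1) * (\<Sum>n<M. of_nat (Suc n) powr (- s)) + of_nat (Suc M) powr (1 - s)"
  by (induction M) (auto simp: Zterm_def algebra_simps)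

lemma Zeta1_eq_zeta:
  assumes s: "Re s > 1"
  shows "Zeta1 s = (s - 1) * zeta s"
proof -
  have "(\<lambda>M. 1 + (\<Sum>n<M. Zterm (Suc n) s)) \<longlonglongrightarrow> Zeta1 s"
    unfolding Zeta1_def using summable_Zterm[of s] s
    by (intro tendsto_intros summable_LIMSEQ) auto
  moreover have "(\<lambda>M. (s - 1) * (\<Sum>n<M. of_nat (Suc n) powr (- s)) + of_nat (Suc M) powr (1 - s)) \<longlonglongrightarrow> (s - 1) * zeta s + 0"
  proof (intro tendsto_intros)
    have "(\<lambda>n. of_nat (Suc n) powr (- s)) sums zeta s"
      using dseries_sums(1)[OF dconv_1 s] by (subst sums_Suc_iff) auto
    thus "(\<lambda>M. \<Sum>n<M. of_nat (Suc n) powr (- s)) \<longlonglongrightarrow> zeta s" by (simp add: sums_def)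
    have "(\<lambda>M. real (Suc M) powr (1 - Re s)) \<longlonglongrightarrow> 0" using s by real_asymp
    moreover have "norm (of_nat (Suc M) powr (1 - s) :: complex) = real (Suc M) powr (1 - Re s)" for M
      using norm_nat_powr[of "Suc M" "s - 1"] by simp
    ultimately show "(\<lambda>M. of_nat (Suc M) powr (1 - s) :: complex) \<longlonglongrightarrow> 0"
      by (subst tendsto_norm_zero_iff[symmetric]) simp
  qed
  ultimately show ?thesis unfolding Zeta1_partial using LIMSEQ_unique by force
qed

subsection \<open>Bounds near the line Re s = 1\<close>

text \<open>Cut the series near the height of s. The head, rewritten by
  \<open>Zeta1_partial\<close>, is a partial sum of zeta with a trivial bound; in the tail, the
  factor 1/n gained in \<open>norm_Zterm_le\<close> outweighs the factor \<open>norm s\<close>. Both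
  come to T^(1 + 2 e), where one power of T stands for s - 1.\<close>

lemma Zeta1_bound:
  assumes e: "0 < e" "e \<le> 1/4"
  obtains C where "C > 0"
    "\<And>s. 1 - e \<le> Re s \<Longrightarrow> Re s \<le> 3 \<Longrightarrow> norm (Zeta1 s) \<le> C * (\<bar>Im s\<bar> + 2) powr (1 + 2 * e)"
proof -
  define c where "c = (\<Sum>n. real (Suc n) powr (- e - 1))"
  have summ: "summable (\<lambda>n. real (Suc n) powr (- e - 1))" using e by (intro summable_Suc_powr) auto
  have c0: "c \<ge> 0" unfolding c_def by (intro suminf_nonneg summ) auto
  show thesis
  proof (rule that[of "7 * c + 1"])
    fix s assume s: "1 - e \<le> Re s" "Re s \<le> 3"
    have s0: "Re s > 0" using s e by auto
    define T where "T = \<bar>Im s\<bar> + 2"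
    define M where "M = nat \<lfloor>\<bar>Im s\<bar>\<rfloor>"
    define N where "N = real (Suc M)"
    have "real M = real_of_int \<lfloor>\<bar>Im s\<bar>\<rfloor>" by (simp add: M_def)
    hence "real M \<le> \<bar>Im s\<bar>" "\<bar>Im s\<bar> < real M + 1" by linarith+
    hence N: "N \<ge> 1" "N \<le> T" "T \<le> 3 * N"
      by (simp_all add: N_def T_def)
    have T: "T \<ge> 2" by (simp add: T_def)
    have s1: "norm (s - 1) \<le> T" and s2: "norm s \<le> 2 * T"
    proof -
      have "norm (s - 1) \<le> \<bar>Re (s - 1)\<bar> + \<bar>Im (s - 1)\<bar>" by (rule cmod_le)
      also have "\<dots> \<le> T" using s e by (simp add: T_def)
      finally show *: "norm (s - 1) \<le> T" .
      have "norm s \<le> norm (s - 1) + norm (1::complex)" using norm_triangle_ineq[of "s - 1" 1] by simp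
      thus "norm s \<le> 2 * T" using * T by simp
    qed
    have "norm (Zeta1 s) = norm ((1 + (\<Sum>n<M. Zterm (Suc n) s)) + (\<Sum>n. Zterm (Suc (n + M)) s))"
      unfolding Zeta1_def using suminf_split_initial_segment[OF summable_Zterm[OF s0], of M] by (simp add: algebra_simps)
    also have "\<dots> \<le> norm (s - 1) * norm (\<Sum>n<M. of_nat (Suc n) powr (- s) :: complex)
         + norm (of_nat (Suc M) powr (1 - s) :: complex) + norm (\<Sum>n. Zterm (Suc (n + M)) s)"
      unfolding Zeta1_partial by (intro order.trans[OF norm_triangle_ineq] add_mono order.refl) (simp add: norm_mult)
    also have "\<dots> \<le> T * (T powr (2 * e) * c) + T powr (1 + 2 * e) + T * (2 * T) * (3 * T powr (2 * e - 1)) * c"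
    proof (intro add_mono mult_mono s1)
      have "norm (\<Sum>n<M. of_nat (Suc n) powr (- s) :: complex) \<le> (\<Sum>n<M. real (Suc n) powr (- Re s))"
        by (rule order.trans[OF norm_sum]) (simp add: norm_nat_powr del: of_nat_Suc)
      also have "\<dots> \<le> (\<Sum>n<M. T powr (2 * e) * real (Suc n) powr (- e - 1))"
      proof (intro sum_mono)
        fix n assume "n \<in> {..<M}"
        hence "real (Suc n) \<le> N" by (simp add: N_def)
        hence nT: "real (Suc n) \<le> T" using N by simp
        \<comment> \<open>As - Re s \<le> e - 1 = 2 e + (- e - 1), one factor is summable and the
          other is at most T^(2 e). The tail is split in the same manner.\<close>
        have "real (Suc n) powr (- Re s) \<le> real (Suc n) powr (2 * e + (- e - 1))"
          using s by (intro powr_mono) auto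
        also have "\<dots> = real (Suc n) powr (2 * e) * real (Suc n) powr (- e - 1)" by (rule powr_add)
        also have "\<dots> \<le> T powr (2 * e) * real (Suc n) powr (- e - 1)"
          using nT e by (intro mult_right_mono powr_mono2) auto
        finally show "real (Suc n) powr (- Re s) \<le> T powr (2 * e) * real (Suc n) powr (- e - 1)" .
      qed
      also have "\<dots> = T powr (2 * e) * (\<Sum>n<M. real (Suc n) powr (- e - 1))"
        by (simp only: sum_distrib_left)
      also have "\<dots> \<le> T powr (2 * e) * c"
        unfolding c_def by (intro mult_left_mono sum_le_suminf summ) auto
      finally show "norm (\<Sum>n<M. of_nat (Suc n) powr (- s) :: complex) \<le> T powr (2 * e) * c" .
      have "norm (of_nat (Suc M) powr (1 - s) :: complex) = N powr (1 - Re s)"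
        using norm_nat_powr[of "Suc M" "s - 1"] by (simp add: N_def)
      also have "\<dots> \<le> N powr (1 + 2 * e)" using s e N by (intro powr_mono) auto
      also have "\<dots> \<le> T powr (1 + 2 * e)" using e N by (intro powr_mono2) auto
      finally show "norm (of_nat (Suc M) powr (1 - s) :: complex) \<le> T powr (1 + 2 * e)" .
      define K where "K = T * (2 * T) * (3 * T powr (2 * e - 1))"
      have t: "norm (Zterm (Suc (n + M)) s) \<le> K * real (Suc n) powr (- e - 1)" for n
      proof -
        let ?n = "real (Suc (n + M))"
        have "norm (Zterm (Suc (n + M)) s) \<le> norm (s - 1) * norm s * ?n powr (- Re s - 1)"
          using s0 by (intro norm_Zterm_le) auto
        also have "\<dots> \<le> T * (2 * T) * (3 * T powr (2 * e - 1) * real (Suc n) powr (- e - 1))"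
        proof (intro mult_mono s1 s2)
          have "?n powr (- Re s - 1) \<le> ?n powr ((2 * e - 1) + (- e - 1))"
            using s by (intro powr_mono) auto
          also have "\<dots> = ?n powr (2 * e - 1) * ?n powr (- e - 1)" by (rule powr_add)
          also have "\<dots> \<le> (3 * T powr (2 * e - 1)) * real (Suc n) powr (- e - 1)"
          proof (intro mult_mono)
            have "?n powr (2 * e - 1) \<le> (T / 3) powr (2 * e - 1)"
              using N T e by (intro powr_mono2') (auto simp: N_def)
            also have "\<dots> = 3 powr (1 - 2 * e) * T powr (2 * e - 1)"
              using T by (simp add: powr_divide powr_minus powr_diff field_simps)
            also have "\<dots> \<le> 3 powr 1 * T powr (2 * e - 1)"
              using e by (intro mult_right_mono powr_mono) auto
            finally show "?n powr (2 * e - 1) \<le> 3 * T powr (2 * e - 1)" by simp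
            show "?n powr (- e - 1) \<le> real (Suc n) powr (- e - 1)"
              using e by (intro powr_mono2') auto
          qed auto
          finally show "?n powr (- Re s - 1) \<le> 3 * T powr (2 * e - 1) * real (Suc n) powr (- e - 1)" .
        qed (use T in auto)
        finally show ?thesis by (simp add: K_def mult_ac)
      qed
      have "norm (\<Sum>n. Zterm (Suc (n + M)) s) \<le> (\<Sum>n. K * real (Suc n) powr (- e - 1))"
        by (rule norm_suminf_le[OF t]) (intro summable_mult summ)
      also have "\<dots> = K * c" unfolding c_def by (intro suminf_mult summ)
      finally show "norm (\<Sum>n. Zterm (Suc (n + M)) s) \<le> T * (2 * T) * (3 * T powr (2 * e - 1)) * c"
        by (simp add: K_def)
    qed (use T in auto)
    also have "\<dots> = (7 * c + 1) * T powr (1 + 2 * e)"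
      using T by (simp add: powr_add powr_diff field_simps)
    finally show "norm (Zeta1 s) \<le> (7 * c + 1) * (\<bar>Im s\<bar> + 2) powr (1 + 2 * e)" by (simp add: T_def)
  qed (use c0 in auto)
qed

lemma deriv_Zeta1_bound:
  assumes e: "0 < e" "e \<le> 1/4"
  obtains C where "C > 0"
    "\<And>s. 1 - e/2 \<le> Re s \<Longrightarrow> Re s \<le> 2 \<Longrightarrow> norm (deriv Zeta1 s) \<le> C * (\<bar>Im s\<bar> + 2) powr (1 + 2 * e)"
proof -
  obtain C where C: "C > 0"
    "\<And>s. 1 - e \<le> Re s \<Longrightarrow> Re s \<le> 3 \<Longrightarrow> norm (Zeta1 s) \<le> C * (\<bar>Im s\<bar> + 2) powr (1 + 2 * e)"
    using Zeta1_bound[OF e] by blast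
  show thesis
  proof (rule that[of "C * 2 powr (1 + 2 * e) / (e/2)"])
    fix s assume s: "1 - e/2 \<le> Re s" "Re s \<le> 2"
    have disc: "\<bar>Re w - Re s\<bar> \<le> e/2 \<and> \<bar>Im w - Im s\<bar> \<le> e/2" if "w \<in> cball s (e/2)" for w
    proof -
      have "norm (w - s) \<le> e/2" using that by (simp add: dist_norm norm_minus_commute)
      thus ?thesis using abs_Re_le_cmod[of "w - s"] abs_Im_le_cmod[of "w - s"] by auto
    qed
    have hol: "Zeta1 holomorphic_on cball s (e/2)"
    proof (rule holomorphic_on_subset[OF Zeta1_holomorphic], rule subsetI)
      fix w assume "w \<in> cball s (e/2)"
      from disc[OF this] have "\<bar>Re w - Re s\<bar> \<le> e/2" by simp
      hence "Re w > 0" using s e by linarith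
      thus "w \<in> {s. Re s > 0}" by simp
    qed
    have "norm ((deriv ^^ 1) Zeta1 s) \<le> fact 1 * (C * (2 * (\<bar>Im s\<bar> + 2)) powr (1 + 2 * e)) / (e/2) ^ 1"
    proof (rule Cauchy_inequality)
      show "norm (Zeta1 w) \<le> C * (2 * (\<bar>Im s\<bar> + 2)) powr (1 + 2 * e)" if "norm (s - w) = e/2" for w
      proof -
        have d: "\<bar>Re w - Re s\<bar> \<le> e/2 \<and> \<bar>Im w - Im s\<bar> \<le> e/2" using disc that by (auto simp: dist_norm)
        have "norm (Zeta1 w) \<le> C * (\<bar>Im w\<bar> + 2) powr (1 + 2 * e)"
          using d s e by (intro C) linarith+
        also have "\<dots> \<le> C * (2 * (\<bar>Im s\<bar> + 2)) powr (1 + 2 * e)"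
        proof (intro mult_left_mono powr_mono2)
          show "\<bar>Im w\<bar> + 2 \<le> 2 * (\<bar>Im s\<bar> + 2)"
          proof -
            have "\<bar>Im w\<bar> \<le> \<bar>Im s\<bar> + 1/8" using conjunct2[OF d] e by linarith
            thus ?thesis by simp
          qed
        qed (use C e in auto)
        finally show ?thesis .
      qed
      show "Zeta1 holomorphic_on ball s (e/2)" by (rule holomorphic_on_subset[OF hol ball_subset_cball])
    qed (use e holomorphic_on_imp_continuous_on[OF hol] in auto)
    also have "(2 * (\<bar>Im s\<bar> + 2)) powr (1 + 2 * e) = 2 powr (1 + 2 * e) * (\<bar>Im s\<bar> + 2) powr (1 + 2 * e)"
      by (rule powr_mult)
    finally show "norm (deriv Zeta1 s) \<le> C * 2 powr (1 + 2 * e) / (e/2) * (\<bar>Im s\<bar> + 2) powr (1 + 2 * e)"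
      by (simp add: mult_ac)
  qed (use C e in auto)
qed

text \<open>The 3-4-1 inequality solved for its middle factor: the value at \<open>\<sigma>\<close>
  costs 1/(\<sigma> - 1), the value at height 2t costs T^(2 e), and passing from zeta to
  \<open>Zeta1\<close> gains T^4. Staying at height at least \<open>d\<close> makes |s - 1|
  comparable to T.\<close>

lemma Zeta1_lower_bound_right:
  assumes e: "0 < e" "e \<le> 1/4" and d: "0 < d" "d \<le> 1"
  obtains c where "c > 0"
    "\<And>s. 1 < Re s \<Longrightarrow> Re s \<le> 2 \<Longrightarrow> \<bar>Im s\<bar> \<ge> d \<Longrightarrow>
       c * (Re s - 1) ^ 3 * (\<bar>Im s\<bar> + 2) powr (4 - 2 * e) \<le> norm (Zeta1 s) ^ 4"
proof -
  obtain C where C: "C > 0"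
    "\<And>s. 1 - e \<le> Re s \<Longrightarrow> Re s \<le> 3 \<Longrightarrow> norm (Zeta1 s) \<le> C * (\<bar>Im s\<bar> + 2) powr (1 + 2 * e)"
    using Zeta1_bound[OF e] by blast
  obtain D where D: "D > 0" "\<And>\<sigma> t. \<sigma> > 1 \<Longrightarrow> D \<le> norm (zeta (of_real \<sigma>)) ^ 3 * norm (zeta (Complex \<sigma> t)) ^ 4 * norm (zeta (Complex \<sigma> (2 * t)))"
    using zeta_3_4_1 by blast
  define A where "A = C * 2 powr (1 + 2 * e)"
  define B where "B = C * 2 powr (1 + 2 * e) * (3 / d)"
  have AB: "A > 0" "B > 0" using C d by (auto simp: A_def B_def)
  show thesis
  proof (rule that[of "D / (A ^ 3 * (3 / d) ^ 4 * B)"])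
    fix s assume s: "1 < Re s" "Re s \<le> 2" "\<bar>Im s\<bar> \<ge> d"
    define \<sigma> t T where "\<sigma> = Re s" and "t = Im s" and "T = \<bar>t\<bar> + 2"
    have T: "T > 0" "T \<le> 3 / d * \<bar>t\<bar>"
    proof -
      have "d * T \<le> 3 * \<bar>t\<bar>"
        using d s mult_right_mono[of d 1 "\<bar>t\<bar>"] by (simp add: T_def t_def algebra_simps)
      thus "T \<le> 3 / d * \<bar>t\<bar>" using d by (simp add: field_simps)
    qed (simp add: T_def)
    have t: "\<bar>t\<bar> > 0" using s d by (simp add: t_def)
    have s_eq: "s = Complex \<sigma> t" by (simp add: \<sigma>_def t_def)
    have z: "norm (zeta w) = norm (Zeta1 w) / norm (w - 1)" if "Re w > 1" for w
      using Zeta1_eq_zeta[OF that] that by (auto simp: norm_mult)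
    have 1: "norm (zeta (of_real \<sigma>)) \<le> A / (\<sigma> - 1)"
    proof -
      have n: "norm (of_real \<sigma> - 1 :: complex) = \<sigma> - 1"
        using s by (metis \<sigma>_def abs_of_pos diff_gt_0_iff_gt norm_of_real of_real_1 of_real_diff)
      have "norm (zeta (of_real \<sigma>)) = norm (Zeta1 (of_real \<sigma>)) / (\<sigma> - 1)"
        using s by (subst z) (auto simp: n \<sigma>_def[symmetric])
      also have "\<dots> \<le> A / (\<sigma> - 1)"
        using C(2)[of "of_real \<sigma>"] s e by (intro divide_right_mono) (auto simp: A_def \<sigma>_def)
      finally show ?thesis .
    qed
    have 2: "norm (zeta s) \<le> 3 / d * norm (Zeta1 s) / T"
    proof -
      have "T \<le> 3 / d * norm (s - 1)"
        using T(2) abs_Im_le_cmod[of "s - 1"] d by (simp add: t_def field_simps)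
      hence "norm (Zeta1 s) / norm (s - 1) \<le> norm (Zeta1 s) / (T / (3 / d))"
        using d T s by (intro divide_left_mono mult_pos_pos) (auto simp: field_simps)
      thus ?thesis using z[of s] s by (simp add: mult_ac)
    qed
    have 3: "norm (zeta (Complex \<sigma> (2 * t))) \<le> B * T powr (2 * e)"
    proof -
      have n: "T \<le> 3 / d * norm (Complex \<sigma> (2 * t) - 1)"
        using T(2) abs_Im_le_cmod[of "Complex \<sigma> (2 * t) - 1"] d by (simp add: field_simps)
      have n0: "norm (Complex \<sigma> (2 * t) - 1) > 0" using t by (auto simp: complex_eq_iff)
      have "norm (zeta (Complex \<sigma> (2 * t))) = norm (Zeta1 (Complex \<sigma> (2 * t))) / norm (Complex \<sigma> (2 * t) - 1)"
        using s by (subst z) (auto simp: \<sigma>_def)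
      also have "\<dots> \<le> (C * (2 * T) powr (1 + 2 * e)) / (T / (3 / d))"
      proof (rule frac_le)
        have "norm (Zeta1 (Complex \<sigma> (2 * t))) \<le> C * (\<bar>Im (Complex \<sigma> (2 * t))\<bar> + 2) powr (1 + 2 * e)"
          using s e by (intro C) (auto simp: \<sigma>_def)
        also have "\<dots> \<le> C * (2 * T) powr (1 + 2 * e)"
          using C e by (intro mult_left_mono powr_mono2) (auto simp: T_def abs_mult)
        finally show "norm (Zeta1 (Complex \<sigma> (2 * t))) \<le> C * (2 * T) powr (1 + 2 * e)" .
        show "T / (3 / d) \<le> norm (Complex \<sigma> (2 * t) - 1)" using n d by (simp add: field_simps)
      qed (use T d C in auto)
      also have "\<dots> = B * T powr (2 * e)"
        using T d by (simp add: B_def powr_mult powr_add field_simps)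
      finally show ?thesis .
    qed
    have "D \<le> norm (zeta (of_real \<sigma>)) ^ 3 * norm (zeta s) ^ 4 * norm (zeta (Complex \<sigma> (2 * t)))"
      unfolding s_eq using s by (intro D) (auto simp: \<sigma>_def)
    also have "\<dots> \<le> (A / (\<sigma> - 1)) ^ 3 * (3 / d * norm (Zeta1 s) / T) ^ 4 * (B * T powr (2 * e))"
      using s T d AB by (intro mult_mono power_mono 1 2 3) (auto simp: \<sigma>_def)
    also have "\<dots> = (A ^ 3 * (3 / d) ^ 4 * B) * norm (Zeta1 s) ^ 4 / ((\<sigma> - 1) ^ 3 * (T powr 4 * T powr (- 2 * e)))"
      using T by (simp add: power_divide power_mult_distrib powr_minus field_simps)
    also have "T powr 4 * T powr (- 2 * e) = T powr (4 - 2 * e)"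
      by (simp add: powr_add[symmetric])
    finally have *: "D \<le> (A ^ 3 * (3 / d) ^ 4 * B) * norm (Zeta1 s) ^ 4 / ((\<sigma> - 1) ^ 3 * T powr (4 - 2 * e))" .
    have "(\<sigma> - 1) ^ 3 * T powr (4 - 2 * e) > 0" using s T by (simp add: \<sigma>_def)
    hence "D * ((\<sigma> - 1) ^ 3 * T powr (4 - 2 * e)) \<le> (A ^ 3 * (3 / d) ^ 4 * B) * norm (Zeta1 s) ^ 4"
      using * by (simp only: pos_le_divide_eq)
    thus "D / (A ^ 3 * (3 / d) ^ 4 * B) * (Re s - 1) ^ 3 * (\<bar>Im s\<bar> + 2) powr (4 - 2 * e) \<le> norm (Zeta1 s) ^ 4"
      using AB d by (simp add: field_simps \<sigma>_def T_def t_def)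
  qed (use D AB d in auto)
qed

text \<open>At Re s = 1 + h, with h = b^4 T^(- 10 e), the previous lemma gives q b^3 T^(1 - 8 e);
  from there one walks left by at most 2 h. The derivative bound T^(1 + 2 e) times h has the same
  exponent 1 - 8 e, a balance that dictates the 10 e. The loss carries b^4 against b^3, so a small b
  saves half of the bound.\<close>

lemma Zeta1_lower_bound:
  assumes e: "0 < e" "e \<le> 1/10" and d: "0 < d" "d \<le> 1"
  obtains a c where "0 < a" "a \<le> e/2" "c > 0"
    "\<And>s. 1 - a * (\<bar>Im s\<bar> + 2) powr (- 10 * e) \<le> Re s \<Longrightarrow> Re s \<le> 2 \<Longrightarrow> \<bar>Im s\<bar> \<ge> d \<Longrightarrow>
       c * (\<bar>Im s\<bar> + 2) powr (1 - 8 * e) \<le> norm (Zeta1 s)"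
proof -
  have e': "e \<le> 1/4" using e by simp
  obtain c where c: "c > 0"
    "\<And>s. 1 < Re s \<Longrightarrow> Re s \<le> 2 \<Longrightarrow> \<bar>Im s\<bar> \<ge> d \<Longrightarrow>
       c * (Re s - 1) ^ 3 * (\<bar>Im s\<bar> + 2) powr (4 - 2 * e) \<le> norm (Zeta1 s) ^ 4"
    using Zeta1_lower_bound_right[OF e(1) e' d] by blast
  obtain C where C: "C > 0"
    "\<And>s. 1 - e/2 \<le> Re s \<Longrightarrow> Re s \<le> 2 \<Longrightarrow> norm (deriv Zeta1 s) \<le> C * (\<bar>Im s\<bar> + 2) powr (1 + 2 * e)"
    using deriv_Zeta1_bound[OF e(1) e'] by blast
  define q where "q = root 4 c"
  have q: "q > 0" "c = q ^ 4" using c by (auto simp: q_def)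
  \<comment> \<open>\<open>b \<le> e / 2\<close> keeps the segment where the bound on the derivative
    applies; \<open>4 * C * b \<le> q\<close> makes the loss 2 C b^4 at most half of q b^3.\<close>
  define b where "b = min (e/2) (q / (4 * C))"
  have b: "0 < b" "b \<le> e/2" "b \<le> 1" "b \<le> q / (4 * C)"
    using e q C by (auto simp: b_def)
  have bq: "4 * C * b \<le> q" using b(4) C by (simp add: field_simps)
  have b4: "b ^ 4 \<le> b" using b power_decreasing[of 1 4 b] by simp
  show thesis
  proof (rule that[of "b ^ 4" "q * b ^ 3 / 2"])
    show "b ^ 4 \<le> e/2" using b4 b by simp
    fix s assume s: "1 - b ^ 4 * (\<bar>Im s\<bar> + 2) powr (- 10 * e) \<le> Re s" "Re s \<le> 2" "\<bar>Im s\<bar> \<ge> d"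
    define T where "T = \<bar>Im s\<bar> + 2"
    define h where "h = b ^ 4 * T powr (- 10 * e)"
    have T: "T \<ge> 2" by (simp add: T_def)
    have "T powr (- 10 * e) \<le> T powr 0" using T e by (intro powr_mono) auto
    hence h: "0 < h" "h \<le> b ^ 4" using T b by (auto simp: h_def mult_le_cancel_left1)
    have h1: "h \<le> e/2" using h b4 b by linarith
    have right: "q * b ^ 3 * T powr (1 - 8 * e) \<le> norm (Zeta1 w)"
      if w: "1 + h \<le> Re w" "Re w \<le> 2" "Im w = Im s" for w
    proof -
      have "(q * b ^ 3 * T powr (1 - 8 * e)) ^ 4 = q ^ 4 * (b ^ 4) ^ 3 * (T powr (4 * (1 - 8 * e)))"
        using T by (simp add: power_mult_distrib powr_power flip: power_mult)
      also have "4 * (1 - 8 * e) = 3 * (- 10 * e) + (4 - 2 * e)" by simp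
      also have "T powr \<dots> = (T powr (- 10 * e)) ^ 3 * T powr (4 - 2 * e)"
        using T by (simp only: powr_add) (simp add: powr_power mult.commute)
      also have "q ^ 4 * (b ^ 4) ^ 3 * ((T powr (- 10 * e)) ^ 3 * T powr (4 - 2 * e)) = c * h ^ 3 * T powr (4 - 2 * e)"
        by (simp add: q h_def power_mult_distrib)
      also have "\<dots> \<le> c * (Re w - 1) ^ 3 * T powr (4 - 2 * e)"
        using c h w by (intro mult_mono power_mono) auto
      also have "\<dots> \<le> norm (Zeta1 w) ^ 4"
        using c(2)[of w] w h s by (simp add: T_def)
      finally show ?thesis
        by (rule power_le_imp_le_base[where n=3, simplified]) auto
    qed
    show "q * b ^ 3 / 2 * (\<bar>Im s\<bar> + 2) powr (1 - 8 * e) \<le> norm (Zeta1 s)"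
    proof (cases "1 + h \<le> Re s")
      case True
      have "q * b ^ 3 / 2 * T powr (1 - 8 * e) \<le> q * b ^ 3 * T powr (1 - 8 * e)"
        using q b by (intro mult_right_mono) auto
      thus ?thesis using right[OF True] s by (simp add: T_def)
    next
      case False
      define w where "w = Complex (1 + h) (Im s)"
      have w: "Re w = 1 + h" "Im w = Im s" by (auto simp: w_def)
      have sh: "1 - h \<le> Re s" using s by (simp add: h_def T_def)
      have seg: "1 - h \<le> Re z \<and> Re z \<le> 1 + h \<and> Im z = Im s" if zs: "z \<in> closed_segment s w" for z
      proof -
        obtain u where u: "0 \<le> u" "u \<le> 1" "z = (1 - u) *\<^sub>R s + u *\<^sub>R w"
          using zs by (auto simp: in_segment)
        have "Re z = (1 - u) * Re s + u * (1 + h)" unfolding u(3) by (simp add: w)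
        moreover have "Im z = Im s" unfolding u(3) by (simp add: w algebra_simps)
        moreover have "(1 - u) * Re s + u * (1 + h) \<le> (1 - u) * (1 + h) + u * (1 + h)"
          using u False by (intro add_mono mult_left_mono) auto
        moreover have "(1 - u) * (1 - h) + u * (1 - h) \<le> (1 - u) * Re s + u * (1 + h)"
          using u sh h by (intro add_mono mult_left_mono) auto
        ultimately show ?thesis by (simp add: algebra_simps)
      qed
      have "norm (Zeta1 s - Zeta1 w) \<le> (C * T powr (1 + 2 * e)) * norm (s - w)"
      proof (rule field_differentiable_bound[OF convex_closed_segment])
        fix z assume z: "z \<in> closed_segment s w"
        have "z \<in> {s. Re s > 0}" using seg[OF z] h1 e by simp
        thus "(Zeta1 has_field_derivative deriv Zeta1 z) (at z within closed_segment s w)"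
          by (intro has_field_derivative_at_within[OF holomorphic_derivI[OF Zeta1_holomorphic open_halfspace_Re_gt]])
        show "norm (deriv Zeta1 z) \<le> C * T powr (1 + 2 * e)"
          using C(2)[of z] seg[OF z] h1 e by (simp add: T_def)
      qed auto
      also have "\<dots> \<le> (C * T powr (1 + 2 * e)) * (2 * h)"
      proof (rule mult_left_mono)
        show "norm (s - w) \<le> 2 * h" using cmod_le[of "s - w"] w sh False by simp
      qed (use C in auto)
      also have "(C * T powr (1 + 2 * e)) * (2 * h) = (2 * C * b) * b ^ 3 * T powr (1 - 8 * e)"
      proof -
        have tp: "T powr (1 - 8 * e) = T powr (1 + 2 * e) * T powr (- 10 * e)" by (simp add: powr_add[symmetric])
        have b4': "b ^ 4 = b * b ^ 3" by (simp add: eval_nat_numeral)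
        show ?thesis unfolding h_def tp b4' by (simp only: mult_ac)
      qed
      also have "\<dots> \<le> (q / 2) * b ^ 3 * T powr (1 - 8 * e)"
        by (rule mult_right_mono, rule mult_right_mono) (use b bq in auto)
      finally have "norm (Zeta1 s - Zeta1 w) \<le> q / 2 * b ^ 3 * T powr (1 - 8 * e)" .
      moreover have "q * b ^ 3 * T powr (1 - 8 * e) \<le> norm (Zeta1 w)"
        using w h1 e by (intro right) auto
      moreover have "norm (Zeta1 w) \<le> norm (Zeta1 s) + norm (Zeta1 s - Zeta1 w)"
        by (metis norm_minus_commute norm_triangle_sub)
      ultimately show ?thesis by (simp add: T_def)
    qed
  qed (use b q in auto)
qed

text \<open>On the line Re s = 1 away from s = 1, the quantitative lower bound with \<open>d\<close>
  at most |Im s| already excludes a zero; at s = 1 the value is 1.\<close>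

lemma Zeta1_nonzero:
  assumes "Re s \<ge> 1"
  shows "Zeta1 s \<noteq> 0"
proof (cases "Re s > 1")
  case True
  thus ?thesis using Zeta1_eq_zeta[OF True] zeta_nonzero[OF True] by auto
next
  case False
  hence r: "Re s = 1" using assms by simp
  show ?thesis
  proof (cases "Im s = 0")
    case True
    hence "s = 1" using r by (simp add: complex_eq_iff)
    thus ?thesis using Zeta1_1 by simp
  next
    case False
    define d where "d = min 1 \<bar>Im s\<bar>"
    have d: "0 < d" "d \<le> 1" "\<bar>Im s\<bar> \<ge> d" using False by (auto simp: d_def)
    obtain a c where ac: "0 < a" "a \<le> 1/10/2" "c > 0"
      "\<And>s. 1 - a * (\<bar>Im s\<bar> + 2) powr (- 10 * (1/10)) \<le> Re s \<Longrightarrow> Re s \<le> 2 \<Longrightarrow> \<bar>Im s\<bar> \<ge> d \<Longrightarrow>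
         c * (\<bar>Im s\<bar> + 2) powr (1 - 8 * (1/10)) \<le> norm (Zeta1 s)"
      using Zeta1_lower_bound[of "1/10" d] d by auto
    have "0 < c * (\<bar>Im s\<bar> + 2) powr (1 - 8 * (1/10))" using ac by simp
    also have "\<dots> \<le> norm (Zeta1 s)" using ac r d by (intro ac) auto
    finally show ?thesis by auto
  qed
qed

text \<open>Perron integrand: \<open>- \<zeta>'/\<zeta>(s)\<close> without its pole at 1, times the kernel \<open>1 / (s (s + 1))\<close>.\<close>

definition Gker :: "complex \<Rightarrow> complex" where
  "Gker s = - deriv Zeta1 s / (Zeta1 s * (s * (s + 1)))"

definition Gdom :: "complex set" where
  "Gdom = {s. Re s > 0} \<inter> Zeta1 -` (- {0})"

text \<open>Nonvanishing on Re s = 1 puts the closed half-plane inside an open domain of holomorphy,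
  so all derivatives are bounded on compact pieces touching that line.\<close>

lemma Gdom: "open Gdom" "Gker holomorphic_on Gdom" "Re s \<ge> 1 \<Longrightarrow> s \<in> Gdom"
proof -
  have op: "open {s. Re s > 0}" by (rule open_halfspace_Re_gt)
  show "open Gdom"
    unfolding Gdom_def
    by (intro continuous_open_preimage holomorphic_on_imp_continuous_on Zeta1_holomorphic op) auto
  have sub: "Gdom \<subseteq> {s. Re s > 0}" by (auto simp: Gdom_def)
  have nz: "Zeta1 s * (s * (s + 1)) \<noteq> 0" if "s \<in> Gdom" for s
  proof -
    have "s \<noteq> 0" "s + 1 \<noteq> 0" using that by (auto simp: Gdom_def complex_eq_iff)
    thus ?thesis using that by (simp add: Gdom_def)
  qed
  note h = holomorphic_on_subset[OF Zeta1_holomorphic sub] holomorphic_on_subset[OF holomorphic_deriv[OF Zeta1_holomorphic op] sub]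
  show "Gker holomorphic_on Gdom"
    unfolding Gker_def
    by (intro h nz holomorphic_on_divide holomorphic_on_minus holomorphic_on_mult holomorphic_on_add holomorphic_on_ident holomorphic_on_const)
  show "Re s \<ge> 1 \<Longrightarrow> s \<in> Gdom"
    using Zeta1_nonzero by (auto simp: Gdom_def)
qed

text \<open>Logarithmic differentiation of (s - 1) zeta(s): the factor s - 1 contributes the 1/(s -
  1) that removes the pole.\<close>

lemma Gker_eq:
  assumes "Re s > 1"
  shows "Gker s = (dseries mangoldt s - 1 / (s - 1)) / (s * (s + 1))"
proof -
  have s1: "s - 1 \<noteq> 0" using assms by auto
  have "(Zeta1 has_field_derivative zeta s + (s - 1) * - (dseries mangoldt s * zeta s)) (at s)"
  proof (rule has_field_derivative_transform_within_open[of _ _ _ "{s. Re s > 1}"])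
    show "((\<lambda>s. (s - 1) * zeta s) has_field_derivative zeta s + (s - 1) * - (dseries mangoldt s * zeta s)) (at s)"
      using assms by (auto intro!: derivative_eq_intros has_field_derivative_zeta)
  qed (use assms Zeta1_eq_zeta in \<open>auto simp: open_halfspace_Re_gt\<close>)
  hence d: "deriv Zeta1 s = zeta s + (s - 1) * - (dseries mangoldt s * zeta s)"
    by (rule DERIV_imp_deriv)
  have "- deriv Zeta1 s / Zeta1 s = dseries mangoldt s - 1 / (s - 1)"
    unfolding d Zeta1_eq_zeta[OF assms] using zeta_nonzero[OF assms] s1 by (simp add: field_simps)
  thus ?thesis by (simp add: Gker_def field_simps)
qed

text \<open>On a disc of radius about T^(- 10 e), \<open>Gker\<close> is at most a constant times
  T^(1 + 2 e) / (T^(1 - 8 e) T^2) = T^(10 e - 2), and Cauchy's inequality multiplies this by T^(10 e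
  k). Low heights are covered by compactness.\<close>

lemma higher_deriv_Gker_bound:
  obtains C where "\<And>s. 1 < Re s \<Longrightarrow> Re s \<le> 3/2 \<Longrightarrow> norm ((deriv ^^ k) Gker s) \<le> C * (\<bar>Im s\<bar> + 2) powr (- 3/2)"
proof -
  \<comment> \<open>Chosen so that 10 e (k + 1) = 1/2, which makes the final exponent exactly -
    3/2.\<close>
  define e where "e = 1 / (20 * real (Suc k))"
  have e: "0 < e" "e \<le> 1/10" "e \<le> 1/4" "e \<le> 1/20" by (auto simp: e_def field_simps)
  have ek: "10 * e * real (Suc k) = 1/2" by (simp add: e_def field_simps)
  obtain a c where ac: "0 < a" "a \<le> e/2" "c > 0"
      "\<And>s. 1 - a * (\<bar>Im s\<bar> + 2) powr (- 10 * e) \<le> Re s \<Longrightarrow> Re s \<le> 2 \<Longrightarrow> \<bar>Im s\<bar> \<ge> 1 \<Longrightarrow>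
         c * (\<bar>Im s\<bar> + 2) powr (1 - 8 * e) \<le> norm (Zeta1 s)"
    using Zeta1_lower_bound[of e 1] e by auto
  obtain C where C: "C > 0"
    "\<And>s. 1 - e/2 \<le> Re s \<Longrightarrow> Re s \<le> 2 \<Longrightarrow> norm (deriv Zeta1 s) \<le> C * (\<bar>Im s\<bar> + 2) powr (1 + 2 * e)"
    using deriv_Zeta1_bound[OF e(1,3)] by blast
  define D where "D = fact k * (C / c * 36) * (2 / a) ^ k"
  have far: "norm ((deriv ^^ k) Gker s) \<le> D * (\<bar>Im s\<bar> + 2) powr (- 3/2)"
    if s: "1 < Re s" "Re s \<le> 3/2" "\<bar>Im s\<bar> \<ge> 2" for s
  proof -
    define T where "T = \<bar>Im s\<bar> + 2"
    have T: "T \<ge> 4" using s by (simp add: T_def)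
    \<comment> \<open>Half of \<open>a\<close> leaves room for replacing T by
      \<open>\<bar>Im w\<bar> + 2\<close>, which is at most 2 T on the disc.\<close>
    define r where "r = a / 2 * T powr (- 10 * e)"
    have "T powr (- 10 * e) \<le> T powr 0" using T e by (intro powr_mono) auto
    hence r: "0 < r" "r \<le> a / 2" using T ac by (auto simp: r_def mult_le_cancel_left1)
    have disc: "\<bar>Re w - Re s\<bar> \<le> r \<and> \<bar>Im w - Im s\<bar> \<le> r" if "w \<in> cball s r" for w
    proof -
      have "norm (w - s) \<le> r" using that by (simp add: dist_norm norm_minus_commute)
      thus ?thesis using abs_Re_le_cmod[of "w - s"] abs_Im_le_cmod[of "w - s"] by auto
    qed
    have w1: "1 - e/2 \<le> Re w \<and> Re w \<le> 2 \<and> \<bar>Im w\<bar> \<ge> 1 \<and> T / 2 \<le> \<bar>Im w\<bar> + 2 \<and> \<bar>Im w\<bar> + 2 \<le> 2 * T \<and> T / 3 \<le> \<bar>Im w\<bar>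
        \<and> 1 - a * (\<bar>Im w\<bar> + 2) powr (- 10 * e) \<le> Re w" if "w \<in> cball s r" for w
    proof -
      have d: "\<bar>Re w - Re s\<bar> \<le> r" "\<bar>Im w - Im s\<bar> \<le> r" "r \<le> 1/40" using disc[OF that] r ac e by auto
      have "\<bar>Im w\<bar> \<le> \<bar>Im s\<bar> + 1/40" "\<bar>Im s\<bar> \<le> \<bar>Im w\<bar> + 1/40" using d(2,3) by linarith+
      hence Tw: "T / 2 \<le> \<bar>Im w\<bar> + 2" "\<bar>Im w\<bar> + 2 \<le> 2 * T" "T / 3 \<le> \<bar>Im w\<bar>" "\<bar>Im w\<bar> \<ge> 1"
        using s by (simp_all add: T_def)
      have "r \<le> a * (\<bar>Im w\<bar> + 2) powr (- 10 * e)"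
      proof -
        have "(2 * T) powr (- 10 * e) \<le> (\<bar>Im w\<bar> + 2) powr (- 10 * e)"
          using Tw T e by (intro powr_mono2') auto
        moreover have "(2 * T) powr (- 10 * e) = 2 powr (- 10 * e) * T powr (- 10 * e)" using T by (simp add: powr_mult)
        moreover have "2 powr (- 1) * T powr (- 10 * e) \<le> 2 powr (- 10 * e) * T powr (- 10 * e)"
          using e by (intro mult_right_mono powr_mono) auto
        ultimately have "T powr (- 10 * e) / 2 \<le> (\<bar>Im w\<bar> + 2) powr (- 10 * e)" by (simp add: powr_minus)
        thus ?thesis using ac by (simp add: r_def field_simps)
      qed
      thus ?thesis using d s r ac e Tw by (auto simp: abs_le_iff)
    qed
    have Zl: "c * (\<bar>Im w\<bar> + 2) powr (1 - 8 * e) \<le> norm (Zeta1 w)" if "w \<in> cball s r" for w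
      using w1[OF that] by (intro ac) auto
    have sub: "cball s r \<subseteq> Gdom"
    proof
      fix w assume w: "w \<in> cball s r"
      have "0 < c * (\<bar>Im w\<bar> + 2) powr (1 - 8 * e)" using ac by simp
      hence "Zeta1 w \<noteq> 0" using Zl[OF w] by auto
      thus "w \<in> Gdom" using w1[OF w] e by (auto simp: Gdom_def)
    qed
    have hol: "Gker holomorphic_on cball s r" by (rule holomorphic_on_subset[OF Gdom(2) sub])
    have "norm ((deriv ^^ k) Gker s) \<le> fact k * (C / c * 36 * T powr (10 * e - 2)) / r ^ k"
    proof (rule Cauchy_inequality)
      show "norm (Gker w) \<le> C / c * 36 * T powr (10 * e - 2)" if "norm (s - w) = r" for w
      proof -
        have wc: "w \<in> cball s r" using that by (simp add: dist_norm)
        define U where "U = \<bar>Im w\<bar> + 2"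
        note w = w1[OF wc, folded U_def]
        have U: "U > 0" by (simp add: U_def)
        have iw: "U / 3 \<le> \<bar>Im w\<bar>" using w by (simp add: U_def)
        have ww: "(U / 3) * (U / 3) \<le> norm (w * (w + 1))"
          unfolding norm_mult using iw abs_Im_le_cmod[of w] abs_Im_le_cmod[of "w + 1"] U
          by (intro mult_mono) auto
        have "norm (Gker w) = norm (deriv Zeta1 w) / (norm (Zeta1 w) * norm (w * (w + 1)))"
          by (simp add: Gker_def norm_divide norm_mult)
        also have "\<dots> \<le> (C * U powr (1 + 2 * e)) / ((c * U powr (1 - 8 * e)) * ((U / 3) * (U / 3)))"
          using w C(2)[of w] Zl[OF wc] ww U ac C by (intro frac_le mult_mono mult_pos_pos) (auto simp: U_def)
        also have "\<dots> = C / c * 9 * U powr (10 * e - 2)"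
        proof -
          have "U powr (10 * e - 2) = U powr (1 + 2 * e) / (U powr (1 - 8 * e) * U powr 2)"
            by (simp add: powr_add[symmetric] powr_diff[symmetric])
          also have "U powr 2 = U * U" using U by (simp add: power2_eq_square)
          finally show ?thesis by (simp add: field_simps)
        qed
        also have "\<dots> \<le> C / c * 9 * (4 * T powr (10 * e - 2))"
        proof (intro mult_left_mono)
          have "U powr (10 * e - 2) \<le> (T / 2) powr (10 * e - 2)"
            using w T e by (intro powr_mono2') auto
          also have "\<dots> = 2 powr (2 - 10 * e) * T powr (10 * e - 2)"
            using T by (simp add: powr_divide powr_diff field_simps)
          also have "\<dots> \<le> 2 powr 2 * T powr (10 * e - 2)"
            using e by (intro mult_right_mono powr_mono) auto
          finally show "U powr (10 * e - 2) \<le> 4 * T powr (10 * e - 2)" by simp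
        qed (use C ac in auto)
        finally show ?thesis by (simp add: mult_ac)
      qed
      show "Gker holomorphic_on ball s r" by (rule holomorphic_on_subset[OF hol ball_subset_cball])
    qed (use r holomorphic_on_imp_continuous_on[OF hol] in auto)
    also have "\<dots> = D * (T powr (10 * e - 2) * (T powr (10 * e)) ^ k)"
    proof -
      have "1 / r = 2 / a * T powr (10 * e)" using T ac by (simp add: r_def powr_minus field_simps)
      hence "1 / r ^ k = (2 / a) ^ k * (T powr (10 * e)) ^ k" by (metis power_mult_distrib power_one_over)
      hence "x / r ^ k = x * ((2 / a) ^ k * (T powr (10 * e)) ^ k)" for x by (metis times_divide_eq_right mult.right_neutral)
      thus ?thesis by (simp add: D_def mult_ac)
    qed
    also have "T powr (10 * e - 2) * (T powr (10 * e)) ^ k = T powr (10 * e - 2 + 10 * e * real k)"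
      using T by (simp add: powr_power powr_add mult_ac)
    also have "10 * e - 2 + 10 * e * real k = - 3/2" using ek by (simp add: algebra_simps)
    finally show ?thesis by (simp add: T_def)
  qed
  \<comment> \<open>The rectangle includes its edge Re s = 1; this makes the bound uniform as Re s
    tends to 1.\<close>
  define K where "K = cbox (Complex 1 (-2)) (Complex (3/2) 2)"
  have "continuous_on K ((deriv ^^ k) Gker)"
    by (intro holomorphic_on_imp_continuous_on holomorphic_on_subset[OF holomorphic_higher_deriv[OF Gdom(2,1)]])
       (auto simp: K_def in_cbox_complex_iff intro: Gdom(3))
  hence "compact ((deriv ^^ k) Gker ` K)" by (rule compact_continuous_image) (simp add: K_def)
  hence "bounded ((deriv ^^ k) Gker ` K)" by (rule compact_imp_bounded)
  then obtain E where E: "E > 0" "\<And>s. s \<in> K \<Longrightarrow> norm ((deriv ^^ k) Gker s) \<le> E"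
    by (auto simp: bounded_pos)
  show thesis
  proof (rule that[of "max D (E * 4 powr (3/2))"])
    fix s assume s: "1 < Re s" "Re s \<le> 3/2"
    show "norm ((deriv ^^ k) Gker s) \<le> max D (E * 4 powr (3/2)) * (\<bar>Im s\<bar> + 2) powr (- 3/2)"
    proof (cases "\<bar>Im s\<bar> \<ge> 2")
      case True
      have "D * (\<bar>Im s\<bar> + 2) powr (- 3/2) \<le> max D (E * 4 powr (3/2)) * (\<bar>Im s\<bar> + 2) powr (- 3/2)"
        by (intro mult_right_mono) auto
      thus ?thesis using far[OF s True] by linarith
    next
      case False
      hence "norm ((deriv ^^ k) Gker s) \<le> E" using s by (intro E) (auto simp: K_def in_cbox_complex_iff)
      also have "\<dots> = E * 4 powr (3/2) * 4 powr (- 3/2)" by (simp add: powr_minus)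
      also have "\<dots> \<le> max D (E * 4 powr (3/2)) * (\<bar>Im s\<bar> + 2) powr (- 3/2)"
        using False E by (intro mult_mono powr_mono2') auto
      finally show ?thesis .
    qed
  qed
qed

subsection \<open>Perron's formula\<close>

lemma Complex_nonzero: "\<sigma> \<noteq> 0 \<Longrightarrow> Complex \<sigma> t \<noteq> 0"
  by (auto simp: complex_eq_iff)

lemma norm_Complex_ge: "\<sigma> \<ge> 1 \<Longrightarrow> (\<bar>t\<bar> + 2) / 3 \<le> norm (Complex \<sigma> t)"
  using abs_Re_le_cmod[of "Complex \<sigma> t"] abs_Im_le_cmod[of "Complex \<sigma> t"] by simp

lemma continuous_on_Complex_line: "continuous_on A (\<lambda>t. Complex \<sigma> t)"
  unfolding Complex_eq by (intro continuous_intros)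

text \<open>The kernel 1/(s (s + 1)) on the line Re s = \<open>\<sigma>\<close>. Its companion
  \<open>perron2\<close> is divided by s - 1 as well and carries the share of the pole; for
  \<open>\<sigma> > 1\<close> the two shares can be integrated separately.\<close>

definition perron1 :: "real \<Rightarrow> real \<Rightarrow> complex" where
  "perron1 \<sigma> t = 1 / (Complex \<sigma> t * Complex (\<sigma> + 1) t)"

definition perron2 :: "real \<Rightarrow> real \<Rightarrow> complex" where
  "perron2 \<sigma> t = 1 / (Complex (\<sigma> - 1) t * Complex \<sigma> t * Complex (\<sigma> + 1) t)"

lemma perron_measurable [measurable]:
  assumes "\<sigma> > 1"
  shows "perron1 \<sigma> \<in> borel_measurable borel" "perron2 \<sigma> \<in> borel_measurable borel"
  unfolding perron1_def perron2_def using assms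
  by (intro borel_measurable_continuous_onI continuous_intros continuous_on_Complex_line ballI;
      simp add: Complex_nonzero)+

lemma norm_perron1_le:
  assumes "\<sigma> > 1"
  shows "norm (perron1 \<sigma> t) \<le> 9 * (\<bar>t\<bar> + 2) powr (- 2)"
proof -
  have "((\<bar>t\<bar> + 2) / 3) * ((\<bar>t\<bar> + 2) / 3) \<le> norm (Complex \<sigma> t) * norm (Complex (\<sigma> + 1) t)"
    using assms by (intro mult_mono norm_Complex_ge) auto
  hence "1 / (norm (Complex \<sigma> t) * norm (Complex (\<sigma> + 1) t)) \<le> 1 / (((\<bar>t\<bar> + 2) / 3) * ((\<bar>t\<bar> + 2) / 3))"
    using assms by (intro divide_left_mono mult_pos_pos) (auto simp: Complex_nonzero)
  thus ?thesis by (simp add: perron1_def norm_divide norm_mult powr_minus power2_eq_square field_simps)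
qed

text \<open>The bound for \<open>perron2\<close> degenerates as \<open>\<sigma>\<close> tends to 1,
  which is harmless: it serves to evaluate integrals at a fixed \<open>\<sigma>\<close>, not to
  estimate them.\<close>

lemma integrable_perron:
  assumes s: "\<sigma> > 1"
  shows "integrable lborel (perron1 \<sigma>)" "integrable lborel (perron2 \<sigma>)"
proof -
  have i: "integrable lborel (\<lambda>t::real. 9 * (\<bar>t\<bar> + 2) powr (- 2))"
    by (intro integrable_mult_right integrable_abs_plus_2_powr) auto
  show *: "integrable lborel (perron1 \<sigma>)"
    by (rule Bochner_Integration.integrable_bound[OF i]) (use norm_perron1_le[OF s] s in auto)
  have "integrable lborel (\<lambda>t. 1 / (\<sigma> - 1) * norm (perron1 \<sigma> t))"
    using * by (intro integrable_mult_right integrable_norm)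
  thus "integrable lborel (perron2 \<sigma>)"
  proof (rule Bochner_Integration.integrable_bound)
    have "norm (perron2 \<sigma> t) \<le> 1 / (\<sigma> - 1) * norm (perron1 \<sigma> t)" for t
    proof -
      have "norm (perron2 \<sigma> t) = 1 / norm (Complex (\<sigma> - 1) t) * norm (perron1 \<sigma> t)"
        by (simp add: perron1_def perron2_def norm_divide norm_mult)
      also have "\<dots> \<le> 1 / (\<sigma> - 1) * norm (perron1 \<sigma> t)"
        using s abs_Re_le_cmod[of "Complex (\<sigma> - 1) t"]
        by (intro mult_right_mono divide_left_mono mult_pos_pos) (auto simp: Complex_nonzero)
      finally show ?thesis .
    qed
    thus "AE t in lborel. norm (perron2 \<sigma> t) \<le> norm (1 / (\<sigma> - 1) * norm (perron1 \<sigma> t))"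
      using s by simp
  qed (use s in measurable)
qed

text \<open>Partial fractions 1/s - 1/(s + 1); the coefficients add up to 0, as the inversion
  requires.\<close>

lemma integral_perron1:
  assumes s: "\<sigma> > 1"
  shows "(LBINT t. perron1 \<sigma> t * iexp (t * y))
       = 2 * pi * complex_of_real (if y \<le> 0 then 0 else exp (- \<sigma> * y) * (1 - exp (- y)))"
proof -
  define c :: "nat \<Rightarrow> real" where "c = (\<lambda>j. if j = 0 then 1 else - 1)"
  define l :: "nat \<Rightarrow> real" where "l = (\<lambda>j. if j = 0 then \<sigma> else \<sigma> + 1)"
  have sum2: "(\<Sum>j<2. f j) = f 0 + f (1::nat)" for f :: "nat \<Rightarrow> 'a :: comm_monoid_add"
    by (simp add: numeral_2_eq_2)
  have K: "perron1 \<sigma> = (\<lambda>t. \<Sum>j<2. complex_of_real (c j) / Complex (l j) t)"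
  proof
    fix t
    have "Complex \<sigma> t \<noteq> 0" "Complex (\<sigma> + 1) t \<noteq> 0" using s by (simp_all add: Complex_nonzero)
    moreover have "Complex (\<sigma> + 1) t = Complex \<sigma> t + 1" by (simp add: complex_eq_iff)
    ultimately show "perron1 \<sigma> t = (\<Sum>j<2. complex_of_real (c j) / Complex (l j) t)"
      by (simp add: perron1_def sum2 c_def l_def field_simps)
  qed
  have "(LBINT t. perron1 \<sigma> t * iexp (t * y))
       = 2 * pi * complex_of_real (if y \<le> 0 then 0 else \<Sum>j<2. c j * exp (- l j * y))"
    unfolding K using s integrable_perron(1)[OF s, unfolded K]
    by (intro exp_sum_inversion) (auto simp: sum2 c_def l_def)
  also have "(\<Sum>j<2. c j * exp (- l j * y)) = exp (- \<sigma> * y) * (1 - exp (- y))"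
    by (simp add: sum2 c_def l_def algebra_simps exp_add[symmetric])
  finally show ?thesis .
qed

lemma integral_perron2:
  assumes s: "\<sigma> > 1" and y: "y > 0"
  shows "(LBINT t. perron2 \<sigma> t * iexp (t * y))
       = 2 * pi * complex_of_real (exp (- \<sigma> * y) * (exp y / 2 - 1 + exp (- y) / 2))"
proof -
  \<comment> \<open>Residues of 1/((s - 1) s (s + 1)) at 1, 0 and -1, again with sum 0.\<close>
  define c :: "nat \<Rightarrow> real" where "c = (\<lambda>j. if j = 0 then 1/2 else if j = 1 then - 1 else 1/2)"
  define l :: "nat \<Rightarrow> real" where "l = (\<lambda>j. if j = 0 then \<sigma> - 1 else if j = 1 then \<sigma> else \<sigma> + 1)"
  have sum3: "(\<Sum>j<3. f j) = f 0 + f 1 + f (2::nat)" for f :: "nat \<Rightarrow> 'a :: comm_monoid_add"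
    by (simp add: eval_nat_numeral)
  have K: "perron2 \<sigma> = (\<lambda>t. \<Sum>j<3. complex_of_real (c j) / Complex (l j) t)"
  proof
    fix t
    define z where "z = Complex \<sigma> t"
    have "z \<noteq> 0" "z + 1 \<noteq> 0" "z - 1 \<noteq> 0" using s by (auto simp: z_def complex_eq_iff)
    moreover have "2 + z * 2 \<noteq> 0"
    proof -
      have "2 + z * 2 = 2 * (z + 1)" by simp
      thus ?thesis using \<open>z + 1 \<noteq> 0\<close> by (simp only: mult_eq_0_iff) simp
    qed
    moreover have "Complex (\<sigma> + 1) t = z + 1" "Complex (\<sigma> - 1) t = z - 1" by (simp_all add: z_def complex_eq_iff)
    ultimately show "perron2 \<sigma> t = (\<Sum>j<3. complex_of_real (c j) / Complex (l j) t)"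
      by (simp add: perron2_def sum3 c_def l_def z_def[symmetric] divide_simps) (simp add: algebra_simps)
  qed
  have "(LBINT t. perron2 \<sigma> t * iexp (t * y))
       = 2 * pi * complex_of_real (if y \<le> 0 then 0 else \<Sum>j<3. c j * exp (- l j * y))"
    unfolding K using s integrable_perron(2)[OF s, unfolded K]
    by (intro exp_sum_inversion) (auto simp: sum3 c_def l_def)
  also have "(\<Sum>j<3. c j * exp (- l j * y)) = exp (- \<sigma> * y) * (exp y / 2 - 1 + exp (- y) / 2)"
    by (simp add: sum3 c_def l_def algebra_simps exp_add[symmetric])
  finally show ?thesis using y by simp
qed

text \<open>First Riesz mean of the von Mangoldt function, minus the contribution of the pole.\<close>

definition riesz :: "real \<Rightarrow> real" where
  "riesz x = (\<Sum>n\<le>nat \<lfloor>x\<rfloor>. mangoldt n * (1 - real n / x)) - (x / 2 - 1 + 1 / (2 * x))"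

text \<open>Integrating the Dirichlet series termwise, the n-th term becomes the inverse transform
  at ln (x / n), which is 0 for n \<ge> x; this truncates the sum at x.\<close>

lemma integral_mangoldt_perron1:
  assumes s: "\<sigma> > 1" and x: "x > 1"
  shows "integrable lborel (\<lambda>t. dseries mangoldt (Complex \<sigma> t) * (perron1 \<sigma> t * iexp (t * ln x)))"
    and "(LBINT t. dseries mangoldt (Complex \<sigma> t) * (perron1 \<sigma> t * iexp (t * ln x)))
      = 2 * pi * complex_of_real (x powr (- \<sigma>) * (\<Sum>n\<le>nat \<lfloor>x\<rfloor>. mangoldt n * (1 - real n / x)))"
proof -
  let ?f = "\<lambda>n t. complex_of_real (mangoldt n * real n powr (- \<sigma>)) * (perron1 \<sigma> t * iexp (t * (ln x - ln (real n))))"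
  have [measurable]: "perron1 \<sigma> \<in> borel_measurable borel" using perron_measurable[OF s] by simp
  note int1 = integrable_perron(1)[OF s]
  have intf: "integrable lborel (?f n)" for n
    by (intro integrable_mult_right Bochner_Integration.integrable_bound[OF int1]) (auto simp: norm_mult)
  have summ: "summable (\<lambda>n. \<bar>mangoldt n\<bar> * real n powr (- \<sigma>))"
    using dconv_mangoldt s by (auto simp: dconv_def)
  have nf: "norm (?f n t) = mangoldt n * real n powr (- \<sigma>) * norm (perron1 \<sigma> t)" for n t
    by (simp add: norm_mult mangoldt_nonneg)
  have eq: "dseries mangoldt (Complex \<sigma> t) * (perron1 \<sigma> t * iexp (t * ln x)) = (\<Sum>n. ?f n t)" for t
  proof -
    have "(\<lambda>n. of_real (mangoldt n) * of_nat n powr (- Complex \<sigma> t) * (perron1 \<sigma> t * iexp (t * ln x)))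
        sums (dseries mangoldt (Complex \<sigma> t) * (perron1 \<sigma> t * iexp (t * ln x)))"
      using s by (intro sums_mult2 dseries_sums(1) dconv_mangoldt) simp
    also have "(\<lambda>n. of_real (mangoldt n) * of_nat n powr (- Complex \<sigma> t) * (perron1 \<sigma> t * iexp (t * ln x))) = (\<lambda>n. ?f n t)"
    proof
      fix n :: nat
      show "of_real (mangoldt n) * of_nat n powr (- Complex \<sigma> t) * (perron1 \<sigma> t * iexp (t * ln x)) = ?f n t"
      proof (cases "n = 0")
        case False
        have "(of_nat n :: complex) powr (- Complex \<sigma> t) = exp (of_real (- \<sigma> * ln (real n)) + - \<i> * of_real (t * ln (real n)))"
          using False by (simp add: powr_def Ln_of_nat Complex_eq algebra_simps)
        also have "\<dots> = of_real (real n powr (- \<sigma>)) * exp (- \<i> * of_real (t * ln (real n)))"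
          using False unfolding exp_add by (simp add: powr_def exp_of_real[symmetric])
        finally show ?thesis
          by (simp add: algebra_simps exp_diff exp_minus field_simps)
      qed auto
    qed
    finally show ?thesis by (simp add: sums_iff)
  qed
  have s1: "AE t in lborel. summable (\<lambda>n. norm (?f n t))"
    unfolding nf using summ by (auto intro!: summable_mult2 AE_I2)
  have s2: "summable (\<lambda>n. LBINT t. norm (?f n t))"
    unfolding nf using summ by (auto intro!: summable_mult2)
  show "integrable lborel (\<lambda>t. dseries mangoldt (Complex \<sigma> t) * (perron1 \<sigma> t * iexp (t * ln x)))"
    unfolding eq by (rule integrable_suminf[OF intf s1 s2])
  have "(LBINT t. dseries mangoldt (Complex \<sigma> t) * (perron1 \<sigma> t * iexp (t * ln x))) = (\<Sum>n. LBINT t. ?f n t)"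
    unfolding eq by (rule integral_suminf[OF intf s1 s2])
  also have "(\<lambda>n. LBINT t. ?f n t) = (\<lambda>n. if n \<in> {..nat \<lfloor>x\<rfloor>} then
       2 * pi * complex_of_real (x powr (- \<sigma>) * (mangoldt n * (1 - real n / x))) else 0)"
  proof
    fix n :: nat
    have "(LBINT t. ?f n t) = complex_of_real (mangoldt n * real n powr (- \<sigma>)) *
        (2 * pi * complex_of_real (if ln x - ln (real n) \<le> 0 then 0 else exp (- \<sigma> * (ln x - ln (real n))) * (1 - exp (- (ln x - ln (real n))))))"
      by (simp only: integral_mult_right_zero integral_perron1[OF s])
    also have "\<dots> = (if n \<in> {..nat \<lfloor>x\<rfloor>} then
       2 * pi * complex_of_real (x powr (- \<sigma>) * (mangoldt n * (1 - real n / x))) else 0)"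
    proof (cases "n = 0")
      case False
      let ?d = "ln x - ln (real n)"
      have 1: "?d \<le> 0 \<longleftrightarrow> x \<le> real n" using x False by simp
      have 2: "n \<in> {..nat \<lfloor>x\<rfloor>} \<longleftrightarrow> real n \<le> x" using x by (simp add: le_nat_iff le_floor_iff)
      have 3: "exp (- ?d) = real n / x" using x False by (simp add: exp_diff)
      have 4: "real n powr (- \<sigma>) * exp (- \<sigma> * ?d) = x powr (- \<sigma>)"
        using x False by (simp add: powr_def exp_add[symmetric] algebra_simps)
      have "complex_of_real (mangoldt n * real n powr (- \<sigma>)) * (2 * pi * complex_of_real (exp (- \<sigma> * ?d) * (1 - exp (- ?d))))
          = 2 * pi * complex_of_real ((real n powr (- \<sigma>) * exp (- \<sigma> * ?d)) * (mangoldt n * (1 - exp (- ?d))))"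
        by (simp only: of_real_mult mult_ac)
      also have "\<dots> = 2 * pi * complex_of_real (x powr (- \<sigma>) * (mangoldt n * (1 - real n / x)))"
        by (simp only: 3 4)
      \<comment> \<open>The two cut-offs disagree only at n = x, where 1 - n / x is 0
        anyway.\<close>
      finally show ?thesis unfolding 1 2 using x
        by (cases "real n = x") (auto simp del: of_real_mult)
    qed auto
    finally show "(LBINT t. ?f n t) = (if n \<in> {..nat \<lfloor>x\<rfloor>} then
       2 * pi * complex_of_real (x powr (- \<sigma>) * (mangoldt n * (1 - real n / x))) else 0)" .
  qed
  also have "(\<Sum>n. if n \<in> {..nat \<lfloor>x\<rfloor>} then 2 * pi * complex_of_real (x powr (- \<sigma>) * (mangoldt n * (1 - real n / x))) else 0)
     = (\<Sum>n\<le>nat \<lfloor>x\<rfloor>. 2 * pi * complex_of_real (x powr (- \<sigma>) * (mangoldt n * (1 - real n / x))))"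
    by (subst suminf_finite[of "{..nat \<lfloor>x\<rfloor>}"]) auto
  also have "\<dots> = 2 * pi * complex_of_real (x powr (- \<sigma>) * (\<Sum>n\<le>nat \<lfloor>x\<rfloor>. mangoldt n * (1 - real n / x)))"
    by (simp add: sum_distrib_left)
  finally show "(LBINT t. dseries mangoldt (Complex \<sigma> t) * (perron1 \<sigma> t * iexp (t * ln x)))
      = 2 * pi * complex_of_real (x powr (- \<sigma>) * (\<Sum>n\<le>nat \<lfloor>x\<rfloor>. mangoldt n * (1 - real n / x)))" .
qed

lemma integral_Gker:
  assumes s: "\<sigma> > 1" and x: "x > 1"
  shows "(LBINT t. Gker (Complex \<sigma> t) * iexp (t * ln x)) = 2 * pi * complex_of_real (x powr (- \<sigma>) * riesz x)"
proof -
  have eq: "Gker (Complex \<sigma> t) * iexp (t * ln x)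
     = dseries mangoldt (Complex \<sigma> t) * (perron1 \<sigma> t * iexp (t * ln x)) - perron2 \<sigma> t * iexp (t * ln x)" for t
  proof -
    have 1: "Complex (\<sigma> + 1) t = Complex \<sigma> t + 1" "Complex (\<sigma> - 1) t = Complex \<sigma> t - 1" by (simp_all add: complex_eq_iff)
    have "Gker (Complex \<sigma> t) = dseries mangoldt (Complex \<sigma> t) * perron1 \<sigma> t - perron2 \<sigma> t"
      using Gker_eq[of "Complex \<sigma> t"] s by (simp add: perron1_def perron2_def 1 diff_divide_distrib mult_ac)
    thus ?thesis by (simp only: left_diff_distrib mult.assoc)
  qed
  have [measurable]: "perron2 \<sigma> \<in> borel_measurable borel" using perron_measurable[OF s] by simp
  have "integrable lborel (\<lambda>t. perron2 \<sigma> t * iexp (t * ln x))"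
    by (rule Bochner_Integration.integrable_bound[OF integrable_perron(2)[OF s]]) (auto simp: norm_mult)
  note i = integral_mangoldt_perron1(1)[OF s x] this
  have "(LBINT t. Gker (Complex \<sigma> t) * iexp (t * ln x))
     = 2 * pi * complex_of_real (x powr (- \<sigma>) * (\<Sum>n\<le>nat \<lfloor>x\<rfloor>. mangoldt n * (1 - real n / x)))
      - 2 * pi * complex_of_real (exp (- \<sigma> * ln x) * (exp (ln x) / 2 - 1 + exp (- ln x) / 2))"
    unfolding eq using x
    by (subst Bochner_Integration.integral_diff[OF i])
       (simp only: integral_mangoldt_perron1(2)[OF s x] integral_perron2[OF s] ln_gt_zero_iff)
  also have "exp (- \<sigma> * ln x) = x powr (- \<sigma>)" using x by (simp add: powr_def)
  also have "exp (ln x) / 2 - 1 + exp (- ln x) / 2 = x / 2 - 1 + 1 / (2 * x)"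
    using x by (simp add: exp_minus field_simps)
  finally show ?thesis by (simp add: riesz_def algebra_simps)
qed

text \<open>Along the line, the derivative in t is \<i> times the complex derivative; this cancels
  the \<i> of \<open>fourier_by_parts\<close> and leaves a factor - y per order.\<close>

lemma integral_higher_deriv_Gker:
  fixes \<sigma> y :: real
  assumes s: "1 < \<sigma>" "\<sigma> \<le> 3/2"
  shows "integrable lborel (\<lambda>t. (deriv ^^ k) Gker (Complex \<sigma> t))"
    and "(LBINT t. (deriv ^^ k) Gker (Complex \<sigma> t) * iexp (t * y)) = complex_of_real ((- y) ^ k) * (LBINT t. Gker (Complex \<sigma> t) * iexp (t * y))"
proof -
  let ?g = "\<lambda>k t. (deriv ^^ k) Gker (Complex \<sigma> t)"
  have mem: "Complex \<sigma> t \<in> Gdom" for t using s by (intro Gdom) auto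
  have hol: "(deriv ^^ k) Gker holomorphic_on Gdom" for k
    by (rule holomorphic_higher_deriv[OF Gdom(2,1)])
  have cont: "continuous_on UNIV (?g k)" for k
    using holomorphic_on_imp_continuous_on[OF hol[of k]] mem
    by (intro continuous_on_compose2[OF _ continuous_on_Complex_line]) auto
  have meas [measurable]: "?g k \<in> borel_measurable borel" for k
    by (rule borel_measurable_continuous_onI[OF cont])
  have bound: "\<exists>C. \<forall>t. norm (?g k t) \<le> C * (\<bar>t\<bar> + 2) powr (- 3/2)" for k
    using higher_deriv_Gker_bound[of k] s by (metis complex.sel)
  have int: "integrable lborel (?g k)" for k
  proof -
    obtain C where C: "\<And>t. norm (?g k t) \<le> C * (\<bar>t\<bar> + 2) powr (- 3/2)" using bound by blast
    have "integrable lborel (\<lambda>t. C * (\<bar>t\<bar> + 2) powr (- 3/2))"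
      by (intro integrable_mult_right integrable_abs_plus_2_powr) auto
    thus ?thesis
      by (rule Bochner_Integration.integrable_bound) (use C in \<open>auto intro: order.trans[OF _ abs_ge_self]\<close>)
  qed
  thus "integrable lborel (?g k)" .
  have lim: "(?g k \<longlongrightarrow> 0) at_top" "(?g k \<longlongrightarrow> 0) at_bot" for k
  proof -
    obtain C where C: "\<And>t. norm (?g k t) \<le> C * (\<bar>t\<bar> + 2) powr (- 3/2)" using bound by blast
    have "((\<lambda>t::real. C * (\<bar>t\<bar> + 2) powr (- 3/2)) \<longlongrightarrow> 0) at_top" by real_asymp
    thus "(?g k \<longlongrightarrow> 0) at_top"
      by (rule Lim_null_comparison[rotated]) (use C in auto)
    have "((\<lambda>t::real. C * (\<bar>t\<bar> + 2) powr (- 3/2)) \<longlongrightarrow> 0) at_bot" by real_asymp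
    thus "(?g k \<longlongrightarrow> 0) at_bot"
      by (rule Lim_null_comparison[rotated]) (use C in auto)
  qed
  have step: "(LBINT t. ?g (Suc k) t * iexp (t * y)) = - y * (LBINT t. ?g k t * iexp (t * y))" for k
  proof -
    have "(LBINT t. (\<i> * ?g (Suc k) t) * iexp (t * y)) = - \<i> * y * (LBINT t. ?g k t * iexp (t * y))"
    proof (rule fourier_by_parts[OF _ _ int _ lim])
      show "(?g k has_vector_derivative \<i> * ?g (Suc k) t) (at t)" for t
      proof -
        have "((deriv ^^ k) Gker has_field_derivative (deriv ^^ Suc k) Gker (Complex \<sigma> t)) (at (Complex \<sigma> t))"
          using holomorphic_derivI[OF hol Gdom(1) mem] by simp
        moreover have "((\<lambda>t. Complex \<sigma> t) has_vector_derivative \<i>) (at t)"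
          unfolding Complex_eq by (auto intro!: derivative_eq_intros simp: has_vector_derivative_def scaleR_conv_of_real mult.commute)
        ultimately show ?thesis
          using field_vector_diff_chain_at by (fastforce simp: o_def mult.commute)
      qed
      show "continuous_on UNIV (\<lambda>t. \<i> * ?g (Suc k) t)" by (intro continuous_intros cont)
      show "integrable lborel (\<lambda>t. \<i> * ?g (Suc k) t)" by (intro integrable_mult_right int)
    qed
    hence "\<i> * (LBINT t. ?g (Suc k) t * iexp (t * y)) = \<i> * (- y * (LBINT t. ?g k t * iexp (t * y)))"
      by (simp only: mult.assoc integral_mult_right_zero) simp
    thus ?thesis by (simp only: mult_cancel_left) simp
  qed
  show "(LBINT t. ?g k t * iexp (t * y)) = complex_of_real ((- y) ^ k) * (LBINT t. Gker (Complex \<sigma> t) * iexp (t * y))"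
  proof (induction k)
    case (Suc k)
    show ?case unfolding step Suc by simp
  qed simp
qed

text \<open>The integral of the k-th derivative is bounded uniformly in \<open>\<sigma>\<close>, and
  up to sign it equals 2 pi (ln x)^k x^(- \<sigma>) riesz(x).\<close>

lemma riesz_bound:
  obtains C where "C > 0" "\<And>x. x > 1 \<Longrightarrow> \<bar>riesz x\<bar> \<le> C * x / ln x ^ k"
proof -
  obtain C where C: "\<And>s. 1 < Re s \<Longrightarrow> Re s \<le> 3/2 \<Longrightarrow> norm ((deriv ^^ k) Gker s) \<le> C * (\<bar>Im s\<bar> + 2) powr (- 3/2)"
    using higher_deriv_Gker_bound[of k] by blast
  define I where "I = (LBINT t. (\<bar>C\<bar> + 1) * (\<bar>t\<bar> + 2) powr (- 3/2))"
  have int: "integrable lborel (\<lambda>t. (\<bar>C\<bar> + 1) * (\<bar>t\<bar> + 2) powr (- 3/2))"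
    by (intro integrable_mult_right integrable_abs_plus_2_powr) auto
  have I0: "I \<ge> 0" unfolding I_def by (intro integral_nonneg_AE) auto
  show thesis
  proof (rule that[of "(I + 1) * exp 1"])
    fix x :: real assume x: "x > 1"
    define y where "y = ln x"
    have y: "y > 0" using x by (simp add: y_def)
    \<comment> \<open>x powr (1 / (2 + ln x)) is at most exp 1, so x powr \<open>\<sigma>\<close> is
      O(x); the summand 2 keeps \<open>\<sigma>\<close> within 3/2.\<close>
    define \<sigma> where "\<sigma> = 1 + 1 / (2 + y)"
    have s: "1 < \<sigma>" "\<sigma> \<le> 3/2" using y by (auto simp: \<sigma>_def field_simps)
    have "norm (LBINT t. (deriv ^^ k) Gker (Complex \<sigma> t) * iexp (t * y)) \<le> I"
      unfolding I_def
    proof (rule Bochner_Integration.integral_norm_bound_integral)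
      have [measurable]: "(\<lambda>t. (deriv ^^ k) Gker (Complex \<sigma> t)) \<in> borel_measurable borel"
        using borel_measurable_integrable[OF integral_higher_deriv_Gker(1)[OF s, of k]] by simp
      show "integrable lborel (\<lambda>t. (deriv ^^ k) Gker (Complex \<sigma> t) * iexp (t * y))"
        by (rule Bochner_Integration.integrable_bound[OF integral_higher_deriv_Gker(1)[OF s, of k]]) (auto simp: norm_mult)
      show "norm ((deriv ^^ k) Gker (Complex \<sigma> t) * iexp (t * y)) \<le> (\<bar>C\<bar> + 1) * (\<bar>t\<bar> + 2) powr (- 3/2)" for t
      proof -
        have "norm ((deriv ^^ k) Gker (Complex \<sigma> t) * iexp (t * y)) \<le> C * (\<bar>t\<bar> + 2) powr (- 3/2)"
          using C[of "Complex \<sigma> t"] s by (simp add: norm_mult)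
        also have "\<dots> \<le> (\<bar>C\<bar> + 1) * (\<bar>t\<bar> + 2) powr (- 3/2)" by (intro mult_right_mono) auto
        finally show ?thesis .
      qed
    qed (rule int)
    also have "(LBINT t. (deriv ^^ k) Gker (Complex \<sigma> t) * iexp (t * y))
       = complex_of_real ((- y) ^ k * (2 * pi * (x powr (- \<sigma>) * riesz x)))"
      unfolding integral_higher_deriv_Gker(2)[OF s] integral_Gker[OF s(1) x, folded y_def] by simp
    also have "norm \<dots> = y ^ k * (2 * pi * (x powr (- \<sigma>) * \<bar>riesz x\<bar>))"
      using y by (simp only: norm_of_real) (simp add: abs_mult power_abs)
    also have "y ^ k * (x powr (- \<sigma>) * \<bar>riesz x\<bar>) \<le> y ^ k * (2 * pi * (x powr (- \<sigma>) * \<bar>riesz x\<bar>))"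
      using pi_ge_two y mult_right_mono[of 1 "2 * pi" "x powr (- \<sigma>) * \<bar>riesz x\<bar>"] by (intro mult_left_mono) auto
    finally have "y ^ k * (x powr (- \<sigma>) * \<bar>riesz x\<bar>) \<le> I" by simp
    hence "\<bar>riesz x\<bar> \<le> I * x powr \<sigma> / y ^ k"
      using x y by (simp add: powr_minus field_simps)
    also have "x powr \<sigma> \<le> x * exp 1"
    proof -
      have "x powr \<sigma> = x * exp (y / (2 + y))"
      proof -
        have "x powr \<sigma> = x * x powr (1 / (2 + y))" using x by (simp add: \<sigma>_def powr_add)
        also have "x powr (1 / (2 + y)) = exp (y / (2 + y))" using x by (simp add: powr_def y_def)
        finally show ?thesis .
      qed
      also have "\<dots> \<le> x * exp 1" using x y by (intro mult_left_mono) (auto simp: field_simps)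
      finally show ?thesis .
    qed
    hence "I * x powr \<sigma> / y ^ k \<le> (I + 1) * (x * exp 1) / y ^ k"
      using I0 y x by (intro divide_right_mono mult_mono) auto
    finally show "\<bar>riesz x\<bar> \<le> (I + 1) * exp 1 * x / ln x ^ k"
      by (simp add: y_def mult_ac)
  qed (use I0 in auto)
qed

subsection \<open>The prime number theorem with logarithmic savings\<close>

lemma ln_power_bigo_powr:
  assumes "e > 0"
  shows "(\<lambda>n. ln (real n) ^ j) \<in> O(\<lambda>n. real n powr e)"
proof -
  define d where "d = e / real (Suc j)"
  have d: "d > 0" using assms by (simp add: d_def)
  have "(\<lambda>n. ln (real n)) \<in> O(\<lambda>n. real n powr d)"
  proof (rule bigoI[where c="1/d"])
    show "\<forall>\<^sub>F n in sequentially. norm (ln (real n)) \<le> 1 / d * norm (real n powr d)"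
      using eventually_ge_at_top[of 1]
      by eventually_elim (use ln_le_powr[OF _ d] in auto)
  qed
  hence "(\<lambda>n. ln (real n) ^ j) \<in> O(\<lambda>n. (real n powr d) ^ j)" by (rule landau_o.big_power)
  also have "(\<lambda>n. (real n powr d) ^ j) \<in> O(\<lambda>n. real n powr e)"
  proof (rule bigoI[where c=1])
    show "\<forall>\<^sub>F n in sequentially. norm ((real n powr d) ^ j) \<le> 1 * norm (real n powr e)"
      using eventually_ge_at_top[of 1]
    proof eventually_elim
      case (elim n)
      have "(real n powr d) ^ j = real n powr (d * real j)" using elim by (simp add: powr_power mult.commute)
      also have "\<dots> \<le> real n powr e" using elim assms by (intro powr_mono) (auto simp: d_def field_simps)
      finally show ?case using elim by simp
    qed
  qed
  finally show ?thesis .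
qed

lemma powr_bigo_over_ln:
  assumes "a < 1"
  shows "(\<lambda>n. real n powr a) \<in> O(\<lambda>n. real n / ln (real n) ^ j)"
proof -
  have "(\<lambda>n. real n powr a * ln (real n) ^ j) \<in> O(\<lambda>n. real n powr a * real n powr (1 - a))"
    using assms by (intro landau_o.big.mult_left ln_power_bigo_powr) auto
  also have "(\<lambda>n. real n powr a * real n powr (1 - a)) = (\<lambda>n. real n)"
    by (simp add: powr_add[symmetric])
  finally have "(\<lambda>n. real n powr a * ln (real n) ^ j / ln (real n) ^ j) \<in> O(\<lambda>n. real n / ln (real n) ^ j)"
    by (intro landau_o.big.divide_right eventually_mono[OF eventually_gt_at_top[of 1]]) auto
  also have "?this \<longleftrightarrow> ?thesis"
    by (intro landau_o.big.in_cong eventually_mono[OF eventually_gt_at_top[of 1]]) auto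
  finally show ?thesis .
qed

section \<open>Chebyshev's functions psi and theta\<close>

definition psi :: "nat \<Rightarrow> real" where
  "psi N = (\<Sum>n\<le>N. mangoldt n)"

definition theta :: "nat \<Rightarrow> real" where
  "theta N = (\<Sum>p | prime p \<and> p \<le> N. ln (real p))"

definition psi1 :: "real \<Rightarrow> real" where
  "psi1 x = (\<Sum>n\<le>nat \<lfloor>x\<rfloor>. mangoldt n * (x - real n))"

lemma psi1_eq_riesz:
  assumes "x > 0" shows "psi1 x = (x - 1)\<^sup>2 / 2 + x * riesz x"
proof -
  have "x * riesz x = (\<Sum>n\<le>nat \<lfloor>x\<rfloor>. x * (mangoldt n * (1 - real n / x))) - x * (x / 2 - 1 + 1 / (2 * x))"
    by (simp add: riesz_def right_diff_distrib sum_distrib_left)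
  also have "(\<Sum>n\<le>nat \<lfloor>x\<rfloor>. x * (mangoldt n * (1 - real n / x))) = psi1 x"
    unfolding psi1_def using assms by (intro sum.cong refl) (simp add: field_simps)
  also have "x * (x / 2 - 1 + 1 / (2 * x)) = (x - 1)\<^sup>2 / 2"
    using assms by (simp add: field_simps power2_eq_square)
  finally show ?thesis by simp
qed

text \<open>The cut-off no longer depends on x, so values at two points can be subtracted term by
  term.\<close>

lemma psi1_eq_max:
  assumes "x \<ge> 0" "x < real M + 1"
  shows "psi1 x = (\<Sum>n\<le>M. mangoldt n * max 0 (x - real n))"
proof -
  have *: "n \<le> nat \<lfloor>x\<rfloor> \<longleftrightarrow> real n \<le> x" for n using assms by (simp add: le_nat_iff le_floor_iff)
  have "psi1 x = (\<Sum>n\<le>nat \<lfloor>x\<rfloor>. mangoldt n * max 0 (x - real n))"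
    unfolding psi1_def by (intro sum.cong refl) (auto simp: * max_def)
  also have "\<dots> = (\<Sum>n\<le>M. mangoldt n * max 0 (x - real n))"
  proof (rule sum.mono_neutral_left)
    show "{..nat \<lfloor>x\<rfloor>} \<subseteq> {..M}"
    proof (rule subsetI)
      fix n assume "n \<in> {..nat \<lfloor>x\<rfloor>}"
      hence "real n < real M + 1" using * assms by auto
      thus "n \<in> {..M}" by simp
    qed
  qed (auto simp: * max_def)
  finally show ?thesis .
qed

text \<open>\<open>psi1\<close> is the integral of psi, which is nondecreasing, so its average over
  an interval to the right of N is at least psi(N). The next lemma is the mirror image on the
  left.\<close>

lemma psi_le_diff:
  assumes "h > 0" shows "psi N * h \<le> psi1 (real N + h) - psi1 (real N)"
proof -
  define M where "M = nat \<lfloor>real N + h\<rfloor>"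
  have M: "real N + h < real M + 1" "N \<le> M" using assms unfolding M_def by linarith+
  have "psi N * h = (\<Sum>n\<le>N. mangoldt n * (max 0 (real N + h - real n) - max 0 (real N - real n)))"
    unfolding psi_def sum_distrib_right using assms by (intro sum.cong) auto
  also have "\<dots> \<le> (\<Sum>n\<le>M. mangoldt n * (max 0 (real N + h - real n) - max 0 (real N - real n)))"
    using M assms by (intro sum_mono2) (auto intro!: mult_nonneg_nonneg mangoldt_nonneg)
  also have "\<dots> = psi1 (real N + h) - psi1 (real N)"
    using M assms psi1_eq_max[of "real N + h" M] psi1_eq_max[of "real N" M]
    by (simp add: right_diff_distrib sum_subtractf)
  finally show ?thesis .
qed

lemma psi_ge_diff:
  assumes "h > 0" "h \<le> real N" shows "psi1 (real N) - psi1 (real N - h) \<le> psi N * h"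
proof -
  have "psi1 (real N) - psi1 (real N - h) = (\<Sum>n\<le>N. mangoldt n * (max 0 (real N - real n) - max 0 (real N - h - real n)))"
    using assms psi1_eq_max[of "real N" N] psi1_eq_max[of "real N - h" N]
    by (simp add: right_diff_distrib sum_subtractf)
  also have "\<dots> \<le> (\<Sum>n\<le>N. mangoldt n * h)"
    using assms by (intro sum_mono mult_left_mono mangoldt_nonneg) (auto simp: max_def)
  finally show ?thesis by (simp add: psi_def sum_distrib_right)
qed

text \<open>Differencing over a length h costs h from the main term and x^2 / (h ln^(2j) x) from the
  Riesz mean. Taking h of order x / ln^j x balances them, whence the 2j logarithms.\<close>

lemma psi_asymp: "(\<lambda>N. psi N - real N) \<in> O(\<lambda>N. real N / ln (real N) ^ j)"
proof -
  obtain C where C: "C > 0" "\<And>x. x > 1 \<Longrightarrow> \<bar>riesz x\<bar> \<le> C * x / ln x ^ (2 * j)"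
    using riesz_bound[of "2 * j"] by blast
  have R: "\<bar>x * riesz x\<bar> \<le> C * x\<^sup>2 / ln x ^ (2 * j)" if "x > 1" for x
    using mult_left_mono[OF C(2)[OF that], of x] that by (simp add: abs_mult power2_eq_square mult_ac)
  define K where "K = 2 + 20 * C + 4 * C * (1 + 4 ^ j)"
  have "(\<lambda>n. ln (real n) ^ j) \<in> O(\<lambda>n. real n powr (1/2))" by (rule ln_power_bigo_powr) simp
  then obtain c where c: "c > 0" "\<forall>\<^sub>F n in sequentially. norm (ln (real n) ^ j) \<le> c * norm (real n powr (1/2))"
    by (elim landau_o.bigE) blast
  have "\<forall>\<^sub>F n in sequentially. c * real n powr (1/2) \<le> real n" using c(1) by real_asymp
  with c(2) have "\<forall>\<^sub>F N in sequentially. real N / ln (real N) ^ j \<ge> 1"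
    using eventually_ge_at_top[of 2]
  proof eventually_elim
    case (elim N)
    have "ln (real N) ^ j > 0" using elim by simp
    thus ?case using elim by simp
  qed
  moreover have "\<forall>\<^sub>F N in sequentially. ln (real N) \<ge> 2" by real_asymp
  ultimately have "\<forall>\<^sub>F N in sequentially. norm (psi N - real N) \<le> K * norm (real N / ln (real N) ^ j)"
    using eventually_ge_at_top[of 4]
  proof eventually_elim
    case (elim N)
    define x where "x = real N"
    \<comment> \<open>The factor 1/2 ensures h \<le> x / 2; together with x \<ge> 4 this gives ln (x
      - h) \<ge> ln x / 2.\<close>
    define h where "h = x / ln x ^ j / 2"
    have x: "x \<ge> 4" "ln x \<ge> 2" using elim by (auto simp: x_def)
    have l1: "ln x ^ j \<ge> 1" using x by (intro one_le_power) auto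
    have h: "h > 0" "h \<le> x / 2" using x l1 by (auto simp: h_def field_simps)
    have h2: "x\<^sup>2 / ln x ^ (2 * j) = 4 * h\<^sup>2"
      by (simp add: h_def power_divide power_mult[symmetric] mult.commute)
    have b0: "\<bar>x * riesz x\<bar> \<le> 4 * C * h\<^sup>2"
      using R[of x] x h2 by (simp flip: times_divide_eq_right)
    have b1: "\<bar>(x + h) * riesz (x + h)\<bar> \<le> 16 * C * h\<^sup>2"
    proof -
      have "\<bar>(x + h) * riesz (x + h)\<bar> \<le> C * (x + h)\<^sup>2 / ln (x + h) ^ (2 * j)" using x h by (intro R) auto
      also have "\<dots> \<le> C * (2 * x)\<^sup>2 / ln x ^ (2 * j)"
        using x h C by (intro frac_le mult_left_mono power_mono) auto
      also have "\<dots> = C * 4 * (x\<^sup>2 / ln x ^ (2 * j))" by (simp add: power_mult_distrib)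
      finally show ?thesis unfolding h2 by simp
    qed
    have b2: "\<bar>(x - h) * riesz (x - h)\<bar> \<le> 4 * C * 4 ^ j * h\<^sup>2"
    proof -
      have "ln (4::real) \<le> ln x" using x by simp
      moreover have "ln (4::real) = 2 * ln 2" using ln_realpow[of 2 2] by simp
      ultimately have "ln x / 2 \<le> ln (x / 2)" using x by (simp add: ln_div)
      also have "\<dots> \<le> ln (x - h)" using x h by simp
      finally have l: "ln x / 2 \<le> ln (x - h)" .
      have "\<bar>(x - h) * riesz (x - h)\<bar> \<le> C * (x - h)\<^sup>2 / ln (x - h) ^ (2 * j)" using x h by (intro R) auto
      also have "\<dots> \<le> C * x\<^sup>2 / (ln x / 2) ^ (2 * j)"
        using x h C l by (intro frac_le mult_left_mono power_mono) auto
      also have "\<dots> = C * 4 ^ j * (x\<^sup>2 / ln x ^ (2 * j))" by (simp add: power_divide power_mult)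
      finally show ?thesis unfolding h2 by simp
    qed
    have up: "psi N * h \<le> (x + h - 1)\<^sup>2 / 2 - (x - 1)\<^sup>2 / 2 + 16 * C * h\<^sup>2 + 4 * C * h\<^sup>2"
      using psi_le_diff[OF h(1), of N] psi1_eq_riesz[of "x + h"] psi1_eq_riesz[of x] b0 b1 x h
      by (simp add: x_def[symmetric])
    have lo: "psi N * h \<ge> (x - 1)\<^sup>2 / 2 - (x - h - 1)\<^sup>2 / 2 - 4 * C * h\<^sup>2 - 4 * C * 4 ^ j * h\<^sup>2"
      using psi_ge_diff[OF h(1), of N] psi1_eq_riesz[of "x - h"] psi1_eq_riesz[of x] b0 b2 x h
      by (simp add: x_def[symmetric])
    have "psi N * h \<le> (x - 1 + h / 2 + 20 * C * h) * h"
      using up by (simp add: power2_eq_square field_simps)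
    hence up': "psi N \<le> x - 1 + h / 2 + 20 * C * h" using h by (simp only: mult_le_cancel_right_pos)
    have "psi N * h \<ge> (x - 1 - h / 2 - 4 * C * (1 + 4 ^ j) * h) * h"
      using lo by (simp add: power2_eq_square field_simps)
    hence lo': "psi N \<ge> x - 1 - h / 2 - 4 * C * (1 + 4 ^ j) * h" using h by (simp only: mult_le_cancel_right_pos)
    \<comment> \<open>Absorbs the - 1 left over from the main term (x - 1)^2 / 2.\<close>
    have H: "1 \<le> 2 * h" using elim by (simp add: h_def x_def)
    have "0 \<le> C * h" "0 \<le> C * (1 + 4 ^ j) * h" using C h by auto
    hence "\<bar>psi N - x\<bar> \<le> K * (2 * h)"
      using up' lo' H h(1) unfolding K_def by (simp add: algebra_simps abs_le_iff)
    moreover have "2 * h = x / ln x ^ j" by (simp add: h_def)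
    ultimately show ?case using x by (simp add: x_def)
  qed
  thus ?thesis by (rule bigoI)
qed

text \<open>What remains are the prime powers p^k with k \<ge> 2: p is at most sqrt N, k at most
  log_2 N, and each contributes at most ln N.\<close>

lemma theta_psi:
  assumes N: "N \<ge> 1"
  shows "0 \<le> psi N - theta N" "psi N - theta N \<le> (sqrt (real N) + 1) * (log 2 (real N) + 1) * ln (real N)"
proof -
  let ?S = "{n. n \<le> N \<and> primepow n \<and> \<not>prime n}"
  have fin: "finite ?S" by simp
  have "psi N = (\<Sum>n | prime n \<and> n \<le> N. mangoldt n) + (\<Sum>n | n \<le> N \<and> \<not> prime n. mangoldt n)"
    unfolding psi_def by (subst sum.union_disjoint[symmetric]) (auto intro!: sum.cong)
  also have "(\<Sum>n | prime n \<and> n \<le> N. mangoldt n) = theta N"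
    unfolding theta_def by (intro sum.cong) auto
  also have "(\<Sum>n | n \<le> N \<and> \<not> prime n. mangoldt n :: real) = (\<Sum>n\<in>?S. mangoldt n)"
    by (intro sum.mono_neutral_right) (auto simp: mangoldt_def)
  finally have eq: "psi N - theta N = (\<Sum>n\<in>?S. mangoldt n)" by simp
  show "0 \<le> psi N - theta N" unfolding eq by (intro sum_nonneg mangoldt_nonneg)
  let ?A = "{1..nat \<lfloor>sqrt (real N)\<rfloor>} \<times> {1..nat \<lfloor>log 2 (real N)\<rfloor>}"
  have sub: "?S \<subseteq> (\<lambda>(p,k). p ^ k) ` ?A"
  proof
    fix n assume "n \<in> ?S"
    then obtain p k where pk: "prime p" "k > 0" "n = p ^ k" "p ^ k \<le> N" "\<not> prime n"
      by (auto simp: primepow_def)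
    have k2: "k \<ge> 2" using pk by (cases "k = 1") auto
    have p2: "p \<ge> 2" using pk prime_ge_2_nat by auto
    have "real p ^ 2 \<le> real p ^ k" using k2 p2 by (intro power_increasing) auto
    also have "\<dots> \<le> real N" using pk(4) by (metis of_nat_le_iff of_nat_power)
    finally have "real p \<le> sqrt (real N)" by (rule real_le_rsqrt)
    hence 1: "p \<le> nat \<lfloor>sqrt (real N)\<rfloor>" by (simp add: le_nat_iff le_floor_iff)
    have "(2::nat) ^ k \<le> p ^ k" using p2 by (intro power_mono) auto
    hence "(2::nat) ^ k \<le> N" using pk(4) by (rule order.trans)
    hence "real k \<le> log 2 (real N)" using N by (simp add: le_log_iff powr_realpow)
    hence 2: "k \<le> nat \<lfloor>log 2 (real N)\<rfloor>" by linarith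
    show "n \<in> (\<lambda>(p,k). p ^ k) ` ?A"
      using 1 2 k2 p2 pk by (intro image_eqI[of _ _ "(p,k)"]) auto
  qed
  have "card ?S \<le> card ?A"
    using card_mono[OF _ sub] card_image_le[of ?A "\<lambda>(p,k). p ^ k"] by fastforce
  hence "real (card ?S) \<le> real (card ?A)" by (rule of_nat_mono)
  also have "real (card ?A) = real (nat \<lfloor>sqrt (real N)\<rfloor>) * real (nat \<lfloor>log 2 (real N)\<rfloor>)"
    by (simp only: card_cartesian_product card_atLeastAtMost of_nat_mult) simp
  also have "\<dots> \<le> (sqrt (real N) + 1) * (log 2 (real N) + 1)"
  proof (intro mult_mono)
    have "log 2 (real N) \<ge> 0" using N by simp
    thus "real (nat \<lfloor>log 2 (real N)\<rfloor>) \<le> log 2 (real N) + 1" by linarith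
    have "sqrt (real N) \<ge> 0" by simp
    thus "real (nat \<lfloor>sqrt (real N)\<rfloor>) \<le> sqrt (real N) + 1" "0 \<le> sqrt (real N) + 1" by linarith+
  qed auto
  finally have c: "real (card ?S) \<le> (sqrt (real N) + 1) * (log 2 (real N) + 1)" .
  have "(\<Sum>n\<in>?S. mangoldt n) \<le> (\<Sum>n\<in>?S. ln (real N))"
  proof (intro sum_mono)
    fix n assume "n \<in> ?S"
    hence n: "n \<le> N" "n > 0" by (auto intro: primepow_gt_0_nat)
    hence "mangoldt n \<le> ln (real n)" by (intro mangoldt_le_ln) simp
    also have "\<dots> \<le> ln (real N)" using n by simp
    finally show "mangoldt n \<le> ln (real N)" .
  qed
  also have "\<dots> = real (card ?S) * ln (real N)" by simp
  also have "\<dots> \<le> (sqrt (real N) + 1) * (log 2 (real N) + 1) * ln (real N)"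
    using c N by (intro mult_right_mono) auto
  finally show "psi N - theta N \<le> (sqrt (real N) + 1) * (log 2 (real N) + 1) * ln (real N)" using eq by simp
qed

lemma theta_asymp: "(\<lambda>N. theta N - real N) \<in> O(\<lambda>N. real N / ln (real N) ^ j)"
proof -
  have "(\<lambda>N. psi N - theta N) \<in> O(\<lambda>N. (sqrt (real N) + 1) * (log 2 (real N) + 1) * ln (real N))"
    by (rule bigoI[where c=1], rule eventually_mono[OF eventually_ge_at_top[of 1]])
       (use theta_psi in \<open>auto simp: abs_mult\<close>)
  also have "(\<lambda>N. (sqrt (real N) + 1) * (log 2 (real N) + 1) * ln (real N)) \<in> O(\<lambda>N. real N powr (3/4))"
    by real_asymp
  also have "(\<lambda>N. real N powr (3/4)) \<in> O(\<lambda>N. real N / ln (real N) ^ j)"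
    by (rule powr_bigo_over_ln) simp
  finally have "(\<lambda>N. (psi N - real N) - (psi N - theta N)) \<in> O(\<lambda>N. real N / ln (real N) ^ j)"
    by (rule sum_in_bigo(2)[OF psi_asymp])
  thus ?thesis by simp
qed

subsection \<open>Sums over primes and the expansion of the means\<close>

text \<open>A big-O form of the Stolz-Cesaro theorem: the increments are summed from a fixed index
  on, and \<open>v\<close>, tending to infinity, absorbs the starting value.\<close>

lemma stolz_bigo:
  fixes u v :: "nat \<Rightarrow> real"
  assumes v: "filterlim v at_top sequentially" and pos: "\<forall>\<^sub>F n in sequentially. v (Suc n) - v n > 0"
    and u: "(\<lambda>n. u (Suc n) - u n) \<in> O(\<lambda>n. v (Suc n) - v n)"
  shows "u \<in> O(v)"
proof -
  obtain c where c: "c > 0" "\<forall>\<^sub>F n in sequentially. norm (u (Suc n) - u n) \<le> c * norm (v (Suc n) - v n)"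
    using u by (elim landau_o.bigE)
  obtain N where N: "\<And>n. n \<ge> N \<Longrightarrow> \<bar>u (Suc n) - u n\<bar> \<le> c * (v (Suc n) - v n)"
    using eventually_conj[OF pos c(2)] unfolding eventually_sequentially by fastforce
  have b: "\<bar>u n - u N\<bar> \<le> c * (v n - v N)" if "n \<ge> N" for n
    using that
  proof (induction n rule: dec_induct)
    case (step n)
    thus ?case using N[of n] by (simp add: algebra_simps abs_le_iff)
  qed simp
  have "\<forall>\<^sub>F n in sequentially. v n \<ge> max 0 (\<bar>u N\<bar> - c * v N)"
    using v unfolding filterlim_at_top by blast
  hence "\<forall>\<^sub>F n in sequentially. norm (u n) \<le> (c + 1) * norm (v n)"
    using eventually_ge_at_top[of N]
  proof eventually_elim
    case (elim n)
    have "\<bar>u n\<bar> \<le> \<bar>u N\<bar> + c * (v n - v N)" using b[OF elim(2)] by linarith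
    also have "\<dots> \<le> (c + 1) * v n" using elim by (simp add: algebra_simps)
    finally show ?case using elim by simp
  qed
  thus ?thesis by (rule bigoI)
qed

lemma theta_Suc: "theta (Suc n) - theta n = (if prime (Suc n) then ln (real (Suc n)) else 0)"
proof -
  have "{p. prime p \<and> p \<le> Suc n} = (if prime (Suc n) then insert (Suc n) {p. prime p \<and> p \<le> n} else {p. prime p \<and> p \<le> n})"
    by (auto simp: le_Suc_eq)
  thus ?thesis by (auto simp: theta_def)
qed

text \<open>Discrete partial summation: subtracting the boundary term \<open>(\<theta>(n) - n) w(n)\<close>
  makes the increments small.\<close>

lemma prime_sum_asymp:
  fixes f w g v d :: "nat \<Rightarrow> real"
  assumes v: "filterlim v at_top sequentially" "\<forall>\<^sub>F n in sequentially. v (Suc n) - v n > 0"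
    and d: "d \<in> O(\<lambda>n. v (Suc n) - v n)"
    and fw: "\<And>p. prime p \<Longrightarrow> f p = w p * ln (real p)"
    and 1: "(\<lambda>n. w (Suc n) - w n) \<in> O(d)" and 2: "(\<lambda>n. w n - (g (Suc n) - g n)) \<in> O(d)"
    and 3: "(\<lambda>n. real n / ln (real n) ^ j * (w (Suc n) - w n)) \<in> O(d)"
    and 4: "(\<lambda>n. real n / ln (real n) ^ j * w n) \<in> O(v)"
  shows "(\<lambda>N. (\<Sum>p | prime p \<and> p \<le> N. f p) - g N) \<in> O(v)"
proof -
  define F where "F = (\<lambda>N. \<Sum>p | prime p \<and> p \<le> N. f p)"
  define E where "E = (\<lambda>n. theta n - real n)"
  have E: "E \<in> O(\<lambda>n. real n / ln (real n) ^ j)" unfolding E_def by (rule theta_asymp)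
  have F: "F (Suc n) - F n = w (Suc n) * (theta (Suc n) - theta n)" for n
  proof -
    have "{p. prime p \<and> p \<le> Suc n} = (if prime (Suc n) then insert (Suc n) {p. prime p \<and> p \<le> n} else {p. prime p \<and> p \<le> n})"
      by (auto simp: le_Suc_eq)
    thus ?thesis unfolding theta_Suc using fw[of "Suc n"] by (auto simp: F_def)
  qed
  define U where "U = (\<lambda>n. F n - g n - E n * w n)"
  \<comment> \<open>Here \<open>E\<close> meets only the increment of \<open>w\<close>; its product
    with \<open>w\<close> itself sits in the boundary term, controlled by assumption 4.\<close>
  have "(\<lambda>n. U (Suc n) - U n) = (\<lambda>n. (w (Suc n) - w n) + (w n - (g (Suc n) - g n)) - E n * (w (Suc n) - w n))"
  proof
    fix n
    have "U (Suc n) - U n = w (Suc n) * (theta (Suc n) - theta n) - (g (Suc n) - g n) - E (Suc n) * w (Suc n) + E n * w n"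
      unfolding F[symmetric] by (simp add: U_def)
    also have "theta (Suc n) - theta n = 1 + E (Suc n) - E n" by (simp add: E_def)
    finally show "U (Suc n) - U n = (w (Suc n) - w n) + (w n - (g (Suc n) - g n)) - E n * (w (Suc n) - w n)"
      by (simp add: algebra_simps)
  qed
  also have "\<dots> \<in> O(d)"
    by (rule sum_in_bigo(2)[OF sum_in_bigo(1)[OF 1 2] landau_o.big_trans[OF landau_o.big.mult_right[OF E] 3]])
  finally have "(\<lambda>n. U (Suc n) - U n) \<in> O(\<lambda>n. v (Suc n) - v n)" by (rule landau_o.big_trans[OF _ d])
  hence "U \<in> O(v)" by (rule stolz_bigo[OF v])
  moreover have "(\<lambda>n. E n * w n) \<in> O(v)"
    by (rule landau_o.big_trans[OF landau_o.big.mult_right[OF E] 4])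
  ultimately have "(\<lambda>n. U n + E n * w n) \<in> O(v)" by (rule sum_in_bigo)
  thus ?thesis by (simp add: U_def F_def)
qed

text \<open>Truncated expansion of the integral of t^(a - 1) / ln t by repeated integration by
  parts: a = 1 for counting primes, a = 2 for summing them.\<close>

definition li_exp :: "nat \<Rightarrow> nat \<Rightarrow> real \<Rightarrow> real" where
  "li_exp a K x = (\<Sum>i<K. fact i / real a ^ (i + 1) * (x ^ a / ln x ^ (i + 1)))"

text \<open>The derivatives telescope.\<close>

lemma li_exp_deriv:
  assumes a: "a \<ge> 1" and x: "x > 1"
  shows "(li_exp a K has_field_derivative x ^ (a - 1) / ln x - fact K / real a ^ K * (x ^ (a - 1) / ln x ^ (K + 1))) (at x)"
proof (induction K)
  case (Suc K)
  have eq: "li_exp a (Suc K) = (\<lambda>x. li_exp a K x + fact K / real a ^ (K + 1) * (x ^ a / ln x ^ (K + 1)))"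
    by (simp add: li_exp_def fun_eq_iff)
  have l: "ln x > 0" "real a \<noteq> 0" using x a by simp_all
  have xa: "x ^ a = x * x ^ (a - 1)" using a by (metis Suc_diff_le diff_Suc_Suc diff_zero power_Suc One_nat_def)
  have "((\<lambda>x. x ^ a / ln x ^ (K + 1)) has_field_derivative
      (real a * x ^ (a - 1) * ln x ^ (K + 1) - x ^ a * (real (K + 1) * ln x ^ K * (1 / x))) / (ln x ^ (K + 1) * ln x ^ (K + 1))) (at x)"
  proof (rule DERIV_divide)
    show "((\<lambda>x. x ^ a) has_field_derivative real a * x ^ (a - 1)) (at x)"
      using DERIV_pow[of a x] by simp
    show "((\<lambda>x. ln x ^ (K + 1)) has_field_derivative real (K + 1) * ln x ^ K * (1 / x)) (at x)"
      using DERIV_power[OF DERIV_ln_divide, of x "K + 1"] x by (simp add: mult_ac)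
  qed (use l in simp)
  also have "(real a * x ^ (a - 1) * ln x ^ (K + 1) - x ^ a * (real (K + 1) * ln x ^ K * (1 / x))) / (ln x ^ (K + 1) * ln x ^ (K + 1))
      = real a * (x ^ (a - 1) / ln x ^ (K + 1)) - real (K + 1) * (x ^ (a - 1) / ln x ^ (K + 2))"
    unfolding xa using x l by (simp add: field_simps)
  finally have d: "((\<lambda>x. x ^ a / ln x ^ (K + 1)) has_field_derivative
     real a * (x ^ (a - 1) / ln x ^ (K + 1)) - real (K + 1) * (x ^ (a - 1) / ln x ^ (K + 2))) (at x)" .
  show ?case unfolding eq
    by (rule DERIV_cong[OF DERIV_add[OF Suc DERIV_cmult[OF d]]]) (use a l in \<open>simp add: field_simps\<close>)
qed (simp add: li_exp_def)

lemma li_exp_increment: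
  assumes a: "a \<ge> 1" and n: "n \<ge> (2::nat)"
  obtains z where "real n < z" "z < real n + 1"
    "li_exp a K (real (Suc n)) - li_exp a K (real n) = z ^ (a - 1) / ln z - fact K / real a ^ K * (z ^ (a - 1) / ln z ^ (K + 1))"
proof -
  have "\<exists>z>real n. z < real n + 1 \<and> li_exp a K (real n + 1) - li_exp a K (real n)
      = (real n + 1 - real n) * (z ^ (a - 1) / ln z - fact K / real a ^ K * (z ^ (a - 1) / ln z ^ (K + 1)))"
    using n by (intro MVT2 li_exp_deriv a) auto
  thus thesis using that by (auto simp: add.commute)
qed

text \<open>In the applications \<open>a\<close> and \<open>d\<close> are the weights at n and n +
  1, \<open>b\<close> the weight at the point given by the mean value theorem, \<open>c\<close> the
  remainder there. The two cases are decreasing and increasing weights.\<close>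

lemma norm_between:
  fixes a b c d e :: real
  assumes "a \<le> b \<and> b \<le> d \<or> d \<le> b \<and> b \<le> a" "0 \<le> c" "c \<le> e"
  shows "norm (a - (b - c)) \<le> 1 * norm (\<bar>d - a\<bar> + e)"
  using assms by auto

text \<open>Partial summation with weight 1 / ln n, whose increments are only of order 1 / (n ln^2
  n); the dominant error is the remainder 1 / ln^(K + 1) n from \<open>li_exp_deriv\<close>.\<close>

lemma prime_count_asymp:
  "(\<lambda>N. real (card {p. prime p \<and> p \<le> N}) - li_exp 1 K (real N)) \<in> O(\<lambda>N. real N / ln (real N) ^ (K + 1))"
proof -
  let ?w = "\<lambda>n. 1 / ln (real n)"
  have "(\<lambda>N. (\<Sum>p | prime p \<and> p \<le> N. 1) - li_exp 1 K (real N)) \<in> O(\<lambda>N. real N / ln (real N) ^ (K + 1))"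
  proof (rule prime_sum_asymp[where w = ?w and j = "K + 1" and d = "\<lambda>n. 1 / ln (real n) ^ (K + 1)"])
    show "filterlim (\<lambda>N. real N / ln (real N) ^ (K + 1)) at_top sequentially" by real_asymp
    show "\<forall>\<^sub>F n in sequentially. real (Suc n) / ln (real (Suc n)) ^ (K + 1) - real n / ln (real n) ^ (K + 1) > 0"
      by real_asymp
    show "(\<lambda>n. 1 / ln (real n) ^ (K + 1)) \<in> O(\<lambda>n. real (Suc n) / ln (real (Suc n)) ^ (K + 1) - real n / ln (real n) ^ (K + 1))"
      by real_asymp
    show d1: "(\<lambda>n. ?w (Suc n) - ?w n) \<in> O(\<lambda>n. 1 / ln (real n) ^ (K + 1))" by real_asymp
    show "(\<lambda>n. real n / ln (real n) ^ (K + 1) * (?w (Suc n) - ?w n)) \<in> O(\<lambda>n. 1 / ln (real n) ^ (K + 1))" by real_asymp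
    show "(\<lambda>n. real n / ln (real n) ^ (K + 1) * ?w n) \<in> O(\<lambda>N. real N / ln (real N) ^ (K + 1))" by real_asymp
    show "1 = 1 / ln (real p) * ln (real p)" if "prime p" for p :: nat
      using prime_gt_1_nat[OF that] by simp
    have "(\<lambda>n. ?w n - (li_exp 1 K (real (Suc n)) - li_exp 1 K (real n))) \<in> O(\<lambda>n. \<bar>?w (Suc n) - ?w n\<bar> + fact K * (1 / ln (real n) ^ (K + 1)))"
    proof (rule bigoI[where c=1], rule eventually_mono[OF eventually_ge_at_top[of 2]])
      fix n :: nat assume n: "n \<ge> 2"
      obtain z where z: "real n < z" "z < real n + 1"
        "li_exp 1 K (real (Suc n)) - li_exp 1 K (real n) = 1 / ln z - fact K * (1 / ln z ^ (K + 1))"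
        using li_exp_increment[of 1 n K] n by auto
      have l: "0 < ln (real n)" "ln (real n) \<le> ln z" "ln z \<le> ln (real (Suc n))" using z n by auto
      hence lz: "0 < ln z" by linarith
      have "1 / ln (real (Suc n)) \<le> 1 / ln z" "1 / ln z \<le> ?w n"
        using l lz n by (auto intro!: divide_left_mono mult_pos_pos)
      moreover have "0 \<le> 1 / ln z ^ (K + 1)" "1 / ln z ^ (K + 1) \<le> 1 / ln (real n) ^ (K + 1)"
        using l lz by (intro frac_le power_mono zero_le_divide_1_iff[THEN iffD2] zero_le_power zero_less_power; linarith)+
      hence "0 \<le> fact K * (1 / ln z ^ (K + 1))" "fact K * (1 / ln z ^ (K + 1)) \<le> fact K * (1 / ln (real n) ^ (K + 1))"
        by (simp_all only: mult_nonneg_nonneg mult_left_mono fact_ge_zero)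
      ultimately show "norm (?w n - (li_exp 1 K (real (Suc n)) - li_exp 1 K (real n)))
          \<le> 1 * norm (\<bar>?w (Suc n) - ?w n\<bar> + fact K * (1 / ln (real n) ^ (K + 1)))"
        unfolding z(3) by (intro norm_between) auto
    qed
    also have "(\<lambda>n. \<bar>?w (Suc n) - ?w n\<bar> + fact K * (1 / ln (real n) ^ (K + 1))) \<in> O(\<lambda>n. 1 / ln (real n) ^ (K + 1))"
    proof (rule sum_in_bigo)
      show "(\<lambda>n. fact K * (1 / ln (real n) ^ (K + 1))) \<in> O(\<lambda>n. 1 / ln (real n) ^ (K + 1))" by real_asymp
    qed (use d1 in simp)
    finally show "(\<lambda>n. ?w n - (li_exp 1 K (real (Suc n)) - li_exp 1 K (real n))) \<in> O(\<lambda>n. 1 / ln (real n) ^ (K + 1))" .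
  qed
  thus ?thesis by simp
qed

lemma prime_sum_asymp2:
  "(\<lambda>N. (\<Sum>p | prime p \<and> p \<le> N. real p) - li_exp 2 K (real N)) \<in> O(\<lambda>N. real N ^ 2 / ln (real N) ^ (K + 1))"
proof (rule prime_sum_asymp[where w = "\<lambda>n. real n / ln (real n)" and j = "K + 1" and d = "\<lambda>n. real n / ln (real n) ^ (K + 1)"])
  let ?w = "\<lambda>n. real n / ln (real n)"
  show "filterlim (\<lambda>N. real N ^ 2 / ln (real N) ^ (K + 1)) at_top sequentially" by real_asymp
  show "\<forall>\<^sub>F n in sequentially. real (Suc n) ^ 2 / ln (real (Suc n)) ^ (K + 1) - real n ^ 2 / ln (real n) ^ (K + 1) > 0"
    by real_asymp
  show "(\<lambda>n. real n / ln (real n) ^ (K + 1)) \<in> O(\<lambda>n. real (Suc n) ^ 2 / ln (real (Suc n)) ^ (K + 1) - real n ^ 2 / ln (real n) ^ (K + 1))"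
    by real_asymp
  show d1: "(\<lambda>n. ?w (Suc n) - ?w n) \<in> O(\<lambda>n. real n / ln (real n) ^ (K + 1))" by real_asymp
  show "(\<lambda>n. real n / ln (real n) ^ (K + 1) * (?w (Suc n) - ?w n)) \<in> O(\<lambda>n. real n / ln (real n) ^ (K + 1))" by real_asymp
  show "(\<lambda>n. real n / ln (real n) ^ (K + 1) * ?w n) \<in> O(\<lambda>N. real N ^ 2 / ln (real N) ^ (K + 1))" by real_asymp
  show "real p = real p / ln (real p) * ln (real p)" if "prime p" for p :: nat
    using prime_gt_1_nat[OF that] by simp
  let ?e = "\<lambda>n. fact K / 2 ^ K * (real (Suc n) / ln (real n) ^ (K + 1))"
  have "(\<lambda>n. ?w n - (li_exp 2 K (real (Suc n)) - li_exp 2 K (real n))) \<in> O(\<lambda>n. \<bar>?w (Suc n) - ?w n\<bar> + ?e n)"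
  proof (rule bigoI[where c=1], rule eventually_mono[OF eventually_ge_at_top[of 3]])
    fix n :: nat assume n: "n \<ge> 3"
    obtain z where z: "real n < z" "z < real n + 1"
      "li_exp 2 K (real (Suc n)) - li_exp 2 K (real n) = z / ln z - fact K / 2 ^ K * (z / ln z ^ (K + 1))"
      using li_exp_increment[of 2 n K] n by auto
    have l: "0 < ln (real n)" "ln (real n) \<le> ln z" using z n by auto
    \<comment> \<open>x / ln x increases only from exp 1 on; this is the reason for n \<ge>
      3.\<close>
    have mono: "x / ln x \<le> y / ln y" if "3 \<le> x" "x \<le> y" for x y :: real
    proof (rule DERIV_nonneg_imp_nondecreasing[OF that(2)])
      fix u assume u: "x \<le> u" "u \<le> y"
      have "ln 3 \<ge> (1::real)" using exp_le by (simp add: ln_ge_iff)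
      moreover have "ln 3 \<le> ln u" using u that by simp
      ultimately have "ln u \<ge> 1" by linarith
      thus "\<exists>k. ((\<lambda>x. x / ln x) has_real_derivative k) (at u) \<and> 0 \<le> k"
        using u that by (intro exI[of _ "(ln u - 1) / (ln u * ln u)"]) (auto intro!: derivative_eq_intros)
    qed
    have "?w n \<le> z / ln z" "z / ln z \<le> ?w (Suc n)"
      using z n by (auto intro!: mono)
    moreover have "0 \<le> z / ln z ^ (K + 1)"
      using l z n by (intro divide_nonneg_nonneg zero_le_power) auto
    moreover have "z / ln z ^ (K + 1) \<le> real (Suc n) / ln (real n) ^ (K + 1)"
      using z(1,2) n by (intro frac_le power_mono zero_less_power l less_imp_le[OF l(1)]) auto
    ultimately have "?w n \<le> z / ln z" "z / ln z \<le> ?w (Suc n)" "0 \<le> fact K / 2 ^ K * (z / ln z ^ (K + 1))" "fact K / 2 ^ K * (z / ln z ^ (K + 1)) \<le> ?e n"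
      by (auto intro: mult_left_mono simp del: times_divide_eq_left times_divide_eq_right)
    thus "norm (?w n - (li_exp 2 K (real (Suc n)) - li_exp 2 K (real n)))
        \<le> 1 * norm (\<bar>?w (Suc n) - ?w n\<bar> + ?e n)"
      unfolding z(3) by (intro norm_between) auto
  qed
  also have "(\<lambda>n. \<bar>?w (Suc n) - ?w n\<bar> + ?e n) \<in> O(\<lambda>n. real n / ln (real n) ^ (K + 1))"
  proof (rule sum_in_bigo)
    show "?e \<in> O(\<lambda>n. real n / ln (real n) ^ (K + 1))" by real_asymp
  qed (use d1 in simp)
  finally show "(\<lambda>n. ?w n - (li_exp 2 K (real (Suc n)) - li_exp 2 K (real n))) \<in> O(\<lambda>n. real n / ln (real n) ^ (K + 1))" .
qed

text \<open>The difference is a polynomial in \<open>y n\<close> without terms of degree below K,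
  hence divisible by the K-th power, and the quotient stays bounded as \<open>y n\<close> tends to
  0.\<close>

lemma truncated_product:
  fixes a b :: "nat \<Rightarrow> real"
  assumes y: "(y \<longlongrightarrow> 0) F"
  shows "(\<lambda>n. (\<Sum>i<K. a i * y n ^ i) * (\<Sum>i<K. b i * y n ^ i) - (\<Sum>i<K. (\<Sum>l\<le>i. a l * b (i - l)) * y n ^ i)) \<in> O[F](\<lambda>n. y n ^ K)"
proof -
  define q where "q = (\<lambda>c. \<Sum>i<K. monom (c i) i :: real poly)"
  have pq: "poly (q c) x = (\<Sum>i<K. c i * x ^ i)" for c x
    by (simp add: q_def poly_sum poly_monom)
  have cq: "coeff (q c) i = (if i < K then c i else 0)" for c i
    by (simp add: q_def coeff_sum sum.delta)
  define r where "r = q a * q b - q (\<lambda>i. \<Sum>l\<le>i. a l * b (i - l))"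
  have "coeff r i = 0" if "i < K" for i
    using that by (auto simp: r_def coeff_mult cq intro!: sum.cong)
  hence "monom 1 K dvd r" by (subst monom_1_dvd_iff') auto
  then obtain s where s: "r = monom 1 K * s" by (elim dvdE)
  have "((\<lambda>n. poly s (y n)) \<longlongrightarrow> poly s 0) F"
    by (intro tendsto_intros y)
  hence "(\<lambda>n. poly s (y n)) \<in> O[F](\<lambda>_. 1)"
    by (intro bigoI_tendsto[where c = "poly s 0"]) simp_all
  hence "(\<lambda>n. y n ^ K * poly s (y n)) \<in> O[F](\<lambda>n. y n ^ K * 1)"
    by (rule landau_o.big.mult_left)
  also have "(\<lambda>n. y n ^ K * poly s (y n)) = (\<lambda>n. poly r (y n))" by (simp add: s poly_monom)
  finally show ?thesis by (simp add: r_def pq)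
qed

text \<open>Coefficients of the reciprocal of \<open>\<Sum>i. i! y\<^sup>i\<close>.\<close>

definition recip_coeff :: "nat \<Rightarrow> real" where
  "recip_coeff i = (if i = 0 then 1 else if i = 1 then - 1 else - real_of_int (k_coeff (i - 1)))"

text \<open>For i \<ge> 2 the recurrence at s = i - 1 says that the terms l < s add up to - s s!;
  the last two, with coefficients - 1 and 1, add - s! + (s + 1)! = s s!.\<close>

lemma fact_recip_conv: "(\<Sum>l\<le>i. fact l * recip_coeff (i - l)) = (if i = 0 then 1 else 0)"
proof (cases "i \<le> 1")
  case True
  thus ?thesis by (cases i) (auto simp: recip_coeff_def le_Suc_eq)
next
  case False
  define s where "s = i - 1"
  have i: "i = Suc s" "s \<ge> 1" using False by (auto simp: s_def)
  have "(\<Sum>l\<le>i. fact l * recip_coeff (i - l)) = (\<Sum>l<s. fact l * recip_coeff (i - l)) - fact s + fact (Suc s)"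
    by (simp add: i(1) lessThan_Suc_atMost[symmetric] recip_coeff_def)
  also have "(\<Sum>l<s. fact l * recip_coeff (i - l)) = - (\<Sum>l<s. fact l * real_of_int (k_coeff (s - l)))"
    unfolding sum_negf[symmetric] by (intro sum.cong refl) (auto simp: i recip_coeff_def)
  also have "(\<Sum>l<s. fact l * real_of_int (k_coeff (s - l))) = real_of_int (\<Sum>l=0..s-1. fact l * k_coeff (s - l))"
    using i(2) by (simp add: atLeast0AtMost lessThan_Suc_atMost[symmetric])
  also have "\<dots> = real s * fact s" using k_coeff_recurrence[OF i(2)] by simp
  finally show ?thesis using i by (simp add: algebra_simps)
qed

text \<open>Write l! / 2^(l + 1) = l! - \<open>r_coeff (l + 1)\<close>: the first part convolves to
  1 or 0, and the second produces the coefficients of the theorem.\<close>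

lemma half_recip_conv:
  "(\<Sum>l\<le>i. fact l / 2 ^ (l + 1) * recip_coeff (i - l)) =
     (if i = 0 then 1/2 else - r_coeff (i + 1) + r_coeff i + (\<Sum>s=1..i-1. r_coeff s * real_of_int (k_coeff (i - s))))"
proof -
  have r: "fact l / 2 ^ (l + 1) = fact l - r_coeff (l + 1)" for l
    by (simp add: r_coeff_def field_simps)
  have eq: "(\<Sum>l\<le>i. fact l / 2 ^ (l + 1) * recip_coeff (i - l)) = (if i = 0 then 1 else 0) - (\<Sum>l\<le>i. r_coeff (l + 1) * recip_coeff (i - l))"
    unfolding r left_diff_distrib sum_subtractf fact_recip_conv ..
  show ?thesis
  proof (cases i)
    case 0
    thus ?thesis by (simp add: recip_coeff_def)
  next
    case (Suc s)
    have "(\<Sum>l\<le>i. r_coeff (l + 1) * recip_coeff (i - l)) = (\<Sum>l<s. r_coeff (l + 1) * recip_coeff (i - l)) - r_coeff i + r_coeff (i + 1)"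
      by (simp add: Suc lessThan_Suc_atMost[symmetric] recip_coeff_def)
    also have "(\<Sum>l<s. r_coeff (l + 1) * recip_coeff (i - l)) = - (\<Sum>l<s. r_coeff (l + 1) * real_of_int (k_coeff (i - (l + 1))))"
      unfolding sum_negf[symmetric] by (intro sum.cong refl) (auto simp: Suc recip_coeff_def)
    also have "(\<Sum>l<s. r_coeff (l + 1) * real_of_int (k_coeff (i - (l + 1)))) = (\<Sum>s=1..i-1. r_coeff s * real_of_int (k_coeff (i - s)))"
      by (rule sum.reindex_bij_witness[of _ "\<lambda>l. l - 1" "\<lambda>l. l + 1"]) (auto simp: Suc)
    finally show ?thesis unfolding eq using Suc by simp
  qed
qed

section \<open>Sums and products over the first n primes\<close>

lemma strict_mono_nth_prime:
  assumes "1 \<le> i" "i < j" shows "nth_prime i < nth_prime j"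
  using assms primes_infinite by (auto simp: nth_prime_def)

lemma prime_nth_prime: "prime (nth_prime n)"
  using enumerate_in_set[OF primes_infinite] by (auto simp: nth_prime_def)

lemma bij_betw_nth_prime:
  assumes "n \<ge> 1"
  shows "bij_betw nth_prime {1..n} {p. prime p \<and> p \<le> nth_prime n}"
proof (rule bij_betwI')
  fix i j assume "i \<in> {1..n}" "j \<in> {1..n}"
  thus "(nth_prime i = nth_prime j) = (i = j)"
    using strict_mono_nth_prime[of i j] strict_mono_nth_prime[of j i] by (cases i j rule: linorder_cases) auto
next
  fix i assume "i \<in> {1..n}"
  thus "nth_prime i \<in> {p. prime p \<and> p \<le> nth_prime n}"
    using strict_mono_nth_prime[of i n] prime_nth_prime by (cases "i = n") auto
next
  fix p assume p: "p \<in> {p. prime p \<and> p \<le> nth_prime n}"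
  then obtain k where k: "enumerate {p. prime p} k = p"
    using enumerate_Ex[OF primes_infinite, of p] by auto
  hence kp: "nth_prime (Suc k) = p" by (simp add: nth_prime_def)
  have "Suc k \<le> n"
    using strict_mono_nth_prime[of n "Suc k"] p kp assms by (cases "Suc k \<le> n") auto
  thus "\<exists>i\<in>{1..n}. p = nth_prime i" using kp by (intro bexI[of _ "Suc k"]) auto
qed

lemma sum_nth_prime:
  assumes "n \<ge> 1"
  shows "(\<Sum>k=1..n. f (nth_prime k)) = (\<Sum>p | prime p \<and> p \<le> nth_prime n. f p)"
  by (rule sum.reindex_bij_betw[OF bij_betw_nth_prime[OF assms]])

lemma card_nth_prime: "n \<ge> 1 \<Longrightarrow> card {p. prime p \<and> p \<le> nth_prime n} = n"
  using bij_betw_same_card[OF bij_betw_nth_prime[of n]] by simp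

lemma geom_mean_eq:
  assumes "n \<ge> 1"
  shows "geom_mean_primes n = exp (theta (nth_prime n) / real n)"
proof -
  have pos: "real (nth_prime k) > 0" for k using prime_gt_0_nat[OF prime_nth_prime] by simp
  hence P: "(\<Prod>k=1..n. real (nth_prime k)) > 0" by (intro prod_pos) auto
  have "geom_mean_primes n = (\<Prod>k=1..n. real (nth_prime k)) powr (1 / real n)"
    unfolding geom_mean_primes_def by (rule root_powr_inverse[OF _ less_imp_le[OF P]]) (use assms in simp)
  also have "\<dots> = exp (ln (\<Prod>k=1..n. real (nth_prime k)) / real n)"
  proof -
    have "Q powr (1 / real n) = exp (ln Q / real n)" if "Q > 0" for Q using that by (simp add: powr_def)
    thus ?thesis using P by blast
  qed
  also have "ln (\<Prod>k=1..n. real (nth_prime k)) = (\<Sum>k=1..n. ln (real (nth_prime k)))"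
    by (intro ln_prod) (use pos in auto)
  also have "\<dots> = theta (nth_prime n)"
    unfolding theta_def by (rule sum_nth_prime[OF assms])
  finally show ?thesis .
qed

lemma filterlim_nth_prime: "filterlim nth_prime at_top sequentially"
proof (rule filterlim_at_top_mono[OF filterlim_ident])
  show "\<forall>\<^sub>F n in sequentially. n \<le> nth_prime n"
  proof (rule eventually_mono[OF eventually_ge_at_top[of 1]])
    fix n :: nat assume "n \<ge> 1"
    have "{p. prime p \<and> p \<le> nth_prime n} \<subseteq> {1..nth_prime n}"
      by (auto dest: prime_gt_0_nat)
    hence "card {p. prime p \<and> p \<le> nth_prime n} \<le> card {1..nth_prime n}"
      by (intro card_mono) auto
    thus "n \<le> nth_prime n" using card_nth_prime[OF \<open>n \<ge> 1\<close>] by simp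
  qed
qed

text \<open>Up to O(y^K), the normalised quantities \<open>u\<close>, \<open>v\<close>,
  \<open>w\<close> are \<open>P\<close>, \<open>H\<close>, 1, and \<open>R\<close> is the reciprocal
  of \<open>P\<close>. Hence A_n / x = v / u is close to H R, and ln G_n = w / (u y) to R / y. As R
  = 1 - y - y E, the difference ln x - ln G_n is close to 1 + E: this is the origin of the factor e
  and of the exponential.\<close>

theorem theorem2p6:
  fixes m :: nat
  assumes "m \<ge> 1"
  shows "(\<lambda>n. arith_mean_primes n / geom_mean_primes n
           - exp 1 * (1 / 2 + (\<Sum>i=1..m. 1 / ln (real (nth_prime n)) ^ i *
                 (- r_coeff (i + 1) + r_coeff i
                  + (\<Sum>s=1..i-1. r_coeff s * real_of_int (k_coeff (i - s))))))
             * exp (\<Sum>j=1..m. real_of_int (k_coeff j) / ln (real (nth_prime n)) ^ j))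
         \<in> O(\<lambda>n. 1 / ln (real (nth_prime n)) ^ (m + 1))"
proof -
  \<comment> \<open>\<open>R\<close> has to reach the term k_m y^(m + 1), and the division by y
    costs one order.\<close>
  define K where "K = m + 2"
  define x where "x = (\<lambda>n. real (nth_prime n))"
  define y where "y = (\<lambda>n. 1 / ln (x n))"
  define P where "P = (\<lambda>n. \<Sum>i<K. fact i * y n ^ i)"
  define H where "H = (\<lambda>n. \<Sum>i<K. fact i / 2 ^ (i + 1) * y n ^ i)"
  define R where "R = (\<lambda>n. \<Sum>i<K. recip_coeff i * y n ^ i)"
  define S where "S = (\<lambda>n. \<Sum>p | prime p \<and> p \<le> nth_prime n. real p)"
  define u where "u = (\<lambda>n. real n / (x n * y n))"
  define v where "v = (\<lambda>n. S n / (x n ^ 2 * y n))"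
  define w where "w = (\<lambda>n. theta (nth_prime n) / x n)"
  have xtop: "filterlim x at_top sequentially"
    unfolding x_def by (rule filterlim_compose[OF filterlim_real_sequentially filterlim_nth_prime])
  have y0: "y \<longlonglongrightarrow> 0"
  proof -
    have "((\<lambda>x::real. 1 / ln x) \<longlongrightarrow> 0) at_top" by real_asymp
    from filterlim_compose[OF this xtop] show ?thesis by (simp add: y_def)
  qed
  have ev: "\<forall>\<^sub>F n in sequentially. n \<ge> 1 \<and> x n > 1 \<and> y n > 0"
  proof -
    have "\<forall>\<^sub>F n in sequentially. x n > 1" using xtop by (simp add: filterlim_at_top_dense)
    with eventually_ge_at_top[of 1] show ?thesis by eventually_elim (auto simp: y_def)
  qed
  have transfer: "(\<lambda>n. f (nth_prime n)) \<in> O(\<lambda>n. g (nth_prime n))" if "f \<in> O(g)" for f g :: "nat \<Rightarrow> real"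
    using that filterlim_nth_prime by (rule landau_o.big.compose)
  have ymono: "(\<lambda>n. y n ^ a) \<in> O(\<lambda>n. y n ^ b)" if "b \<le> a" for a b
  proof (rule bigoI[where c=1])
    have "\<forall>\<^sub>F n in sequentially. y n < 1" using order_tendstoD(2)[OF y0, of 1] by simp
    with ev show "\<forall>\<^sub>F n in sequentially. norm (y n ^ a) \<le> 1 * norm (y n ^ b)"
      by eventually_elim (use that in \<open>auto intro: power_decreasing\<close>)
  qed
  have lim_poly: "(\<lambda>n. \<Sum>i<K. c i * y n ^ i) \<longlonglongrightarrow> c 0" for c :: "nat \<Rightarrow> real"
  proof -
    have "(\<lambda>n. \<Sum>i<K. c i * y n ^ i) \<longlonglongrightarrow> (\<Sum>i<K. c i * 0 ^ i)"
      by (intro tendsto_intros y0)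
    also have "(\<Sum>i<K. c i * 0 ^ i) = c 0"
      by (simp add: K_def power_0_left if_distrib sum.If_cases cong: if_cong)
    finally show ?thesis .
  qed
  have bounded: "f \<in> O(\<lambda>_. 1)" if "f \<longlonglongrightarrow> c" for f :: "nat \<Rightarrow> real" and c
    by (rule bigoI_tendsto[where c=c]) (use that in auto)
  have yK: "(\<lambda>n. y n ^ K) \<in> o(\<lambda>_. 1)"
    using tendsto_power[OF y0, of K] by (intro smalloI_tendsto) (auto simp: K_def)
  have lim_of: "f \<longlonglongrightarrow> c" if "(\<lambda>n. f n - g n) \<in> O(\<lambda>n. y n ^ K)" "g \<longlonglongrightarrow> c" for f g :: "nat \<Rightarrow> real" and c
  proof -
    have "(\<lambda>n. f n - g n) \<in> o(\<lambda>_. 1)" by (rule landau_o.big_small_trans[OF that(1) yK])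
    hence "(\<lambda>n. f n - g n) \<longlonglongrightarrow> 0" by (auto dest: smalloD_tendsto)
    from tendsto_add[OF this that(2)] show ?thesis by simp
  qed
  have uP: "(\<lambda>n. u n - P n) \<in> O(\<lambda>n. y n ^ K)"
  proof -
    have "(\<lambda>n. real (card {p. prime p \<and> p \<le> nth_prime n}) - li_exp 1 K (x n)) \<in> O(\<lambda>n. x n / ln (x n) ^ (K + 1))"
      unfolding x_def by (rule transfer[OF prime_count_asymp])
    hence "(\<lambda>n. (real (card {p. prime p \<and> p \<le> nth_prime n}) - li_exp 1 K (x n)) / (x n * y n))
        \<in> O(\<lambda>n. x n / ln (x n) ^ (K + 1) / (x n * y n))"
      by (rule landau_o.big.divide_right[rotated]) (use ev in \<open>auto elim: eventually_mono\<close>)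
    also have "?this \<longleftrightarrow> ?thesis"
    proof (rule landau_o.big.cong_ex[OF eventually_mono[OF ev] eventually_mono[OF ev]]; elim conjE)
      fix n assume n: "1 \<le> n" "1 < x n" "0 < y n"
      have "li_exp 1 K (x n) / (x n * y n) = P n"
        unfolding li_exp_def P_def sum_divide_distrib using n
        by (intro sum.cong refl) (simp add: y_def power_divide)
      thus "(real (card {p. prime p \<and> p \<le> nth_prime n}) - li_exp 1 K (x n)) / (x n * y n) = u n - P n"
        using card_nth_prime[OF n(1)] by (simp add: u_def diff_divide_distrib)
      show "x n / ln (x n) ^ (K + 1) / (x n * y n) = y n ^ K"
        using n by (simp add: y_def power_divide)
    qed
    finally show ?thesis .
  qed
  have vH: "(\<lambda>n. v n - H n) \<in> O(\<lambda>n. y n ^ K)"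
  proof -
    have "(\<lambda>n. S n - li_exp 2 K (x n)) \<in> O(\<lambda>n. x n ^ 2 / ln (x n) ^ (K + 1))"
      unfolding x_def S_def by (rule transfer[OF prime_sum_asymp2])
    hence "(\<lambda>n. (S n - li_exp 2 K (x n)) / (x n ^ 2 * y n))
        \<in> O(\<lambda>n. x n ^ 2 / ln (x n) ^ (K + 1) / (x n ^ 2 * y n))"
      by (rule landau_o.big.divide_right[rotated]) (use ev in \<open>auto elim: eventually_mono\<close>)
    also have "?this \<longleftrightarrow> ?thesis"
    proof (rule landau_o.big.cong_ex[OF eventually_mono[OF ev] eventually_mono[OF ev]]; elim conjE)
      fix n assume n: "1 \<le> n" "1 < x n" "0 < y n"
      have "li_exp 2 K (x n) / (x n ^ 2 * y n) = H n"
        unfolding li_exp_def H_def sum_divide_distrib using n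
        by (intro sum.cong refl) (simp add: y_def power_divide)
      thus "(S n - li_exp 2 K (x n)) / (x n ^ 2 * y n) = v n - H n"
        by (simp add: v_def diff_divide_distrib)
      show "x n ^ 2 / ln (x n) ^ (K + 1) / (x n ^ 2 * y n) = y n ^ K"
        using n by (simp add: y_def power_divide)
    qed
    finally show ?thesis .
  qed
  have w1: "(\<lambda>n. w n - 1) \<in> O(\<lambda>n. y n ^ K)"
  proof -
    have "(\<lambda>n. theta (nth_prime n) - x n) \<in> O(\<lambda>n. x n / ln (x n) ^ K)"
      unfolding x_def by (rule transfer[OF theta_asymp])
    hence "(\<lambda>n. (theta (nth_prime n) - x n) / x n) \<in> O(\<lambda>n. x n / ln (x n) ^ K / x n)"
      by (rule landau_o.big.divide_right[rotated]) (use ev in \<open>auto elim: eventually_mono\<close>)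
    also have "?this \<longleftrightarrow> ?thesis"
      by (rule landau_o.big.cong_ex[OF eventually_mono[OF ev] eventually_mono[OF ev]])
         (auto simp: w_def y_def diff_divide_distrib power_divide)
    finally show ?thesis .
  qed
  have P1: "P \<longlonglongrightarrow> 1" using lim_poly[of fact] by (simp add: P_def)
  have R1: "R \<longlonglongrightarrow> 1" using lim_poly[of recip_coeff] by (simp add: R_def recip_coeff_def)
  have H1: "H \<longlonglongrightarrow> 1/2" using lim_poly[of "\<lambda>i. fact i / 2 ^ (i + 1)"] by (simp add: H_def)
  have u1: "u \<longlonglongrightarrow> 1" by (rule lim_of[OF uP P1])
  have PR: "(\<lambda>n. P n * R n - 1) \<in> O(\<lambda>n. y n ^ K)"
  proof -
    have "(\<Sum>i<K. (if i = 0 then 1 else 0) * y n ^ i) = (\<Sum>i<K. if i = 0 then 1 else 0)" for n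
      by (intro sum.cong) auto
    also have "\<dots> = (1::real)" by (simp add: K_def)
    finally show ?thesis
      using truncated_product[OF y0, where K = K and a = fact and b = recip_coeff]
      by (simp only: P_def R_def fact_recip_conv)
  qed
  have uR: "(\<lambda>n. 1 / u n - R n) \<in> O(\<lambda>n. y n ^ K)"
  proof -
    have "(\<lambda>n. (u n - P n) * R n + (P n * R n - 1)) \<in> O(\<lambda>n. y n ^ K)"
      by (rule sum_in_bigo(1)[OF _ PR]) (use landau_o.big.mult[OF uP bounded[OF R1]] in simp)
    moreover have "(\<lambda>n. - 1 / u n) \<in> O(\<lambda>_. 1)"
      using tendsto_divide[OF tendsto_const[of "- 1"] u1] by (intro bounded[of _ "- 1"]) simp
    \<comment> \<open>1 / u - R = - (u R - 1) / u, and u R - 1 is small because u is close to P and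
      P R to 1.\<close>
    ultimately have "(\<lambda>n. (- 1 / u n) * ((u n - P n) * R n + (P n * R n - 1))) \<in> O(\<lambda>n. 1 * y n ^ K)"
      by (rule landau_o.big.mult[rotated])
    also have "?this \<longleftrightarrow> ?thesis"
    proof (rule landau_o.big.cong_ex)
      have "\<forall>\<^sub>F n in sequentially. u n > 0" using order_tendstoD(1)[OF u1, of 0] by simp
      thus "\<forall>\<^sub>F n in sequentially. - 1 / u n * ((u n - P n) * R n + (P n * R n - 1)) = 1 / u n - R n"
        by eventually_elim (simp add: field_simps)
    qed auto
    finally show ?thesis .
  qed
  have ui: "(\<lambda>n. 1 / u n) \<longlonglongrightarrow> 1" by (rule lim_of[OF uR R1])
  define E where "E = (\<lambda>n. \<Sum>j=1..m. real_of_int (k_coeff j) * y n ^ j)"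
  define M where "M = (\<lambda>n. 1/2 + (\<Sum>i=1..m. y n ^ i * (- r_coeff (i + 1) + r_coeff i + (\<Sum>s=1..i-1. r_coeff s * real_of_int (k_coeff (i - s))))))"
  define B where "B = (\<lambda>n. theta (nth_prime n) / real n)"
  define A where "A = (\<lambda>n. arith_mean_primes n / x n)"
  have R_eq: "R n = 1 - y n - y n * E n" for n
  proof -
    have "R n = 1 - y n + (\<Sum>i\<in>{2..<K}. recip_coeff i * y n ^ i)"
    proof -
      have "{..<K} = insert 0 (insert 1 {2..<K})" by (auto simp: K_def)
      thus ?thesis by (simp add: R_def recip_coeff_def)
    qed
    also have "(\<Sum>i\<in>{2..<K}. recip_coeff i * y n ^ i) = (\<Sum>j=1..m. - (y n * (real_of_int (k_coeff j) * y n ^ j)))"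
      by (rule sum.reindex_bij_witness[of _ "\<lambda>j. j + 1" "\<lambda>i. i - 1"]) (auto simp: K_def recip_coeff_def power_eq_if)
    finally show ?thesis by (simp add: E_def sum_negf sum_distrib_left)
  qed
  have Bexp: "(\<lambda>n. ln (x n) - B n - (1 + E n)) \<in> O(\<lambda>n. y n ^ (m + 1))"
  proof -
    have "(\<lambda>n. (w n - 1) * (1 / u n) + (1 / u n - R n)) \<in> O(\<lambda>n. y n ^ K)"
      by (rule sum_in_bigo(1)[OF _ uR]) (use landau_o.big.mult[OF w1 bounded[OF ui]] in simp)
    hence "(\<lambda>n. - ((w n - 1) * (1 / u n) + (1 / u n - R n))) \<in> O(\<lambda>n. y n ^ K)"
      by (simp only: landau_o.big.uminus_in_iff)
    hence "(\<lambda>n. - ((w n - 1) * (1 / u n) + (1 / u n - R n)) / y n) \<in> O(\<lambda>n. y n ^ K / y n)"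
      by (rule landau_o.big.divide_right[rotated]) (use ev in \<open>auto elim: eventually_mono\<close>)
    also have "?this \<longleftrightarrow> ?thesis"
    proof (rule landau_o.big.cong_ex[OF eventually_mono[OF ev] eventually_mono[OF ev]]; elim conjE)
      fix n assume n: "1 \<le> n" "1 < x n" "0 < y n"
      have "w n / u n / y n = B n" using n by (simp add: w_def u_def B_def)
      moreover have "R n / y n = ln (x n) - 1 - E n"
        using n by (simp add: R_eq diff_divide_distrib) (simp add: y_def)
      ultimately show "- ((w n - 1) * (1 / u n) + (1 / u n - R n)) / y n = ln (x n) - B n - (1 + E n)"
        by (simp add: left_diff_distrib diff_divide_distrib)
      show "y n ^ K / y n = y n ^ (m + 1)" using n by (simp add: K_def)
    qed
    finally show ?thesis .
  qed
  have AM: "(\<lambda>n. A n - M n) \<in> O(\<lambda>n. y n ^ (m + 1))"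
  proof -
    define D where "D = (\<lambda>n. \<Sum>i<K. (\<Sum>l\<le>i. fact l / 2 ^ (l + 1) * recip_coeff (i - l)) * y n ^ i)"
    \<comment> \<open>Coefficient of y^(m + 1) in the product, one degree beyond \<open>M\<close>;
      it goes into the error.\<close>
    define c where "c = (\<Sum>l\<le>m+1. fact l / 2 ^ (l + 1) * recip_coeff (m + 1 - l))"
    have 1: "(\<lambda>n. H n * R n - D n) \<in> O(\<lambda>n. y n ^ K)"
      unfolding H_def R_def D_def by (rule truncated_product[OF y0])
    have 2: "(\<lambda>n. (v n - H n) * (1 / u n)) \<in> O(\<lambda>n. y n ^ K)"
      using landau_o.big.mult[OF vH bounded[OF ui]] by simp
    have 3: "(\<lambda>n. H n * (1 / u n - R n)) \<in> O(\<lambda>n. y n ^ K)"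
      using landau_o.big.mult[OF bounded[OF H1] uR] by simp
    have "(\<lambda>n. (v n - H n) * (1 / u n) + H n * (1 / u n - R n) + (H n * R n - D n)) \<in> O(\<lambda>n. y n ^ K)"
      by (intro sum_in_bigo(1) 1 2 3)
    also have "(\<lambda>n. y n ^ K) \<in> O(\<lambda>n. y n ^ (m + 1))" by (rule ymono) (simp add: K_def)
    finally have "(\<lambda>n. ((v n - H n) * (1 / u n) + H n * (1 / u n - R n) + (H n * R n - D n)) + c * y n ^ (m + 1)) \<in> O(\<lambda>n. y n ^ (m + 1))"
      by (rule sum_in_bigo(1)) simp_all
    also have "?this \<longleftrightarrow> ?thesis"
    proof (rule landau_o.big.cong_ex[OF eventually_mono[OF ev]]; (elim conjE)?)
      fix n assume n: "1 \<le> n" "1 < x n" "0 < y n"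
      have S: "(\<Sum>k=1..n. real (nth_prime k)) = S n"
        unfolding S_def by (rule sum_nth_prime[OF n(1)])
      have "A n = v n / u n"
        unfolding A_def arith_mean_primes_def S using n
        by (simp add: v_def u_def power2_eq_square field_simps)
      moreover have "D n = M n + c * y n ^ (m + 1)"
      proof -
        have "D n = (\<Sum>i<m+1. (\<Sum>l\<le>i. fact l / 2 ^ (l + 1) * recip_coeff (i - l)) * y n ^ i) + c * y n ^ (m + 1)"
          by (simp add: D_def K_def c_def)
        also have "{..<m+1} = insert 0 {1..m}" by auto
        also have "(\<Sum>i\<in>insert 0 {1..m}. (\<Sum>l\<le>i. fact l / 2 ^ (l + 1) * recip_coeff (i - l)) * y n ^ i) = M n"
        proof -
          have "(\<Sum>i=1..m. (\<Sum>l\<le>i. fact l / 2 ^ (l + 1) * recip_coeff (i - l)) * y n ^ i)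
             = (\<Sum>i=1..m. y n ^ i * (- r_coeff (i + 1) + r_coeff i + (\<Sum>s=1..i-1. r_coeff s * real_of_int (k_coeff (i - s)))))"
            unfolding half_recip_conv by (intro sum.cong refl) (simp add: mult.commute)
          thus ?thesis using half_recip_conv[of 0] by (simp add: M_def)
        qed
        finally show ?thesis .
      qed
      ultimately show "(v n - H n) * (1 / u n) + H n * (1 / u n - R n) + (H n * R n - D n) + c * y n ^ (m + 1) = A n - M n"
        by (simp add: algebra_simps)
    qed auto
    finally show ?thesis .
  qed
  \<comment> \<open>The exact discrepancy: A_n / G_n = A exp (1 + E + T), so that only exp T - 1 =
    O(T) remains to be estimated.\<close>
  define T where "T = (\<lambda>n. ln (x n) - B n - (1 + E n))"
  have E0: "E \<longlonglongrightarrow> 0"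
  proof -
    have "E \<longlonglongrightarrow> (\<Sum>j=1..m. real_of_int (k_coeff j) * 0 ^ j)"
      unfolding E_def by (intro tendsto_intros y0)
    thus ?thesis by simp
  qed
  have T: "T \<in> O(\<lambda>n. y n ^ (m + 1))" using Bexp by (simp add: T_def)
  have T0: "T \<longlonglongrightarrow> 0"
  proof -
    have "(\<lambda>n. y n ^ (m + 1)) \<in> o(\<lambda>_. 1)"
      using tendsto_power[OF y0, of "m + 1"] by (intro smalloI_tendsto) auto
    from landau_o.big_small_trans[OF T this] show ?thesis by (auto dest: smalloD_tendsto)
  qed
  have expT: "(\<lambda>n. exp (T n) - 1) \<in> O(\<lambda>n. y n ^ (m + 1))"
  proof -
    have "(\<lambda>n. exp (T n) - 1) \<in> O(T)"
    proof (rule bigoI[where c=2])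
      have "\<forall>\<^sub>F n in sequentially. \<bar>T n\<bar> < 1" using tendstoD[OF T0, of 1] by simp
      thus "\<forall>\<^sub>F n in sequentially. norm (exp (T n) - 1) \<le> 2 * norm (T n)"
      proof eventually_elim
        case (elim n)
        show ?case
        proof (cases "T n \<ge> 0")
          case True
          hence "exp (T n) \<le> 1 + T n + (T n)\<^sup>2" using elim by (intro exp_bound) auto
          also have "(T n)\<^sup>2 \<le> T n" using True elim by (simp add: power2_eq_square mult_left_le)
          finally show ?thesis using True by simp
        next
          case False
          moreover have "1 + T n \<le> exp (T n)" by (rule exp_ge_add_one_self)
          moreover have "exp (T n) \<le> 1" using False by simp
          ultimately show ?thesis unfolding real_norm_def by linarith
        qed
      qed
    qed
    from landau_o.big_trans[OF this T] show ?thesis .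
  qed
  have A1: "A \<in> O(\<lambda>_. 1)"
  proof -
    have "M \<longlonglongrightarrow> 1/2 + (\<Sum>i=1..m. 0 ^ i * (- r_coeff (i + 1) + r_coeff i + (\<Sum>s=1..i-1. r_coeff s * real_of_int (k_coeff (i - s)))))"
      unfolding M_def by (intro tendsto_intros y0)
    from bounded[OF this] have "M \<in> O(\<lambda>_. 1)" .
    moreover have "(\<lambda>n. A n - M n) \<in> O(\<lambda>_. 1)"
      using landau_o.big_trans[OF AM ymono[of 0 "m + 1"]] by simp
    ultimately have "(\<lambda>n. M n + (A n - M n)) \<in> O(\<lambda>_. 1)" by (rule sum_in_bigo(1))
    thus ?thesis by simp
  qed
  have X1: "(\<lambda>n. exp 1 * exp (E n)) \<in> O(\<lambda>_. 1)"
    by (rule bounded[OF tendsto_mult[OF tendsto_const tendsto_exp[OF E0]]])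
  \<comment> \<open>Splits A e^(1 + E + T) - M e^(1 + E) into the error due to \<open>T\<close> and
    the one due to replacing \<open>A\<close> by \<open>M\<close>.\<close>
  have "(\<lambda>n. A n * (exp 1 * exp (E n)) * (exp (T n) - 1) + (A n - M n) * (exp 1 * exp (E n))) \<in> O(\<lambda>n. y n ^ (m + 1))"
    by (rule sum_in_bigo(1))
       (use landau_o.big.mult[OF landau_o.big.mult[OF A1 X1] expT] landau_o.big.mult[OF AM X1] in simp_all)
  also have "?this \<longleftrightarrow> (\<lambda>n. arith_mean_primes n / geom_mean_primes n - exp 1 * M n * exp (E n)) \<in> O(\<lambda>n. y n ^ (m + 1))"
  proof (rule landau_o.big.cong_ex[OF eventually_mono[OF ev]]; (elim conjE)?)
    fix n assume n: "1 \<le> n" "1 < x n" "0 < y n"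
    have "exp 1 * exp (E n) * exp (T n) = exp (ln (x n) - B n)"
      by (simp add: T_def exp_add[symmetric])
    also have "\<dots> = x n / geom_mean_primes n"
      using n by (simp add: exp_diff B_def geom_mean_eq)
    finally have "A n * (exp 1 * exp (E n) * exp (T n)) = arith_mean_primes n / geom_mean_primes n"
      using n by (simp add: A_def)
    thus "A n * (exp 1 * exp (E n)) * (exp (T n) - 1) + (A n - M n) * (exp 1 * exp (E n)) =
          arith_mean_primes n / geom_mean_primes n - exp 1 * M n * exp (E n)"
      by (simp add: algebra_simps)
  qed auto
  finally show ?thesis
    by (simp add: M_def E_def y_def x_def power_one_over)
qed

end
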